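(* Let $k$ be an uncountable algebraically closed field of characteristic $p>0$. Let $f\in k[[x_1,\dots,x_n]]$ be such that $k[[x_1,\dots,x_n]]/(f)$ is an $(n-1)$-dimensional hypersurface ring, and let $g\in k[[x_1,\dots,x_n]]$ be a formal power series with $g\neq 0$, $g(0)=0$ and $g\notin k\cdot f$. Then there is a subset $\Lambda\subseteq k$, dense in the Zariski topology of $k$, such that for every $\alpha\in\Lambda$, $$\operatorname{e}_{HK}\Big(\frac{k[[x_1,\dots,x_n]]}{(f+\alpha g)}\Big)\le \operatorname{e}_{HK}\Big(\frac{k[[x_1,\dots,x_n]]}{(f)}\Big).$$ (Equivalently, with $R=k[[x_1,\dots,x_n]][t]/(f+tg)$, $t_\alpha=t-\alpha$ and $\mathfrak m_\alpha=(x_1,\dots,x_n,t-\alpha)$, one has $\operatorname{e}_{HK}((R/t_\alpha R)_{\mathfrak m_\alpha})\le \operatorname{e}_{HK}((R/tR)_{\mathfrak m_0})$ for all $\alpha\in\Lambda$.)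
   Context: For a $d$-dimensional Noetherian local ring $(A,\mathfrak m)$ of characteristic $p>0$, $\mathfrak m^{[q]}=(a^q:a\in\mathfrak m)$ for $q=p^e$, and $\operatorname{e}_{HK}(A)=\lim_{q\to\infty}\lambda(A/\mathfrak m^{[q]})/q^d$, where $\lambda$ denotes length. *)

theory Defs
  imports "HOL-Computational_Algebra.Polynomial" "HOL-Library.Extended_Nat" Complex_Main
begin

text \<open>Formal power series ring k[[x_0,...,x_(n-1)]]: a series is a coefficient function
  on exponent vectors (nat => nat); elements of the ring in n variables are those
  whose coefficients vanish on exponent vectors involving a variable index >= n.\<close>

type_synonym 'a mps = "(nat \<Rightarrow> nat) \<Rightarrow> 'a"

definition ps_ring :: "nat \<Rightarrow> 'a::zero mps set" where
  "ps_ring n = {F. \<forall>e. (\<exists>i\<ge>n. e i \<noteq> 0) \<longrightarrow> F e = 0}"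

definition ps_zero :: "'a::zero mps" where
  "ps_zero = (\<lambda>e. 0)"

definition ps_one :: "'a::{zero,one} mps" where
  "ps_one = (\<lambda>e. if e = (\<lambda>_. 0) then 1 else 0)"

definition ps_add :: "'a::plus mps \<Rightarrow> 'a mps \<Rightarrow> 'a mps" where
  "ps_add F G = (\<lambda>e. F e + G e)"

definition ps_smult :: "'a::times \<Rightarrow> 'a mps \<Rightarrow> 'a mps" where
  "ps_smult c F = (\<lambda>e. c * F e)"

definition ps_mult :: "'a::comm_ring_1 mps \<Rightarrow> 'a mps \<Rightarrow> 'a mps" where
  "ps_mult F G = (\<lambda>e. \<Sum>d\<in>{d. \<forall>i. d i \<le> e i}. F d * G (\<lambda>i. e i - d i))"

definition ps_pow :: "'a::comm_ring_1 mps \<Rightarrow> nat \<Rightarrow> 'a mps" where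
  "ps_pow F m = ((ps_mult F) ^^ m) ps_one"

definition ps_const_term :: "'a mps \<Rightarrow> 'a" where
  "ps_const_term F = F (\<lambda>_. 0)"

definition ps_ideal :: "nat \<Rightarrow> 'a::comm_ring_1 mps set \<Rightarrow> bool" where
  "ps_ideal n I \<longleftrightarrow> I \<subseteq> ps_ring n \<and> ps_zero \<in> I \<and>
     (\<forall>F\<in>I. \<forall>G\<in>I. ps_add F G \<in> I) \<and>
     (\<forall>F\<in>I. \<forall>H\<in>ps_ring n. ps_mult H F \<in> I)"

definition ps_gen :: "nat \<Rightarrow> 'a::comm_ring_1 mps set \<Rightarrow> 'a mps set" where
  "ps_gen n S = \<Inter>{I. ps_ideal n I \<and> S \<subseteq> I}"

definition ps_prime :: "nat \<Rightarrow> 'a::comm_ring_1 mps set \<Rightarrow> bool" where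
  "ps_prime n P \<longleftrightarrow> ps_ideal n P \<and> P \<noteq> ps_ring n \<and>
     (\<forall>F\<in>ps_ring n. \<forall>G\<in>ps_ring n. ps_mult F G \<in> P \<longrightarrow> F \<in> P \<or> G \<in> P)"

text \<open>Length of the module R/J (R = k[[x]]): supremum of lengths of strict chains of
  submodules of R/J, i.e. strict chains of ideals J = C_0 < C_1 < ... < C_l = R.\<close>
definition ps_quot_length :: "nat \<Rightarrow> 'a::comm_ring_1 mps set \<Rightarrow> enat" where
  "ps_quot_length n J = Sup {enat l | l. \<exists>C :: nat \<Rightarrow> 'a mps set.
      C 0 = J \<and> C l = ps_ring n \<and> (\<forall>i\<le>l. ps_ideal n (C i)) \<and>
      (\<forall>i<l. C i \<subset> C (Suc i))}"

definition ps_quot_dim :: "nat \<Rightarrow> 'a::comm_ring_1 mps set \<Rightarrow> enat" where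
  "ps_quot_dim n J = Sup {enat l | l. \<exists>C :: nat \<Rightarrow> 'a mps set.
      (\<forall>i\<le>l. ps_prime n (C i) \<and> J \<subseteq> C i) \<and> (\<forall>i<l. C i \<subset> C (Suc i))}"

text \<open>Maximal ideal of R and the Frobenius power: preimage in R of m_A^[q] for
  A = R/J is J + (a^q : a in m).\<close>
definition ps_max_ideal :: "nat \<Rightarrow> 'a::comm_ring_1 mps set" where
  "ps_max_ideal n = {F \<in> ps_ring n. ps_const_term F = 0}"

definition ps_frob_quot :: "nat \<Rightarrow> 'a::comm_ring_1 mps set \<Rightarrow> nat \<Rightarrow> 'a mps set" where
  "ps_frob_quot n J q = ps_gen n (J \<union> {ps_pow F q | F. F \<in> ps_max_ideal n})"

definition eHK :: "nat \<Rightarrow> 'a::comm_ring_1 mps set \<Rightarrow> real" where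
  "eHK n J = lim (\<lambda>e. real (the_enat (ps_quot_length n (ps_frob_quot n J (CHAR('a) ^ e))))
                      / real (CHAR('a) ^ e) ^ the_enat (ps_quot_dim n J))"

definition zariski_closed :: "'a::field set \<Rightarrow> bool" where
  "zariski_closed S \<longleftrightarrow> (\<exists>P :: 'a poly set. S = {x. \<forall>p\<in>P. poly p x = 0})"

definition zariski_dense :: "'a::field set \<Rightarrow> bool" where
  "zariski_dense L \<longleftrightarrow> (\<forall>S. zariski_closed S \<and> L \<subseteq> S \<longrightarrow> S = UNIV)"

end

theory Submission
  imports Defs "HOL-Library.Multiset" "HOL-Library.Infinite_Set" "HOL-Computational_Algebra.Primes"
begin

text \<open>
  Write \<open>R\<close> for the power series ring, \<open>J\<^sub>q = (x\<^sub>1\<^sup>q, \<dots>, x\<^sub>n\<^sup>q)\<close> and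
  \<open>a\<^sub>q(f)\<close> for the length of \<open>R / (J\<^sub>q + (f))\<close>. On the finite-dimensional space \<open>R / J\<^sub>q\<close>,
  multiplication by \<open>f + \<alpha>g\<close> is affine linear in \<open>\<alpha>\<close>, so its rank falls below the rank at
  \<open>\<alpha> = 0\<close> only for finitely many \<open>\<alpha>\<close>. Hence, outside a countable set of \<open>\<alpha>\<close>,
  \<open>a\<^sub>q(f + \<alpha>g) \<le> a\<^sub>q(f)\<close> for all powers \<open>q\<close> of \<open>p\<close>.

  The normalised lengths converge: freeness of Frobenius and the filtration of
  \<open>R / (J\<^sub>p\<^sub>q + (f\<^sup>p))\<close> by powers of \<open>f\<close> give \<open>p\<^sup>n a\<^sub>q(f) \<le> p a\<^sub>p\<^sub>q(f)\<close>, so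
  \<open>a\<^sub>q(f) / q\<^bsup>n-1\<^esup>\<close> is nondecreasing, and it is bounded because monomial multiples of \<open>f\<close> have
  distinct leading exponents.

  For \<open>f + \<alpha>g\<close> it suffices to know that the quotient has dimension \<open>n - 1\<close> or \<open>n\<close>, since in the
  latter case the normalised limit is 0. The lower bound holds because an ideal that is maximal
  among those whose truncated colength grows at a given rate is prime, while adding an element of
  the maximal ideal lowers the rate by at most one degree. For the upper bound, an Artin--Rees
  estimate shows that each step of a chain of primes raises the rate of growth by one degree.
\<close>

section \<open>Relative dimension of subspaces\<close>

text \<open>Two features of the definitions shape the proof. \<open>eHK\<close> takes
  \<open>lim\<close>, unspecified on divergent sequences, and its exponent passes through
  \<open>the_enat\<close>, unspecified at infinity. So convergence is needed for f and for f +
  \<alpha>g, and the dimension belonging to f + \<alpha>g, about which nothing is assumed, must be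
  shown finite and at least n - 1. Rank semicontinuity excludes finitely many parameters for each q,
  but the excluded set depends on q; the uncountability of k leaves parameters good for all q at
  once. That g is no multiple of f keeps f + \<alpha>g nonzero, which gives the upper bound on the
  lengths; g(0) = 0 keeps it in the maximal ideal, which gives the initial value 1 from which the
  lower bound is propagated. Since k lies in R and is its residue field, lengths are k-dimensions
  and linear algebra replaces module theory. The order \<open>nu\<close> serves twice: truncation by
  it gives ideals of finite colength that multiply like powers of the maximal ideal, and division by
  it gives standard bases with controlled multipliers, as Artin--Rees requires.\<close>

locale vspace = vector_space scale
  for scale :: "'a::field \<Rightarrow> 'b::ab_group_add \<Rightarrow> 'b" (infixr \<open>*s\<close> 75)
begin

text \<open>For a subspace U of W, the dimension of W/U without a quotient space. It carries meaning
  only under \<open>fin_codim\<close>; otherwise \<open>LEAST\<close> ranges over an empty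
  condition.\<close>

definition rel_dim :: "'b set \<Rightarrow> 'b set \<Rightarrow> nat" where
  "rel_dim W U = (LEAST d. \<exists>S. finite S \<and> card S = d \<and> S \<subseteq> W \<and> W \<subseteq> span (U \<union> S))"

definition fin_codim :: "'b set \<Rightarrow> 'b set \<Rightarrow> bool" where
  "fin_codim W U \<longleftrightarrow> (\<exists>S. finite S \<and> S \<subseteq> W \<and> W \<subseteq> span (U \<union> S))"

text \<open>Stated for an indexed family, so that the image of a basis under a linear map can be
  treated without first proving the map injective on it.\<close>

definition indep_mod :: "'b set \<Rightarrow> 'i set \<Rightarrow> ('i \<Rightarrow> 'b) \<Rightarrow> bool" where
  "indep_mod U X v \<longleftrightarrow> (\<forall>c. (\<Sum>i\<in>X. c i *s v i) \<in> U \<longrightarrow> (\<forall>i\<in>X. c i = 0))"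

lemma sum_scale_single:
  assumes "finite X" "i \<in> X"
  shows "(\<Sum>j\<in>X. (if j = i then 1 else 0) *s v j) = v i"
proof -
  have "(\<Sum>j\<in>X - {i}. (if j = i then 1 else 0) *s v j) = 0"
    by (rule sum.neutral) auto
  with assms show ?thesis by (simp add: sum.remove[of X i])
qed

lemma indep_modD: "indep_mod U X v \<Longrightarrow> (\<Sum>i\<in>X. c i *s v i) \<in> U \<Longrightarrow> i \<in> X \<Longrightarrow> c i = 0"
  unfolding indep_mod_def by blast

lemma indep_mod_notin:
  assumes "indep_mod U X v" "finite X" "i \<in> X"
  shows "v i \<notin> U"
proof
  assume "v i \<in> U"
  then have "(\<Sum>j\<in>X. (if j = i then 1 else 0) *s v j) \<in> U"
    by (subst sum_scale_single[OF assms(2,3)])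
  from indep_modD[OF assms(1) this assms(3)] show False by simp
qed

lemma in_span_Un_insertE:
  assumes "x \<in> span (U \<union> insert s S)"
  obtains k where "x - k *s s \<in> span (U \<union> S)"
  using assms by (auto simp: span_breakdown_eq)

text \<open>Steinitz exchange modulo U, by induction on the spanning set. If some family member has
  a nonzero coefficient at the new spanning vector s, it serves as pivot and is sacrificed to remove
  s from all the others.\<close>

lemma indep_mod_card_le:
  assumes "finite S" "finite X" "subspace U" "indep_mod U X v" "v ` X \<subseteq> span (U \<union> S)"
  shows "card X \<le> card S"
  using assms
proof (induction S arbitrary: X v rule: finite_induct)
  case empty
  have "i \<notin> X" for i
  proof
    assume "i \<in> X"
    have "span U = U" using empty.prems by (simp add: span_eq_iff)
    with empty.prems \<open>i \<in> X\<close> have "v i \<in> U" by auto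
    with indep_mod_notin[OF empty.prems(3,1) \<open>i \<in> X\<close>] show False by contradiction
  qed
  then have "X = {}" by blast
  then show ?case by simp
next
  case (insert s S)
  have "\<forall>i\<in>X. \<exists>k. v i - k *s s \<in> span (U \<union> S)"
    using insert.prems(4) by (meson image_subset_iff in_span_Un_insertE)
  then obtain k where k: "\<And>i. i \<in> X \<Longrightarrow> v i - k i *s s \<in> span (U \<union> S)"
    by metis
  show ?case
  proof (cases "\<forall>i\<in>X. k i = 0")
    case True
    then have "v ` X \<subseteq> span (U \<union> S)" using k by fastforce
    with insert have "card X \<le> card S" by blast
    then show ?thesis using insert by simp
  next
    case False
    then obtain i0 where i0: "i0 \<in> X" "k i0 \<noteq> 0" by blast
    define w where "w i = v i - (k i / k i0) *s v i0" for i
    have "indep_mod U (X - {i0}) w"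
      unfolding indep_mod_def
    proof (intro allI impI)
      fix c assume c: "(\<Sum>i\<in>X - {i0}. c i *s w i) \<in> U"
      \<comment> \<open>The coefficient at \<open>i0\<close> collects the pivot multiples hidden in
        the \<open>w i\<close>, so that both combinations have the same value.\<close>
      define c' where "c' i = (if i = i0 then - (\<Sum>i\<in>X - {i0}. c i * (k i / k i0)) else c i)" for i
      have "(\<Sum>i\<in>X. c' i *s v i) = c' i0 *s v i0 + (\<Sum>i\<in>X - {i0}. c' i *s v i)"
        using i0 insert.prems(1) by (simp add: sum.remove)
      also have "(\<Sum>i\<in>X - {i0}. c' i *s v i) = (\<Sum>i\<in>X - {i0}. c i *s v i)"
        by (rule sum.cong) (auto simp: c'_def)
      also have "c' i0 *s v i0 + (\<Sum>i\<in>X - {i0}. c i *s v i) = (\<Sum>i\<in>X - {i0}. c i *s w i)"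
        by (simp add: c'_def w_def scale_right_diff_distrib sum_subtractf scale_sum_left)
      finally have "(\<Sum>i\<in>X. c' i *s v i) \<in> U" using c by simp
      then have "\<forall>i\<in>X. c' i = 0" by (intro ballI indep_modD[OF insert.prems(3)])
      moreover have "c' i = c i" if "i \<noteq> i0" for i using that by (simp add: c'_def)
      ultimately show "\<forall>i\<in>X - {i0}. c i = 0" by fastforce
    qed
    moreover have "w ` (X - {i0}) \<subseteq> span (U \<union> S)"
    proof (rule image_subsetI)
      fix i assume "i \<in> X - {i0}"
      then have "i \<in> X" by simp
      have "w i = (v i - k i *s s) - (k i / k i0) *s (v i0 - k i0 *s s)"
        using i0 by (simp add: w_def scale_right_diff_distrib)
      then show "w i \<in> span (U \<union> S)"
        using k \<open>i \<in> X\<close> i0 by (metis span_diff span_scale)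
    qed
    ultimately have "card (X - {i0}) \<le> card S"
      using insert by (meson finite_Diff)
    then show ?thesis using i0 insert by (simp add: card_Diff_singleton)
  qed
qed

lemma rel_dim_le:
  assumes "finite S" "S \<subseteq> W" "W \<subseteq> span (U \<union> S)"
  shows "rel_dim W U \<le> card S"
  unfolding rel_dim_def by (rule Least_le) (use assms in blast)

text \<open>A spanning set of least size is independent: a relation with a nonzero coefficient at s
  puts s into the span of the rest and allows it to be dropped.\<close>

lemma fin_codim_basis:
  assumes "fin_codim W U" "subspace U"
  obtains S where "finite S" "card S = rel_dim W U" "S \<subseteq> W" "W \<subseteq> span (U \<union> S)"
    "indep_mod U S (\<lambda>x. x)"
proof -
  have "\<exists>d S. finite S \<and> card S = d \<and> S \<subseteq> W \<and> W \<subseteq> span (U \<union> S)"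
    using assms unfolding fin_codim_def by blast
  then have "\<exists>S. finite S \<and> card S = rel_dim W U \<and> S \<subseteq> W \<and> W \<subseteq> span (U \<union> S)"
    unfolding rel_dim_def by (rule LeastI_ex)
  then obtain S where S: "finite S" "card S = rel_dim W U" "S \<subseteq> W" "W \<subseteq> span (U \<union> S)"
    by blast
  have "indep_mod U S (\<lambda>x. x)"
    unfolding indep_mod_def
  proof (intro allI impI ballI, rule ccontr)
    fix c s assume c: "(\<Sum>i\<in>S. c i *s i) \<in> U" and s: "s \<in> S" "c s \<noteq> 0"
    let ?T = "span (U \<union> (S - {s}))"
    have "c s *s s = (\<Sum>i\<in>S. c i *s i) - (\<Sum>i\<in>S - {s}. c i *s i)"
      using S(1) s by (simp add: sum.remove)
    moreover have "(\<Sum>i\<in>S. c i *s i) \<in> ?T" using c by (auto intro: span_base)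
    moreover have "(\<Sum>i\<in>S - {s}. c i *s i) \<in> ?T" by (rule span_sum, rule span_scale, rule span_base) simp
    ultimately have "c s *s s \<in> ?T" by (simp add: span_diff)
    then have "inverse (c s) *s (c s *s s) \<in> ?T" by (rule span_scale)
    then have "s \<in> ?T" using s by simp
    then have "U \<union> S \<subseteq> ?T" by (auto intro: span_base)
    then have "span (U \<union> S) \<subseteq> ?T" by (simp add: span_minimal)
    then have "rel_dim W U \<le> card (S - {s})" using S by (intro rel_dim_le) auto
    with S(2) card_Diff1_less[OF S(1) s(1)] show False by linarith
  qed
  with S show ?thesis using that by blast
qed

lemma rel_dim_ge:
  assumes "fin_codim W U" "subspace U" "finite X" "indep_mod U X v" "v ` X \<subseteq> W"
  shows "card X \<le> rel_dim W U"
proof -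
  obtain S where "finite S" "card S = rel_dim W U" "S \<subseteq> W" "W \<subseteq> span (U \<union> S)"
    using fin_codim_basis assms(1,2) by metis
  moreover from this have "v ` X \<subseteq> span (U \<union> S)" using assms(5) by blast
  ultimately show ?thesis using assms indep_mod_card_le[of S X U v] by simp
qed

lemma indep_mod_insert:
  assumes "indep_mod U T (\<lambda>x. x)" "finite T" "subspace U" "x \<notin> span (U \<union> T)"
  shows "indep_mod U (insert x T) (\<lambda>x. x)"
  unfolding indep_mod_def
proof (intro allI impI)
  fix c assume c: "(\<Sum>i\<in>insert x T. c i *s i) \<in> U"
  have xT: "x \<notin> T" using assms(4) by (meson UnCI span_base)
  have "c x = 0"
  proof (rule ccontr)
    assume "c x \<noteq> 0"
    have "c x *s x = (\<Sum>i\<in>insert x T. c i *s i) - (\<Sum>i\<in>T. c i *s i)"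
      using xT assms(2) by simp
    moreover have "(\<Sum>i\<in>insert x T. c i *s i) \<in> span (U \<union> T)"
      using c by (auto intro: span_base)
    moreover have "(\<Sum>i\<in>T. c i *s i) \<in> span (U \<union> T)"
      by (rule span_sum, rule span_scale, rule span_base) simp
    ultimately have "c x *s x \<in> span (U \<union> T)" by (simp add: span_diff)
    then have "inverse (c x) *s (c x *s x) \<in> span (U \<union> T)" by (rule span_scale)
    with \<open>c x \<noteq> 0\<close> assms(4) show False by simp
  qed
  then have "(\<Sum>i\<in>T. c i *s i) \<in> U" using c xT assms(2) by simp
  then have "\<forall>i\<in>T. c i = 0" by (intro ballI indep_modD[OF assms(1)])
  with \<open>c x = 0\<close> show "\<forall>i\<in>insert x T. c i = 0" by simp
qed

text \<open>Independent subsets of V modulo U have bounded size by \<open>indep_mod_card_le\<close>;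
  one of maximal size spans V, since anything outside its span could be added.\<close>

lemma fin_codim_sub:
  assumes "fin_codim W U" "subspace U" "V \<subseteq> W"
  shows "fin_codim V U"
proof -
  obtain S where S: "finite S" "W \<subseteq> span (U \<union> S)"
    using assms(1) unfolding fin_codim_def by blast
  let ?P = "\<lambda>d. \<exists>T. finite T \<and> card T = d \<and> T \<subseteq> V \<and> indep_mod U T (\<lambda>x. x)"
  have P0: "?P 0" by (intro exI [of _ "{}"]) (simp add: indep_mod_def)
  have bnd: "d \<le> card S" if Pd: "?P d" for d
  proof -
    obtain T where T: "finite T" "card T = d" "T \<subseteq> V" "indep_mod U T (\<lambda>x. x)"
      using Pd by blast
    have "(\<lambda>x. x) ` T \<subseteq> span (U \<union> S)" using T S assms(3) by auto
    then show ?thesis using indep_mod_card_le[OF S(1) T(1) assms(2) T(4)] T(2) by simp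
  qed
  have "\<exists>d. ?P d \<and> (\<forall>y. ?P y \<longrightarrow> y \<le> d)"
    by (rule ex_has_greatest_nat[of ?P 0 "\<lambda>x. x" "Suc (card S)", OF P0]) (use bnd less_Suc_eq_le in blast)
  then obtain d where d: "?P d" "\<And>d'. ?P d' \<Longrightarrow> d' \<le> d" by (elim exE conjE) blast
  then obtain T where T: "finite T" "card T = d" "T \<subseteq> V" "indep_mod U T (\<lambda>x. x)" by blast
  have "V \<subseteq> span (U \<union> T)"
  proof (rule subsetI, rule ccontr)
    fix x assume x: "x \<in> V" "x \<notin> span (U \<union> T)"
    then have "x \<notin> T" by (meson UnCI span_base)
    with T have "finite (insert x T) \<and> card (insert x T) = Suc d \<and> insert x T \<subseteq> V \<and> indep_mod U (insert x T) (\<lambda>x. x)"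
      using x(1) indep_mod_insert[OF T(4,1) assms(2) x(2)] by (intro conjI) simp_all
    then have "?P (Suc d)" by (rule exI)
    from d(2)[OF this] show False by simp
  qed
  with T show ?thesis unfolding fin_codim_def by blast
qed

lemma fin_codim_mono:
  assumes "fin_codim W U" "U \<subseteq> V"
  shows "fin_codim W V"
proof -
  obtain S where S: "finite S" "S \<subseteq> W" "W \<subseteq> span (U \<union> S)"
    using assms(1) unfolding fin_codim_def by blast
  have "span (U \<union> S) \<subseteq> span (V \<union> S)" using assms(2) by (intro span_mono) auto
  with S show ?thesis unfolding fin_codim_def by blast
qed

text \<open>Bases of V/U and of W/V together form a basis of W/U.\<close>

lemma rel_dim_add:
  assumes "fin_codim W U" "subspace U" "subspace V" "subspace W" "U \<subseteq> V" "V \<subseteq> W"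
  shows "rel_dim W U = rel_dim W V + rel_dim V U"
proof -
  obtain S where S: "finite S" "card S = rel_dim V U" "S \<subseteq> V" "V \<subseteq> span (U \<union> S)"
    "indep_mod U S (\<lambda>x. x)"
    using fin_codim_basis[OF fin_codim_sub[OF assms(1,2,6)] assms(2)] by metis
  obtain T where T: "finite T" "card T = rel_dim W V" "T \<subseteq> W" "W \<subseteq> span (V \<union> T)"
    "indep_mod V T (\<lambda>x. x)"
    using fin_codim_basis[OF fin_codim_mono[OF assms(1,5)] assms(3)] by metis
  have "span (V \<union> T) \<subseteq> span (U \<union> (S \<union> T))"
  proof (rule span_minimal)
    have "span (U \<union> S) \<subseteq> span (U \<union> (S \<union> T))" by (rule span_mono) auto
    then show "V \<union> T \<subseteq> span (U \<union> (S \<union> T))" using S(4) by (auto intro: span_base)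
  qed auto
  then have "rel_dim W U \<le> card (S \<union> T)"
    using S T assms by (intro rel_dim_le) auto
  also have "\<dots> \<le> card T + card S" by (simp add: card_Un_le add.commute)
  finally have 1: "rel_dim W U \<le> rel_dim W V + rel_dim V U" using S T by simp
  \<comment> \<open>Members of T are nonzero modulo V, whereas S lies in V.\<close>
  have disj: "S \<inter> T = {}"
  proof (rule ccontr)
    assume "S \<inter> T \<noteq> {}"
    then obtain x where x: "x \<in> T" "x \<in> V" using S by blast
    with indep_mod_notin[OF T(5,1) x(1)] show False by simp
  qed
  have "indep_mod U (S \<union> T) (\<lambda>x. x)"
    unfolding indep_mod_def
  proof (intro allI impI)
    fix c assume c: "(\<Sum>i\<in>S \<union> T. c i *s i) \<in> U"
    have eq: "(\<Sum>i\<in>S \<union> T. c i *s i) = (\<Sum>i\<in>S. c i *s i) + (\<Sum>i\<in>T. c i *s i)"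
      using S T disj by (simp add: sum.union_disjoint)
    have "(\<Sum>i\<in>S. c i *s i) \<in> V"
      by (rule subspace_sum[OF assms(3)]) (use S(3) assms(3) subspace_scale in blast)
    moreover have "(\<Sum>i\<in>S \<union> T. c i *s i) \<in> V" using c assms by blast
    ultimately have "(\<Sum>i\<in>S \<union> T. c i *s i) - (\<Sum>i\<in>S. c i *s i) \<in> V"
      by (intro subspace_diff[OF assms(3)])
    then have "(\<Sum>i\<in>T. c i *s i) \<in> V" unfolding eq by simp
    then have cT: "\<forall>i\<in>T. c i = 0" by (intro ballI indep_modD[OF T(5)])
    then have "(\<Sum>i\<in>S. c i *s i) \<in> U" using eq c by simp
    then have "\<forall>i\<in>S. c i = 0" by (intro ballI indep_modD[OF S(5)])
    with cT show "\<forall>i\<in>S \<union> T. c i = 0" by blast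
  qed
  then have "card (S \<union> T) \<le> rel_dim W U"
    using S T assms by (intro rel_dim_ge[of _ _ _ "\<lambda>x. x"]) auto
  then show ?thesis using 1 S T disj by (simp add: card_Un_disjoint)
qed

lemma rel_dim_eq_0_iff:
  assumes "fin_codim W U" "subspace U"
  shows "rel_dim W U = 0 \<longleftrightarrow> W \<subseteq> U"
proof
  assume "rel_dim W U = 0"
  then obtain S where "finite S" "card S = 0" "W \<subseteq> span (U \<union> S)"
    using fin_codim_basis[OF assms] by metis
  moreover have "span U = U" using assms(2) by (simp add: span_eq_iff)
  ultimately show "W \<subseteq> U" by simp
next
  assume "W \<subseteq> U"
  then show "rel_dim W U = 0" using rel_dim_le[of "{}" W U] span_superset[of U] by auto
qed

text \<open>The isomorphism between R modulo the preimage of U and W/U induced by T. It is applied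
  to multiplication by a series, where the preimage is a colon ideal.\<close>

lemma rel_dim_map:
  assumes lin: "\<And>x y. T (x + y) = T x + T y" "\<And>c x. T (c *s x) = c *s T x"
    and sub: "subspace R" "subspace U" "subspace W"
    and UW: "U \<subseteq> W" and TR: "T ` R \<subseteq> W" and surj: "\<And>w. w \<in> W \<Longrightarrow> \<exists>r\<in>R. w - T r \<in> U"
    and fin: "fin_codim R {v \<in> R. T v \<in> U}"
  shows "rel_dim W U = rel_dim R {v \<in> R. T v \<in> U}" "fin_codim W U"
proof -
  let ?K = "{v \<in> R. T v \<in> U}"
  have T0: "T 0 = 0" using lin(2)[of 0 0] by simp
  have Tsum: "T (\<Sum>i\<in>X. c i *s f i) = (\<Sum>i\<in>X. c i *s T (f i))" for X c and f :: "'b \<Rightarrow> 'b"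
    by (induction X rule: infinite_finite_induct) (auto simp: T0 lin)
  have sK: "subspace ?K"
    using sub by (auto simp: subspace_def T0 lin)
  obtain S where S: "finite S" "card S = rel_dim R ?K" "S \<subseteq> R" "R \<subseteq> span (?K \<union> S)"
    "indep_mod ?K S (\<lambda>x. x)"
    by (rule fin_codim_basis[OF fin sK])
  have sp: "W \<subseteq> span (U \<union> T ` S)"
  proof
    fix w assume "w \<in> W"
    then obtain r where r: "r \<in> R" "w - T r \<in> U" using surj by blast
    have "r \<in> span (?K \<union> S)" using r S by blast
    moreover have "subspace {r. T r \<in> span (U \<union> T ` S)}"
      by (auto simp: subspace_def T0 lin span_zero intro: span_add span_scale)
    moreover have "?K \<union> S \<subseteq> {r. T r \<in> span (U \<union> T ` S)}" by (auto intro: span_base)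
    ultimately have "T r \<in> span (U \<union> T ` S)" using span_minimal by blast
    moreover have "w - T r \<in> span (U \<union> T ` S)" using r by (auto intro: span_base)
    ultimately have "(w - T r) + T r \<in> span (U \<union> T ` S)" by (intro span_add)
    then show "w \<in> span (U \<union> T ` S)" by simp
  qed
  have TS: "T ` S \<subseteq> W" "finite (T ` S)" using TR S by blast+
  with sp show f: "fin_codim W U" unfolding fin_codim_def by blast
  have "rel_dim W U \<le> card (T ` S)" using sp TS by (intro rel_dim_le)
  also have "\<dots> \<le> rel_dim R ?K" using S by (metis card_image_le)
  finally have 1: "rel_dim W U \<le> rel_dim R ?K" .
  have "indep_mod U S T"
    unfolding indep_mod_def
  proof (intro allI impI)
    fix c assume "(\<Sum>i\<in>S. c i *s T i) \<in> U"
    then have "T (\<Sum>i\<in>S. c i *s i) \<in> U" by (simp add: Tsum)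
    moreover have "(\<Sum>i\<in>S. c i *s i) \<in> R"
      by (rule subspace_sum[OF sub(1)]) (use S(3) sub(1) subspace_scale in blast)
    ultimately have "(\<Sum>i\<in>S. c i *s i) \<in> ?K" by simp
    then show "\<forall>i\<in>S. c i = 0" by (intro ballI indep_modD[OF S(5)])
  qed
  then have "card S \<le> rel_dim W U" using f sub S TS by (intro rel_dim_ge)
  with 1 S show "rel_dim W U = rel_dim R ?K" by simp
qed

end

section \<open>Power series as functions on multisets of variables\<close>

text \<open>Indexing by multisets makes every exponent finitely supported, so the Cauchy product is
  a finite sum. A separate type can be made an instance of \<open>comm_ring_1\<close>, which gives
  access to \<open>freshmans_dream\<close>.\<close>

typedef 'a ser = "UNIV :: (nat multiset \<Rightarrow> 'a) set"
  morphisms coef Ser ..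

lemma coef_Ser [simp]: "coef (Ser f) = f"
  by (simp add: Ser_inverse)

lemma ser_eqI: "(\<And>e. coef F e = coef G e) \<Longrightarrow> F = G"
  by (metis coef_inverse ext)

definition splits :: "nat multiset \<Rightarrow> (nat multiset \<times> nat multiset) set" where
  "splits e = {(a, b). a + b = e}"

lemma finite_submultisets: "finite {d. d \<subseteq># (e :: 'b multiset)}"
proof (induction e)
  case (add x e)
  have "{d. d \<subseteq># add_mset x e} \<subseteq> {d. d \<subseteq># e} \<union> add_mset x ` {d. d \<subseteq># e}"
  proof
    fix d assume d: "d \<in> {d. d \<subseteq># add_mset x e}"
    show "d \<in> {d. d \<subseteq># e} \<union> add_mset x ` {d. d \<subseteq># e}"
    proof (cases "x \<in># d")
      case True
      then obtain d' where "d = add_mset x d'" by (meson multi_member_split)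
      with d show ?thesis by auto
    next
      case False
      with d have "d \<subseteq># e"
        by (metis mem_Collect_eq diff_single_trivial subset_eq_diff_conv add_mset_add_single)
      then show ?thesis by blast
    qed
  qed
  with add show ?case by (meson finite_UnI finite_imageI finite_subset)
qed simp

lemma splits_eq: "splits e = (\<lambda>d. (d, e - d)) ` {d. d \<subseteq># e}"
  by (auto simp: splits_def image_iff subset_mset.add_diff_inverse)

lemma finite_splits [simp]: "finite (splits e)"
  by (simp add: splits_eq finite_submultisets)

lemma sum_splits: "(\<Sum>(a, b)\<in>splits e. f a b) = (\<Sum>d\<in>{d. d \<subseteq># e}. f d (e - d))"
  unfolding splits_eq by (subst sum.reindex) (auto simp: inj_on_def)

instantiation ser :: (comm_ring_1) comm_ring_1
begin

definition "0 = Ser (\<lambda>_. 0)"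
definition "1 = Ser (\<lambda>e. if e = {#} then 1 else 0)"
definition "F + G = Ser (\<lambda>e. coef F e + coef G e)"
definition "F - G = Ser (\<lambda>e. coef F e - coef G e)"
definition "- F = Ser (\<lambda>e. - coef F e)"
definition "F * G = Ser (\<lambda>e. \<Sum>(a, b)\<in>splits e. coef F a * coef G b)"

instance
proof
  fix F G H :: "'a ser"
  show "F * G * H = F * (G * H)"
  proof (rule ser_eqI)
    fix e
    have "coef (F * G * H) e =
      (\<Sum>(x, y)\<in>(SIGMA x:splits e. splits (fst x)). coef F (fst y) * coef G (snd y) * coef H (snd x))"
      by (simp add: times_ser_def case_prod_unfold sum_distrib_right sum.Sigma)
    also have "\<dots> = (\<Sum>(x, y)\<in>(SIGMA x:splits e. splits (snd x)). coef F (fst x) * (coef G (fst y) * coef H (snd y)))"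
      by (rule sum.reindex_bij_witness[of _ "\<lambda>((a, d), (b, c)). ((a + b, c), (a, b))"
            "\<lambda>((d, c), (a, b)). ((a, b + c), (b, c))"]) (auto simp: splits_def ac_simps)
    also have "\<dots> = coef (F * (G * H)) e"
      by (simp add: times_ser_def case_prod_unfold sum_distrib_left sum.Sigma)
    finally show "coef (F * G * H) e = coef (F * (G * H)) e" .
  qed
  show "F * G = G * F"
    unfolding times_ser_def
    by (rule arg_cong[of _ _ Ser], rule ext,
        rule sum.reindex_bij_witness[of _ "\<lambda>(a, b). (b, a)" "\<lambda>(a, b). (b, a)"])
       (auto simp: splits_def ac_simps)
  show "1 * F = F"
  proof (rule ser_eqI)
    fix e
    have "coef (1 * F) e = (\<Sum>d\<in>{d. d \<subseteq># e}. (if d = {#} then 1 else 0) * coef F (e - d))"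
      by (simp add: times_ser_def one_ser_def sum_splits)
    also have "\<dots> = (\<Sum>d\<in>{d. d \<subseteq># e}. if {#} = d then coef F (e - d) else 0)"
      by (rule sum.cong) auto
    also have "\<dots> = coef F e"
      by (simp add: finite_submultisets)
    finally show "coef (1 * F) e = coef F e" .
  qed
  show "(F + G) * H = F * H + G * H"
    by (simp add: times_ser_def plus_ser_def case_prod_unfold distrib_right sum.distrib)
  show "(0 :: 'a ser) \<noteq> 1"
  proof
    assume "(0 :: 'a ser) = 1"
    then have "coef (0 :: 'a ser) {#} = coef 1 {#}" by simp
    then show False by (simp add: zero_ser_def one_ser_def)
  qed
qed (simp_all add: plus_ser_def zero_ser_def minus_ser_def uminus_ser_def ac_simps coef_inverse)

end

lemma coef_0 [simp]: "coef 0 e = 0"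
  by (simp add: zero_ser_def)

lemma coef_1: "coef 1 e = (if e = {#} then 1 else 0)"
  by (simp add: one_ser_def)

lemma coef_add [simp]: "coef (F + G) e = coef F e + coef G e"
  by (simp add: plus_ser_def)

lemma coef_diff [simp]: "coef (F - G) e = coef F e - coef G e"
  by (simp add: minus_ser_def)

lemma coef_uminus [simp]: "coef (- F) e = - coef F e"
  by (simp add: uminus_ser_def)

lemma coef_mult: "coef (F * G) e = (\<Sum>(a, b)\<in>splits e. coef F a * coef G b)"
  by (simp add: times_ser_def)

lemma coef_sum [simp]: "coef (sum f A) e = (\<Sum>i\<in>A. coef (f i) e)"
  by (induction A rule: infinite_finite_induct) auto

definition scale_ser :: "'a::comm_ring_1 \<Rightarrow> 'a ser \<Rightarrow> 'a ser" where
  "scale_ser c F = Ser (\<lambda>e. c * coef F e)"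

lemma coef_scale_ser [simp]: "coef (scale_ser c F) e = c * coef F e"
  by (simp add: scale_ser_def)

lemma scale_ser_mult:
  fixes F G :: "'a::comm_ring_1 ser"
  shows "scale_ser c F * G = scale_ser c (F * G)" "F * scale_ser c G = scale_ser c (F * G)"
proof -
  show *: "scale_ser c F * G = scale_ser c (F * G)" for F G :: "'a ser"
    by (rule ser_eqI) (simp add: coef_mult case_prod_unfold sum_distrib_left mult.assoc)
  show "F * scale_ser c G = scale_ser c (F * G)"
    using *[of G F] by (simp add: mult.commute)
qed

lemma scale_ser_eq_mult: "scale_ser c F = scale_ser c 1 * F"
  by (simp add: scale_ser_mult)

interpretation ser: vspace "scale_ser :: 'a::field \<Rightarrow> _"
  by unfold_locales (auto intro!: ser_eqI simp: algebra_simps)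

lemma coef_of_nat: "coef (of_nat m :: 'a::comm_ring_1 ser) e = (if e = {#} then of_nat m else 0)"
  by (induction m) (auto simp: coef_1)

text \<open>With this the Frobenius identities for rings of prime characteristic apply to
  series.\<close>

lemma CHAR_ser [simp]: "CHAR('a::comm_ring_1 ser) = CHAR('a)"
proof (rule CHAR_eqI)
  show "of_nat CHAR('a) = (0 :: 'a ser)"
    by (rule ser_eqI) (simp add: coef_of_nat)
  show "CHAR('a) dvd x" if "of_nat x = (0 :: 'a ser)" for x
  proof -
    have "coef (of_nat x :: 'a ser) {#} = 0" using that by simp
    then show ?thesis by (simp add: coef_of_nat of_nat_eq_0_iff_char_dvd)
  qed
qed

definition xmonom :: "nat multiset \<Rightarrow> 'a::comm_ring_1 ser" where
  "xmonom b = Ser (\<lambda>e. if e = b then 1 else 0)"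

lemma coef_mono: "coef (xmonom b) e = (if e = b then 1 else 0)"
  by (simp add: xmonom_def)

lemma coef_mono_mult: "coef (xmonom b * F) e = (if b \<subseteq># e then coef F (e - b) else 0)"
proof -
  have "coef (xmonom b * F) e = (\<Sum>d\<in>{d. d \<subseteq># e}. (if d = b then 1 else 0) * coef F (e - d))"
    by (simp add: coef_mult coef_mono sum_splits)
  also have "\<dots> = (\<Sum>d\<in>{d. d \<subseteq># e}. if b = d then coef F (e - d) else 0)"
    by (rule sum.cong) auto
  also have "\<dots> = (if b \<subseteq># e then coef F (e - b) else 0)"
    by (simp add: finite_submultisets)
  finally show ?thesis .
qed

lemma mono_add: "xmonom (a + b) = (xmonom a * xmonom b :: 'a::comm_ring_1 ser)"
proof (rule ser_eqI)
  fix e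
  show "coef (xmonom (a + b) :: 'a ser) e = coef (xmonom a * xmonom b) e"
    unfolding coef_mono_mult coef_mono
    by (auto simp: subset_mset.add_diff_inverse)
qed

lemma mono_empty: "xmonom {#} = 1"
  by (rule ser_eqI) (simp add: coef_mono coef_1)

lemma mono_power: "xmonom e ^ k = xmonom (repeat_mset k e)"
  by (induction k) (auto simp: mono_empty mono_add)

section \<open>Ideals and colength\<close>

definition exponents :: "nat \<Rightarrow> nat multiset set" where
  "exponents n = {e. set_mset e \<subseteq> {..<n}}"

definition series :: "nat \<Rightarrow> 'a::comm_ring_1 ser set" where
  "series n = {F. \<forall>e. coef F e \<noteq> 0 \<longrightarrow> e \<in> exponents n}"

definition is_ideal :: "nat \<Rightarrow> 'a::comm_ring_1 ser set \<Rightarrow> bool" where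
  "is_ideal n I \<longleftrightarrow> I \<subseteq> series n \<and> 0 \<in> I \<and> (\<forall>F\<in>I. \<forall>G\<in>I. F + G \<in> I) \<and> (\<forall>F\<in>I. \<forall>H\<in>series n. H * F \<in> I)"

text \<open>For B closed under sub-multisets and finite in n variables, this is the monomial ideal
  whose quotient has the monomials with exponent in B as a basis. Both filtrations used below have
  this form.\<close>

definition vanish :: "nat \<Rightarrow> nat multiset set \<Rightarrow> 'a::comm_ring_1 ser set" where
  "vanish n B = {F \<in> series n. \<forall>e\<in>B. coef F e = 0}"

definition isum :: "'a::comm_ring_1 ser set \<Rightarrow> 'a ser set \<Rightarrow> 'a ser set" where
  "isum I J = {a + b |a b. a \<in> I \<and> b \<in> J}"

definition princ :: "nat \<Rightarrow> 'a::comm_ring_1 ser \<Rightarrow> 'a ser set" where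
  "princ n a = {a * h |h. h \<in> series n}"

definition colon :: "nat \<Rightarrow> 'a::comm_ring_1 ser set \<Rightarrow> 'a ser \<Rightarrow> 'a ser set" where
  "colon n I a = {v \<in> series n. a * v \<in> I}"

text \<open>A k-dimension; that it is also a length in the sense of chains of ideals is
  \<open>ps_quot_length_of_ser\<close>.\<close>

definition colength :: "nat \<Rightarrow> 'a::field ser set \<Rightarrow> nat" where
  "colength n I = ser.rel_dim (series n) I"

lemma exponents_add_iff: "a + b \<in> exponents n \<longleftrightarrow> a \<in> exponents n \<and> b \<in> exponents n"
  by (auto simp: exponents_def)

lemma series_coef: "F \<in> series n \<Longrightarrow> e \<notin> exponents n \<Longrightarrow> coef F e = 0"
  by (auto simp: series_def)

lemma series_closed:
  assumes "F \<in> series n" "G \<in> series n"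
  shows "F + G \<in> series n" "F - G \<in> series n" "F * G \<in> series n" "scale_ser c F \<in> series n" "- F \<in> series n"
proof -
  show "F * G \<in> series n"
    unfolding series_def
  proof (safe, rule ccontr)
    fix e assume e: "coef (F * G) e \<noteq> 0" "e \<notin> exponents n"
    have "coef (F * G) e = (\<Sum>(a, b)\<in>splits e. 0)"
      unfolding coef_mult
    proof (rule sum.cong)
      fix x assume "x \<in> splits e"
      then obtain a b where ab: "x = (a, b)" "a + b = e" by (auto simp: splits_def)
      then have "a \<notin> exponents n \<or> b \<notin> exponents n" using e exponents_add_iff by blast
      then show "(case x of (a, b) \<Rightarrow> coef F a * coef G b) = (case x of (a, b) \<Rightarrow> 0)"
        using ab series_coef[OF assms(1), of a] series_coef[OF assms(2), of b] by auto
    qed simp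
    then show False using e by simp
  qed
qed (use assms in \<open>auto simp: series_def\<close>, force+)

lemma series_0 [simp]: "0 \<in> series n"
  by (simp add: series_def)

lemma series_1 [simp]: "1 \<in> series n"
  by (simp add: series_def coef_1 exponents_def)

lemma series_power: "F \<in> series n \<Longrightarrow> F ^ k \<in> series n"
  by (induction k) (auto intro: series_closed)

lemma series_sum: "(\<And>i. i \<in> A \<Longrightarrow> f i \<in> series n) \<Longrightarrow> sum f A \<in> series n"
  by (induction A rule: infinite_finite_induct) (auto intro: series_closed)

lemma series_mono: "e \<in> exponents n \<Longrightarrow> xmonom e \<in> series n"
  by (simp add: series_def coef_mono)

lemma is_idealD:
  assumes "is_ideal n I"
  shows "F \<in> I \<Longrightarrow> F \<in> series n" "0 \<in> I" "F \<in> I \<Longrightarrow> G \<in> I \<Longrightarrow> F + G \<in> I"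
    "F \<in> I \<Longrightarrow> H \<in> series n \<Longrightarrow> H * F \<in> I" "F \<in> I \<Longrightarrow> H \<in> series n \<Longrightarrow> F * H \<in> I"
    "F \<in> I \<Longrightarrow> scale_ser c F \<in> I" "F \<in> I \<Longrightarrow> - F \<in> I" "F \<in> I \<Longrightarrow> G \<in> I \<Longrightarrow> F - G \<in> I"
proof -
  show 1: "F \<in> I \<Longrightarrow> F \<in> series n" "0 \<in> I" for F
    using assms by (auto simp: is_ideal_def)
  show 2: "F \<in> I \<Longrightarrow> G \<in> I \<Longrightarrow> F + G \<in> I" for F G
    using assms by (auto simp: is_ideal_def)
  show 3: "F \<in> I \<Longrightarrow> H \<in> series n \<Longrightarrow> H * F \<in> I" for F H
    using assms by (auto simp: is_ideal_def)
  show "F \<in> I \<Longrightarrow> H \<in> series n \<Longrightarrow> F * H \<in> I"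
    using 3 by (metis mult.commute)
  show 4: "F \<in> I \<Longrightarrow> scale_ser c F \<in> I" for c F
    using 3[of F "scale_ser c 1"] series_closed(4)[OF series_1 series_1, of c n] unfolding scale_ser_eq_mult[of c F] by blast
  have "scale_ser (- 1) F = - F" for F :: "'a ser"
    by (rule ser_eqI) simp
  then show 5: "F \<in> I \<Longrightarrow> - F \<in> I" for F
    using 4 by metis
  show "F \<in> I \<Longrightarrow> G \<in> I \<Longrightarrow> F - G \<in> I"
    using 2[of F "- G"] 5 by simp
qed

lemma is_ideal_sum: "is_ideal n I \<Longrightarrow> (\<And>i. i \<in> A \<Longrightarrow> f i \<in> I) \<Longrightarrow> sum f A \<in> I"
  by (induction A rule: infinite_finite_induct) (auto intro: is_idealD)

lemma is_ideal_subspace: "is_ideal n I \<Longrightarrow> ser.subspace I"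
  by (auto simp: ser.subspace_def intro: is_idealD)

lemma is_ideal_series: "is_ideal n (series n)"
  by (auto simp: is_ideal_def intro: series_closed)

lemma is_ideal_one: "is_ideal n I \<Longrightarrow> 1 \<in> I \<Longrightarrow> I = series n"
  using is_idealD(1)[of n I] is_idealD(4)[of n I 1] by auto

lemma is_ideal_vanish:
  assumes B: "\<And>e d. e \<in> B \<Longrightarrow> d \<subseteq># e \<Longrightarrow> d \<in> B"
  shows "is_ideal n (vanish n B)"
  unfolding is_ideal_def
proof (intro conjI ballI)
  fix F H :: "'a ser" assume FH: "F \<in> vanish n B" "H \<in> series n"
  have "coef (H * F) e = 0" if "e \<in> B" for e
    unfolding coef_mult
  proof (rule sum.neutral, safe)
    fix a b assume "(a, b) \<in> splits e"
    then have "b \<subseteq># e" by (auto simp: splits_def)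
    with B that have "b \<in> B" by blast
    with FH show "coef H a * coef F b = 0" by (simp add: vanish_def)
  qed
  with FH show "H * F \<in> vanish n B" by (auto simp: vanish_def intro: series_closed)
qed (auto simp: vanish_def intro: series_closed)

lemma is_ideal_isum:
  fixes I :: "'a::comm_ring_1 ser set"
  assumes I: "is_ideal n I" and J: "is_ideal n J"
  shows "is_ideal n (isum I J)"
  unfolding is_ideal_def
proof (intro conjI ballI)
  show "isum I J \<subseteq> series n"
    using is_idealD(1)[OF I] is_idealD(1)[OF J] by (auto simp: isum_def intro: series_closed)
  show "0 \<in> isum I J"
    using is_idealD(2)[OF I] is_idealD(2)[OF J] unfolding isum_def
    by (metis (mono_tags, lifting) add.right_neutral mem_Collect_eq)
next
  fix F G assume "F \<in> isum I J" "G \<in> isum I J"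
  then obtain a b c d where "a \<in> I" "b \<in> J" "c \<in> I" "d \<in> J" "F = a + b" "G = c + d"
    by (auto simp: isum_def)
  then have "a + c \<in> I" "b + d \<in> J" "F + G = (a + c) + (b + d)"
    using is_idealD(3)[OF I] is_idealD(3)[OF J] by auto
  then show "F + G \<in> isum I J" unfolding isum_def by blast
next
  fix F H :: "'a ser" assume "F \<in> isum I J" "H \<in> series n"
  then obtain a b where ab: "a \<in> I" "b \<in> J" "F = a + b"
    by (auto simp: isum_def)
  then have "H * a \<in> I" "H * b \<in> J" "H * F = H * a + H * b"
    using is_idealD(4)[OF I] is_idealD(4)[OF J] \<open>H \<in> series n\<close> by (auto simp: distrib_left)
  then show "H * F \<in> isum I J" unfolding isum_def by blast
qed

lemma isum_mono: "I \<subseteq> I' \<Longrightarrow> J \<subseteq> J' \<Longrightarrow> isum I J \<subseteq> isum I' J'"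
  by (auto simp: isum_def)

lemma isum_upper:
  assumes "is_ideal n I" "is_ideal n J"
  shows "I \<subseteq> isum I J" "J \<subseteq> isum I J"
proof -
  show "I \<subseteq> isum I J"
    using is_idealD(2)[OF assms(2)] unfolding isum_def by (force intro: exI[of _ 0])
  show "J \<subseteq> isum I J"
    using is_idealD(2)[OF assms(1)] unfolding isum_def by (force intro: exI[of _ 0])
qed

lemma isum_least:
  assumes "is_ideal n K" "I \<subseteq> K" "J \<subseteq> K"
  shows "isum I J \<subseteq> K"
  using assms is_idealD(3)[OF assms(1)] by (auto simp: isum_def)

lemma is_ideal_princ:
  fixes a :: "'a::comm_ring_1 ser"
  assumes a: "a \<in> series n"
  shows "is_ideal n (princ n a)"
  unfolding is_ideal_def
proof (intro conjI ballI)
  show "0 \<in> princ n a" unfolding princ_def using series_0[of n] by (auto intro!: exI[of _ 0])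
next
  fix F G assume "F \<in> princ n a" "G \<in> princ n a"
  then obtain h k where "h \<in> series n" "k \<in> series n" "F = a * h" "G = a * k" by (auto simp: princ_def)
  then have "F + G = a * (h + k)" "h + k \<in> series n" by (auto simp: distrib_left intro: series_closed)
  then show "F + G \<in> princ n a" unfolding princ_def by blast
next
  fix F H :: "'a ser" assume "F \<in> princ n a" "H \<in> series n"
  then obtain h where "h \<in> series n" "F = a * h" by (auto simp: princ_def)
  then have "H * F = a * (H * h)" "H * h \<in> series n"
    using \<open>H \<in> series n\<close> by (auto simp: ac_simps intro: series_closed)
  then show "H * F \<in> princ n a" unfolding princ_def by blast
qed (auto simp: princ_def intro: series_closed a)

lemma princ_self: "a \<in> princ n a"
  unfolding princ_def by (force intro: exI[of _ 1])

lemma princ_least: "is_ideal n I \<Longrightarrow> a \<in> I \<Longrightarrow> princ n a \<subseteq> I"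
  by (auto simp: princ_def intro: is_idealD)

lemma is_ideal_colon:
  fixes I :: "'a::comm_ring_1 ser set"
  assumes I: "is_ideal n I"
  shows "is_ideal n (colon n I a)"
  unfolding is_ideal_def
proof (intro conjI ballI)
  fix F H :: "'a ser" assume "F \<in> colon n I a" "H \<in> series n"
  then have "F \<in> series n" "H * (a * F) \<in> I" "H \<in> series n" using is_idealD(4)[OF I] by (auto simp: colon_def)
  then show "H * F \<in> colon n I a" by (auto simp: colon_def mult.left_commute intro: series_closed)
qed (use is_idealD[OF I] in \<open>auto simp: colon_def distrib_left intro: series_closed\<close>)

lemma colon_upper: "is_ideal n I \<Longrightarrow> a \<in> series n \<Longrightarrow> I \<subseteq> colon n I a"
  by (auto simp: colon_def intro: is_idealD)

section \<open>Colength in exact sequences\<close>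

definition fin_colength :: "nat \<Rightarrow> 'a::field ser set \<Rightarrow> bool" where
  "fin_colength n I \<longleftrightarrow> is_ideal n I \<and> ser.fin_codim (series n) I"

lemma fin_colength_is_ideal: "fin_colength n I \<Longrightarrow> is_ideal n I"
  by (simp add: fin_colength_def)

lemma fin_colength_mono: "fin_colength n I \<Longrightarrow> is_ideal n J \<Longrightarrow> I \<subseteq> J \<Longrightarrow> fin_colength n J"
  using ser.fin_codim_mono by (auto simp: fin_colength_def)

lemma colength_add:
  assumes "fin_colength n I" "is_ideal n J" "I \<subseteq> J"
  shows "colength n I = colength n J + ser.rel_dim J I"
  unfolding colength_def using assms is_idealD(1)[OF assms(2)]
  by (intro ser.rel_dim_add) (auto simp: fin_colength_def intro: is_ideal_subspace is_ideal_series)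

lemma colength_mono: "fin_colength n I \<Longrightarrow> is_ideal n J \<Longrightarrow> I \<subseteq> J \<Longrightarrow> colength n J \<le> colength n I"
  using colength_add by fastforce

lemma colength_eq_0_iff: "fin_colength n I \<Longrightarrow> colength n I = 0 \<longleftrightarrow> I = series n"
  unfolding colength_def using ser.rel_dim_eq_0_iff[of "series n" I] is_idealD(1)[of n I]
  by (auto simp: fin_colength_def is_ideal_subspace)

text \<open>Multiplication by a induces an isomorphism from R/(I : a) to (I + (a))/I.\<close>

lemma rel_dim_princ:
  assumes I: "fin_colength n I" and a: "a \<in> series n"
  shows "ser.rel_dim (isum I (princ n a)) I = colength n (colon n I a)"
proof -
  note i = fin_colength_is_ideal[OF I]
  have fin: "ser.fin_codim (series n) {v \<in> series n. a * v \<in> I}"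
    using fin_colength_mono[OF I is_ideal_colon[OF i] colon_upper[OF i a]] by (simp add: fin_colength_def colon_def)
  show ?thesis
    unfolding colength_def colon_def
  proof (rule ser.rel_dim_map)
    show "ser.subspace (series n)" "ser.subspace I" "ser.subspace (isum I (princ n a))"
      using is_ideal_subspace is_ideal_series i is_ideal_isum is_ideal_princ a by blast+
    show "I \<subseteq> isum I (princ n a)" using isum_upper i is_ideal_princ a by blast
    have "princ n a \<subseteq> isum I (princ n a)" using isum_upper i is_ideal_princ a by blast
    then show "(\<lambda>v. a * v) ` series n \<subseteq> isum I (princ n a)" by (auto simp: princ_def)
    show "\<exists>r\<in>series n. w - a * r \<in> I" if w: "w \<in> isum I (princ n a)" for w
    proof -
      obtain u h where "u \<in> I" "h \<in> series n" "w = u + a * h"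
        using w by (auto simp: isum_def princ_def)
      then show ?thesis by (intro bexI[of _ h]) auto
    qed
    show "ser.fin_codim (series n) {v \<in> series n. a * v \<in> I}" by (fact fin)
  qed (auto simp: distrib_left scale_ser_mult)
qed

lemma colength_colon:
  assumes I: "fin_colength n I" and a: "a \<in> series n"
  shows "colength n I = colength n (isum I (princ n a)) + colength n (colon n I a)"
  using colength_add[OF I is_ideal_isum[OF fin_colength_is_ideal[OF I] is_ideal_princ[OF a]]] isum_upper[OF fin_colength_is_ideal[OF I] is_ideal_princ[OF a]]
    rel_dim_princ[OF I a] by simp

text \<open>The exact sequence of \<open>colength_colon\<close> for I + (ab) and the element a;
  since ab lies in (a), adding a to this ideal gives I + (a).\<close>

lemma colength_isum_mult:
  assumes I: "fin_colength n I" and a: "a \<in> series n" and b: "b \<in> series n"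
  shows "colength n (isum I (princ n (a * b))) = colength n (isum I (princ n a)) + colength n (colon n (isum I (princ n (a * b))) a)"
proof -
  let ?I = "isum I (princ n (a * b))"
  note i = fin_colength_is_ideal[OF I]
  have ab: "a * b \<in> series n" using a b by (rule series_closed)
  have i': "is_ideal n ?I" using i ab by (intro is_ideal_isum is_ideal_princ)
  have sub: "I \<subseteq> ?I" "princ n (a * b) \<subseteq> ?I" using isum_upper[OF i is_ideal_princ[OF ab]] by auto
  have f: "fin_colength n ?I" using fin_colength_mono I i' sub by blast
  have s: "is_ideal n (isum I (princ n a))" "is_ideal n (isum ?I (princ n a))"
    using is_ideal_isum[OF i is_ideal_princ[OF a]] is_ideal_isum[OF i' is_ideal_princ[OF a]] by auto
  have u: "I \<subseteq> isum I (princ n a)" "princ n a \<subseteq> isum I (princ n a)"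
     "?I \<subseteq> isum ?I (princ n a)" "princ n a \<subseteq> isum ?I (princ n a)"
    using isum_upper[OF i is_ideal_princ[OF a]] isum_upper[OF i' is_ideal_princ[OF a]] by auto
  have "a * b \<in> princ n a" using b by (auto simp: princ_def)
  then have "princ n (a * b) \<subseteq> isum I (princ n a)"
    using princ_least[OF s(1)] u by blast
  then have "isum ?I (princ n a) = isum I (princ n a)"
    using u sub by (intro subset_antisym isum_least[OF s(1)] isum_least[OF s(2)]) auto
  with colength_colon[OF f a] show ?thesis by simp
qed

text \<open>The colon ideal left over in \<open>colength_isum_mult\<close> contains both I and
  b.\<close>

lemma colength_isum_mult_le:
  assumes I: "fin_colength n I" and a: "a \<in> series n" and b: "b \<in> series n"
  shows "colength n (isum I (princ n (a * b))) \<le> colength n (isum I (princ n a)) + colength n (isum I (princ n b))"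
proof -
  let ?I = "isum I (princ n (a * b))"
  note i = fin_colength_is_ideal[OF I]
  have ab: "a * b \<in> series n" using a b by (rule series_closed)
  have i': "is_ideal n ?I" using i ab by (intro is_ideal_isum is_ideal_princ)
  have "princ n b \<subseteq> colon n ?I a"
  proof (rule princ_least[OF is_ideal_colon[OF i']])
    show "b \<in> colon n ?I a"
      using b isum_upper(2)[OF i is_ideal_princ[OF ab]] princ_self[of "a * b" n] by (auto simp: colon_def)
  qed
  moreover have "I \<subseteq> colon n ?I a"
    using colon_upper[OF i' a] isum_upper(1)[OF i is_ideal_princ[OF ab]] by blast
  ultimately have "isum I (princ n b) \<subseteq> colon n ?I a"
    by (intro isum_least[OF is_ideal_colon[OF i']])
  moreover have "fin_colength n (isum I (princ n b))"
    using fin_colength_mono[OF I is_ideal_isum[OF i is_ideal_princ[OF b]] isum_upper(1)[OF i is_ideal_princ[OF b]]] .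
  ultimately have "colength n (colon n ?I a) \<le> colength n (isum I (princ n b))"
    using colength_mono is_ideal_colon[OF i'] by blast
  with colength_isum_mult[OF assms] show ?thesis by simp
qed

lemma colength_isum_power_le:
  assumes I: "fin_colength n I" and a: "a \<in> series n"
  shows "colength n (isum I (princ n (a ^ k))) \<le> k * colength n (isum I (princ n a))"
proof (induction k)
  case 0
  have "isum I (princ n 1) = series n"
    using isum_upper(2)[OF fin_colength_is_ideal[OF I] is_ideal_princ[OF series_1]] princ_self[of 1 n]
    by (intro is_ideal_one is_ideal_isum fin_colength_is_ideal[OF I] is_ideal_princ series_1) blast
  moreover have "colength n (series n :: 'a ser set) = 0"
    using colength_eq_0_iff[of n "series n"] fin_colength_mono[OF I is_ideal_series] is_idealD(1)[OF fin_colength_is_ideal[OF I]] by blast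
  ultimately show ?case by simp
next
  case (Suc k)
  then show ?case
    using colength_isum_mult_le[OF I a series_power[OF a, of k]] by simp
qed

lemma trunc_in_vanish:
  assumes F: "F \<in> series n" and B: "finite (B \<inter> exponents n)"
  shows "F - (\<Sum>e\<in>B \<inter> exponents n. scale_ser (coef F e) (xmonom e)) \<in> vanish n B"
proof -
  have "(\<Sum>e\<in>B \<inter> exponents n. coef F e * (if d = e then 1 else 0)) = coef F d" if "d \<in> B" for d
  proof (cases "d \<in> exponents n")
    case True
    then have "(\<Sum>e\<in>B \<inter> exponents n. coef F e * (if d = e then 1 else 0))
      = (\<Sum>e\<in>B \<inter> exponents n. if d = e then coef F e else 0)"
      by (intro sum.cong) auto
    with True that B show ?thesis by simp
  next
    case False
    then have "(\<Sum>e\<in>B \<inter> exponents n. coef F e * (if d = e then 1 else 0)) = 0"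
      by (intro sum.neutral) auto
    with False series_coef[OF F] show ?thesis by simp
  qed
  moreover have "(\<Sum>e\<in>B \<inter> exponents n. scale_ser (coef F e) (xmonom e)) \<in> series n"
    by (rule series_sum) (auto intro: series_closed series_mono)
  ultimately show ?thesis
    using F by (auto simp: vanish_def coef_mono intro: series_closed)
qed

text \<open>The monomials with exponent in B span by truncation, and they are independent because
  each coefficient at an exponent in B can be read off separately.\<close>

lemma fin_colength_vanish:
  fixes B :: "nat multiset set"
  assumes down: "\<And>e d. e \<in> B \<Longrightarrow> d \<subseteq># e \<Longrightarrow> d \<in> B" and B: "finite (B \<inter> exponents n)"
  shows "fin_colength n (vanish n B :: 'a::field ser set)"
    and "colength n (vanish n B :: 'a::field ser set) = card (B \<inter> exponents n)"
proof -
  let ?V = "vanish n B :: 'a ser set"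
  let ?M = "xmonom ` (B \<inter> exponents n) :: 'a ser set"
  have i: "is_ideal n ?V" using is_ideal_vanish down .
  have M: "finite ?M" "?M \<subseteq> series n" using B by (auto intro: series_mono)
  have sp: "series n \<subseteq> ser.span (?V \<union> ?M)"
  proof
    fix F :: "'a ser" assume "F \<in> series n"
    let ?P = "\<Sum>e\<in>B \<inter> exponents n. scale_ser (coef F e) (xmonom e)"
    have "F - ?P \<in> ser.span (?V \<union> ?M)"
      using trunc_in_vanish[OF \<open>F \<in> series n\<close> B] by (intro ser.span_base) blast
    moreover have "?P \<in> ser.span (?V \<union> ?M)"
      by (rule ser.span_sum, rule ser.span_scale, rule ser.span_base) blast
    ultimately have "(F - ?P) + ?P \<in> ser.span (?V \<union> ?M)" by (rule ser.span_add)
    then show "F \<in> ser.span (?V \<union> ?M)" by simp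
  qed
  show f: "fin_colength n ?V" unfolding fin_colength_def ser.fin_codim_def using i M sp by blast
  have "colength n ?V \<le> card ?M" unfolding colength_def using M sp by (intro ser.rel_dim_le)
  also have "\<dots> \<le> card (B \<inter> exponents n)" using B by (rule card_image_le)
  finally have 1: "colength n ?V \<le> card (B \<inter> exponents n)" .
  have "ser.indep_mod ?V (B \<inter> exponents n) xmonom"
    unfolding ser.indep_mod_def
  proof (intro allI impI ballI)
    fix c d assume V: "(\<Sum>e\<in>B \<inter> exponents n. scale_ser (c e) (xmonom e)) \<in> ?V" and d: "d \<in> B \<inter> exponents n"
    have "(\<Sum>e\<in>B \<inter> exponents n. c e * (if d = e then 1 else 0))
      = (\<Sum>e\<in>B \<inter> exponents n. if d = e then c e else 0)"
      by (intro sum.cong) auto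
    then have "coef (\<Sum>e\<in>B \<inter> exponents n. scale_ser (c e) (xmonom e)) d = c d"
      using d B by (simp add: coef_mono)
    with V d show "c d = 0" by (auto simp: vanish_def)
  qed
  then have "card (B \<inter> exponents n) \<le> colength n ?V"
    unfolding colength_def using f B
    by (intro ser.rel_dim_ge) (auto simp: fin_colength_def is_ideal_subspace intro: series_mono)
  with 1 show "colength n ?V = card (B \<inter> exponents n)" by simp
qed

section \<open>A monomial order and the two filtrations\<close>

text \<open>The map \<open>nu\<close> is injective and multiplicative by unique factorisation, so comparing its
  values is a monomial order in which every exponent has only finitely many predecessors.\<close>

definition nu :: "nat multiset \<Rightarrow> nat" where
  "nu e = prod_mset (image_mset (enumerate {p::nat. prime p}) e)"

text \<open>The threshold is a power of 2 because nu is multiplicative: M then behaves additively,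
  as for powers of the maximal ideal (\<open>nu_filtration_mult\<close>).\<close>

definition nu_filtration :: "nat \<Rightarrow> nat \<Rightarrow> 'a::comm_ring_1 ser set" where
  "nu_filtration n M = vanish n {e. nu e < 2 ^ M}"

text \<open>The ideal generated by the x_i^q, described through vanishing on the box of exponents
  below q, which turns its colength into a count. The generators reappear in
  \<open>frob_ideal_decomp\<close>.\<close>

definition frob_ideal :: "nat \<Rightarrow> nat \<Rightarrow> 'a::comm_ring_1 ser set" where
  "frob_ideal n q = vanish n {e. \<forall>i. count e i < q}"

lemma prime_enumerate: "prime (enumerate {p::nat. prime p} i)"
  using enumerate_in_set[OF primes_infinite] by simp

lemma nu_empty [simp]: "nu {#} = 1"
  by (simp add: nu_def)

lemma nu_add: "nu (a + b) = nu a * nu b"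
  by (simp add: nu_def)

lemma nu_ge_size: "2 ^ size e \<le> nu e"
proof (induction e)
  case (add x e)
  have "2 \<le> enumerate {p::nat. prime p} x" using prime_enumerate prime_ge_2_nat by blast
  then have "2 * 2 ^ size e \<le> enumerate {p::nat. prime p} x * nu e"
    using add by (intro mult_mono) auto
  then show ?case by (simp add: nu_def)
qed simp

lemma nu_pos [simp]: "0 < nu e"
  using nu_ge_size[of e] by (meson less_le_trans zero_less_numeral zero_less_power)

lemma inj_nu: "inj nu"
proof (rule injI)
  fix a b assume "nu a = nu b"
  then have "prime_factorization (nu a) = prime_factorization (nu b)" by simp
  then have "image_mset (enumerate {p::nat. prime p}) a = image_mset (enumerate {p::nat. prime p}) b"
    unfolding nu_def using prime_enumerate
    by (subst (asm) (1 2) prime_factorization_prod_mset_primes) auto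
  moreover have "inj (enumerate {p::nat. prime p})"
    using strict_mono_enumerate[OF primes_infinite] by (rule strict_mono_imp_inj_on)
  ultimately show "a = b" by (metis multiset.inj_map injD)
qed

lemma nu_neq_0 [simp]: "nu e \<noteq> 0"
  using nu_pos[of e] by linarith

lemma nu_mono: "d \<subseteq># e \<Longrightarrow> nu d \<le> nu e"
proof -
  assume "d \<subseteq># e"
  then obtain c where "e = d + c" by (auto simp: mset_subset_eq_exists_conv)
  then show ?thesis by (simp add: nu_add Suc_leI)
qed

lemma finite_nu_less: "finite {e. nu e < M}"
  using finite_vimageI[OF finite_lessThan inj_nu, of M] by (simp add: vimage_def)

lemma box_Suc: "{e. \<forall>i. count e i < q} \<inter> exponents (Suc n) =
  (\<lambda>(e, k). e + replicate_mset k n) ` (({e. \<forall>i. count e i < q} \<inter> exponents n) \<times> {..<q})"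
proof (intro equalityI subsetI)
  fix e assume e: "e \<in> {e. \<forall>i. count e i < q} \<inter> exponents (Suc n)"
  have "e = filter_mset (\<lambda>i. i \<noteq> n) e + replicate_mset (count e n) n"
    by (rule multiset_eqI) auto
  moreover have "filter_mset (\<lambda>i. i \<noteq> n) e \<in> {e. \<forall>i. count e i < q} \<inter> exponents n"
    using e by (auto simp: exponents_def less_Suc_eq) (metis gr0I not_less0)?
  ultimately show "e \<in> (\<lambda>(e, k). e + replicate_mset k n) ` (({e. \<forall>i. count e i < q} \<inter> exponents n) \<times> {..<q})"
    using e by (intro image_eqI[of _ _ "(filter_mset (\<lambda>i. i \<noteq> n) e, count e n)"]) auto
next
  fix e assume "e \<in> (\<lambda>(e, k). e + replicate_mset k n) ` (({e. \<forall>i. count e i < q} \<inter> exponents n) \<times> {..<q})"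
  then obtain d k where d: "e = d + replicate_mset k n" "\<forall>i. count d i < q" "d \<in> exponents n" "k < q"
    by auto
  have "n \<notin># d" using d by (auto simp: exponents_def)
  then have "count d n = 0" by (simp add: not_in_iff)
  with d show "e \<in> {e. \<forall>i. count e i < q} \<inter> exponents (Suc n)"
    by (auto simp: exponents_def split: if_splits)
qed

lemma card_box:
  "finite ({e. \<forall>i. count e i < q} \<inter> exponents n) \<and> card ({e. \<forall>i. count e i < q} \<inter> exponents n) = q ^ n" if "q > 0"
proof (induction n)
  case 0
  have "{e. \<forall>i. count e i < q} \<inter> exponents 0 = {{#}}" using that by (auto simp: exponents_def)
  then show ?case by simp
next
  case (Suc n)
  have "inj_on (\<lambda>(e, k). e + replicate_mset k n) (({e. \<forall>i. count e i < q} \<inter> exponents n) \<times> {..<q})"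
  proof (rule inj_onI, clarify)
    fix d k d' k'
    assume d: "d \<in> exponents n" "d' \<in> exponents n" and eq: "d + replicate_mset k n = d' + replicate_mset k' n"
    have "n \<notin># d" "n \<notin># d'" using d by (auto simp: exponents_def)
    then have "count d n = 0" "count d' n = 0" by (simp_all add: not_in_iff)
    then have "k = k'" using arg_cong[OF eq, of "\<lambda>e. count e n"] by simp
    with eq show "d = d' \<and> k = k'" by simp
  qed
  then show ?case unfolding box_Suc using Suc
    by (simp add: card_image card_cartesian_product)
qed

lemma fin_colength_frob_ideal: "q > 0 \<Longrightarrow> fin_colength n (frob_ideal n q :: 'a::field ser set)"
  and colength_frob_ideal: "q > 0 \<Longrightarrow> colength n (frob_ideal n q :: 'a::field ser set) = q ^ n"
proof -
  assume q: "q > 0"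
  have down: "d \<in> {e. \<forall>i. count e i < q}" if "e \<in> {e. \<forall>i. count e i < q}" "d \<subseteq># e" for e d
    using that by (auto dest: mset_subset_eq_count intro: le_less_trans)
  have fin: "finite ({e. \<forall>i. count e i < q} \<inter> exponents n)" using card_box[OF q] by blast
  show "fin_colength n (frob_ideal n q :: 'a::field ser set)"
    using fin_colength_vanish(1)[OF down fin] by (simp add: frob_ideal_def)
  show "colength n (frob_ideal n q :: 'a::field ser set) = q ^ n"
    using fin_colength_vanish(2)[OF down fin] card_box[OF q, of n] by (simp add: frob_ideal_def)
qed

text \<open>All primes are at least 2, so nu e < 2^M forces degree below M, and the exponents under
  the threshold lie in a box of side M.\<close>

lemma fin_colength_nu_filtration: "fin_colength n (nu_filtration n M :: 'a::field ser set)"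
  and colength_nu_filtration_le: "colength n (nu_filtration n M :: 'a::field ser set) \<le> M ^ n"
proof -
  have down: "d \<in> {e. nu e < 2 ^ M}" if "e \<in> {e. nu e < 2 ^ M}" "d \<subseteq># e" for e d
    using that nu_mono[of d e] by simp
  have fin: "finite ({e. nu e < 2 ^ M} \<inter> exponents n)" by (simp add: finite_nu_less)
  show "fin_colength n (nu_filtration n M :: 'a::field ser set)"
    using fin_colength_vanish(1)[OF down fin] by (simp add: nu_filtration_def)
  have "colength n (nu_filtration n M :: 'a ser set) = card ({e. nu e < 2 ^ M} \<inter> exponents n)"
    using fin_colength_vanish(2)[OF down fin] by (simp add: nu_filtration_def)
  also have "\<dots> \<le> M ^ n"
  proof (cases "M = 0")
    case False
    have "nu e < 2 ^ M \<Longrightarrow> count e i < M" for e i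
    proof -
      assume "nu e < 2 ^ M"
      then have "(2::nat) ^ size e < 2 ^ M" using nu_ge_size[of e] by linarith
      then have "size e < M" by simp
      then show "count e i < M" using count_le_size[of e i] by linarith
    qed
    then have "{e. nu e < 2 ^ M} \<inter> exponents n \<subseteq> {e. \<forall>i. count e i < M} \<inter> exponents n" by blast
    then have "card ({e. nu e < 2 ^ M} \<inter> exponents n) \<le> card ({e. \<forall>i. count e i < M} \<inter> exponents n)"
      using card_box[of M n] False by (intro card_mono) auto
    then show ?thesis using card_box[of M n] False by simp
  next
    case True
    then have "{e. nu e < 2 ^ M} = {}" by simp
    then show ?thesis by simp
  qed
  finally show "colength n (nu_filtration n M :: 'a ser set) \<le> M ^ n" .
qed

lemma is_ideal_nu_filtration: "is_ideal n (nu_filtration n M)"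
  unfolding nu_filtration_def by (rule is_ideal_vanish) (metis mem_Collect_eq nu_mono le_less_trans)

lemma nu_filtration_mult:
  assumes "F \<in> nu_filtration n a" "G \<in> nu_filtration n b"
  shows "F * G \<in> nu_filtration n (a + b)"
proof -
  have "coef (F * G) e = 0" if "nu e < 2 ^ (a + b)" for e
    unfolding coef_mult
  proof (rule sum.neutral, safe)
    fix x y assume "(x, y) \<in> splits e"
    then have "nu x * nu y < 2 ^ a * 2 ^ b" using that by (auto simp: splits_def nu_add power_add)
    then have "nu x < 2 ^ a \<or> nu y < 2 ^ b" by (meson leI mult_le_mono not_less)
    with assms show "coef F x * coef G y = 0" by (auto simp: nu_filtration_def vanish_def)
  qed
  with assms show ?thesis by (auto simp: nu_filtration_def vanish_def intro: series_closed)
qed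

lemma nu_filtration_0: "nu_filtration n 0 = series n"
  by (auto simp: nu_filtration_def vanish_def)

lemma nu_filtration_antimono: "M \<le> M' \<Longrightarrow> nu_filtration n M' \<subseteq> nu_filtration n M"
proof -
  assume "M \<le> M'"
  then have "(2::nat) ^ M \<le> 2 ^ M'" by simp
  then have "nu e < 2 ^ M'" if "nu e < 2 ^ M" for e using that by linarith
  then show ?thesis by (auto simp: nu_filtration_def vanish_def)
qed

lemma nu_filtration_1: "F \<in> nu_filtration n 1 \<longleftrightarrow> F \<in> series n \<and> coef F {#} = 0"
proof -
  have "nu e < 2 \<longleftrightarrow> e = {#}" for e
  proof
    assume "nu e < 2"
    then have "nu e = nu {#}" using nu_pos[of e] by (simp del: nu_pos)
    then show "e = {#}" by (rule injD[OF inj_nu])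
  qed simp
  then show ?thesis by (simp add: nu_filtration_def vanish_def)
qed

lemma nu_filtration_1_eq_frob_ideal: "nu_filtration n 1 = frob_ideal n 1"
proof -
  have "(\<forall>i. count e i < 1) \<longleftrightarrow> e = {#}" for e :: "nat multiset"
    by (auto simp: multiset_eq_iff)
  then have "F \<in> frob_ideal n 1 \<longleftrightarrow> F \<in> series n \<and> coef F {#} = 0" for F :: "'a ser"
    by (simp add: frob_ideal_def vanish_def)
  with nu_filtration_1 show ?thesis by blast
qed

lemma nu_filtration_power: "F \<in> nu_filtration n 1 \<Longrightarrow> F ^ k \<in> nu_filtration n k"
proof (induction k)
  case (Suc k)
  then show ?case using nu_filtration_mult[of F n 1 "F ^ k" k] by simp
qed (simp add: nu_filtration_0)

text \<open>One Gaussian elimination step over the polynomials takes the place of a nonvanishing minor.\<close>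

lemma indep_poly:
  fixes v :: "'i \<Rightarrow> 'e \<Rightarrow> 'a::field poly"
  assumes "finite X"
    and "\<And>c. (\<And>e. (\<Sum>i\<in>X. c i * poly (v i e) 0) = 0) \<Longrightarrow> \<forall>i\<in>X. c i = 0"
  shows "finite {\<alpha>. \<not> (\<forall>c. (\<forall>e. (\<Sum>i\<in>X. c i * poly (v i e) \<alpha>) = 0) \<longrightarrow> (\<forall>i\<in>X. c i = 0))}"
  using assms
proof (induction X arbitrary: v rule: finite_induct)
  case (insert x X)
  note fX = insert.hyps(1)
  have "\<exists>e. poly (v x e) 0 \<noteq> 0"
  proof (rule ccontr)
    assume *: "\<not> (\<exists>e. poly (v x e) 0 \<noteq> 0)"
    have "\<forall>i\<in>insert x X. (if i = x then 1 else 0 :: 'a) = 0"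
    proof (rule insert.prems)
      fix e
      show "(\<Sum>i\<in>insert x X. (if i = x then 1 else 0) * poly (v i e) 0) = 0"
        using * by (intro sum.neutral) auto
    qed
    then show False by simp
  qed
  then obtain e0 where e0: "poly (v x e0) 0 \<noteq> 0" by blast
  \<comment> \<open>Cross-multiplication with the pivot entry at \<open>e0\<close> keeps the entries
    polynomial; the price is the finite set of roots of the pivot.\<close>
  define w where "w i e = v x e0 * v i e - v i e0 * v x e" for i e
  let ?bad = "\<lambda>X v. {\<alpha>. \<not> (\<forall>c. (\<forall>e. (\<Sum>i\<in>X. c i * poly (v i e) \<alpha>) = 0) \<longrightarrow> (\<forall>i\<in>X. c i = 0))}"
  have key: "(\<Sum>i\<in>X. c i * poly (w i e) \<alpha>) =
      poly (v x e0) \<alpha> * (\<Sum>i\<in>X. c i * poly (v i e) \<alpha>) - (\<Sum>i\<in>X. c i * poly (v i e0) \<alpha>) * poly (v x e) \<alpha>" for c e \<alpha>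
    by (simp add: w_def right_diff_distrib sum_subtractf sum_distrib_left sum_distrib_right ac_simps)
  have "finite (?bad X w)"
  proof (rule insert.IH)
    fix c assume c: "\<And>e. (\<Sum>i\<in>X. c i * poly (w i e) 0) = 0"
    define c' where "c' i = (if i = x then - (\<Sum>i\<in>X. c i * poly (v i e0) 0) else poly (v x e0) 0 * c i)" for i
    have "(\<Sum>i\<in>insert x X. c' i * poly (v i e) 0) = 0" for e
    proof -
      have "(\<Sum>i\<in>X. c' i * poly (v i e) 0) = (\<Sum>i\<in>X. poly (v x e0) 0 * c i * poly (v i e) 0)"
        using insert.hyps(2) by (intro sum.cong) (auto simp: c'_def)
      then show ?thesis
        using c[of e] key[of c e 0] fX insert.hyps(2)
        by (simp add: c'_def sum_distrib_left mult.assoc)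
    qed
    then have "\<forall>i\<in>insert x X. c' i = 0" by (rule insert.prems)
    then show "\<forall>i\<in>X. c i = 0" using e0 insert.hyps(2) by (auto simp: c'_def split: if_splits)
  qed
  moreover have "finite {\<alpha>. poly (v x e0) \<alpha> = 0}"
    using e0 by (intro poly_roots_finite) auto
  moreover have "?bad (insert x X) v \<subseteq> ?bad X w \<union> {\<alpha>. poly (v x e0) \<alpha> = 0}"
  proof (rule subsetI, rule ccontr)
    fix \<alpha> assume bad: "\<alpha> \<in> ?bad (insert x X) v" and n: "\<alpha> \<notin> ?bad X w \<union> {\<alpha>. poly (v x e0) \<alpha> = 0}"
    have nz: "poly (v x e0) \<alpha> \<noteq> 0"
      and good: "\<And>c. (\<And>e. (\<Sum>i\<in>X. c i * poly (w i e) \<alpha>) = 0) \<Longrightarrow> \<forall>i\<in>X. c i = 0"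
      using n by blast+
    have "\<forall>i\<in>insert x X. c i = 0" if c: "\<forall>e. (\<Sum>i\<in>insert x X. c i * poly (v i e) \<alpha>) = 0" for c
    proof -
      have s: "(\<Sum>i\<in>X. c i * poly (v i e) \<alpha>) = - (c x * poly (v x e) \<alpha>)" for e
        using c fX insert.hyps(2) by (simp add: add_eq_0_iff2)
      have "(\<Sum>i\<in>X. c i * poly (w i e) \<alpha>) = 0" for e
        unfolding key s by simp
      then have cX: "\<forall>i\<in>X. c i = 0" by (rule good)
      then have "c x * poly (v x e0) \<alpha> = 0" using s[of e0] by simp
      with nz cX show ?thesis by simp
    qed
    with bad show False by blast
  qed
  ultimately show ?case by (meson finite_UnI finite_subset)
qed simp

section \<open>The Hilbert--Kunz function of a hypersurface\<close>

lemma is_ideal_frob_ideal: "q > 0 \<Longrightarrow> is_ideal n (frob_ideal n q :: 'a::field ser set)"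
  using fin_colength_frob_ideal fin_colength_is_ideal by blast

lemma mono_in_frob_ideal:
  assumes "i < n" "q > 0"
  shows "xmonom (replicate_mset q i) \<in> frob_ideal n q"
  using assms by (auto simp: frob_ideal_def vanish_def coef_mono exponents_def intro!: series_mono)

text \<open>Every exponent occurring in F has a coordinate that is at least q; each monomial is
  charged to the first such coordinate, so that none is counted twice.\<close>

lemma frob_ideal_decomp:
  fixes F :: "'a::comm_ring_1 ser"
  assumes F: "F \<in> frob_ideal n q" and q: "q > 0"
  obtains G where "\<And>i. G i \<in> series n" "F = (\<Sum>i<n. xmonom (replicate_mset q i) * G i)"
proof -
  define m where "m e = (LEAST j. q \<le> count e j)" for e :: "nat multiset"
  define G where "G i = Ser (\<lambda>e. if m (e + replicate_mset q i) = i then coef F (e + replicate_mset q i) else 0)" for i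
  have FR: "F \<in> series n" using F by (simp add: frob_ideal_def vanish_def)
  have "G i \<in> series n" for i
    using series_coef[OF FR, of "e + replicate_mset q i" for e] by (auto simp: series_def G_def exponents_add_iff)
  moreover have "F = (\<Sum>i<n. xmonom (replicate_mset q i) * G i)"
  proof (rule ser_eqI)
    fix e
    have eq: "coef (xmonom (replicate_mset q i) * G i) e = (if q \<le> count e i \<and> m e = i then coef F e else 0)" for i
      by (auto simp: coef_mono_mult G_def count_le_replicate_mset_subset_eq [symmetric]
          subset_mset.diff_add)
    show "coef F e = coef (\<Sum>i<n. xmonom (replicate_mset q i) * G i) e"
    proof (cases "coef F e = 0")
      case True
      then have "(\<Sum>i<n. coef (xmonom (replicate_mset q i) * G i) e) = 0"
        unfolding eq by (intro sum.neutral) simp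
      with True show ?thesis by simp
    next
      case False
      then have e: "e \<in> exponents n" using FR by (auto simp: series_def)
      have "\<exists>j. q \<le> count e j" using False F by (force simp: frob_ideal_def vanish_def not_less)
      then have le: "q \<le> count e (m e)" unfolding m_def by (rule LeastI_ex)
      then have "m e \<in># e" using q by (metis count_inI leD)
      then have "m e < n" using e by (auto simp: exponents_def)
      have "(\<Sum>i<n. coef (xmonom (replicate_mset q i) * G i) e) = (\<Sum>i<n. if m e = i then coef F e else 0)"
        unfolding eq using le by (intro sum.cong) auto
      then show ?thesis using \<open>m e < n\<close> by simp
    qed
  qed
  ultimately show ?thesis using that by blast
qed

text \<open>In characteristic p the power p^k is additive, so it can be applied to each term of the
  decomposition over the x_i^q.\<close>

lemma frob_ideal_frob:
  fixes F :: "'a::field ser"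
  assumes F: "F \<in> frob_ideal n q" and q: "q > 0" and p: "prime CHAR('a)"
  shows "F ^ (CHAR('a) ^ k) \<in> frob_ideal n (q * CHAR('a) ^ k)"
proof -
  let ?Q = "CHAR('a) ^ k"
  have Q: "q * ?Q > 0" using q p prime_gt_0_nat by simp
  obtain G where G: "\<And>i. G i \<in> series n" "F = (\<Sum>i<n. xmonom (replicate_mset q i) * G i)"
    using frob_ideal_decomp[OF F q] by blast
  have "F ^ ?Q = (\<Sum>i<n. (xmonom (replicate_mset q i) * G i) ^ ?Q)"
    unfolding G(2) by (rule freshmans_dream_sum'[where n = k]) (use p in auto)
  also have "\<dots> = (\<Sum>i<n. G i ^ ?Q * xmonom (replicate_mset (q * ?Q) i))"
  proof (rule sum.cong)
    fix i :: nat
    have "repeat_mset ?Q (replicate_mset q i) = replicate_mset (q * ?Q) i"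
      by (rule multiset_eqI) simp
    then show "(xmonom (replicate_mset q i) * G i) ^ ?Q = G i ^ ?Q * xmonom (replicate_mset (q * ?Q) i)"
      by (simp add: power_mult_distrib mono_power mult.commute[of _ "G i ^ ?Q"])
  qed simp
  also have "\<dots> \<in> frob_ideal n (q * ?Q)"
    using Q G by (intro is_ideal_sum[OF is_ideal_frob_ideal] is_idealD(4)[OF is_ideal_frob_ideal] mono_in_frob_ideal series_power) auto
  finally show ?thesis .
qed

definition hk_length :: "nat \<Rightarrow> 'a::field ser \<Rightarrow> nat \<Rightarrow> nat" where
  "hk_length n f q = colength n (isum (frob_ideal n q) (princ n f))"

text \<open>The rank of multiplication by f on R/J_q. Ranks can be bounded by spanning sets and by
  independent families; \<open>hk_length\<close> is the complement in q^n.\<close>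

definition hk_rank :: "nat \<Rightarrow> 'a::field ser \<Rightarrow> nat \<Rightarrow> nat" where
  "hk_rank n f q = ser.rel_dim (isum (frob_ideal n q) (princ n f)) (frob_ideal n q)"

lemma fin_colength_hk_length:
  assumes "f \<in> series n" "q > 0"
  shows "is_ideal n (isum (frob_ideal n q) (princ n f))" "frob_ideal n q \<subseteq> isum (frob_ideal n q) (princ n f)"
    "fin_colength n (isum (frob_ideal n q) (princ n f))"
proof -
  show 1: "is_ideal n (isum (frob_ideal n q) (princ n f))"
    using assms by (intro is_ideal_isum is_ideal_frob_ideal is_ideal_princ)
  show 2: "frob_ideal n q \<subseteq> isum (frob_ideal n q) (princ n f)"
    using isum_upper(1)[OF is_ideal_frob_ideal[OF assms(2)] is_ideal_princ[OF assms(1)]] .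
  show "fin_colength n (isum (frob_ideal n q) (princ n f))"
    using fin_colength_mono[OF fin_colength_frob_ideal 1 2] assms by blast
qed

lemma hk_length_hk_rank:
  assumes "f \<in> series n" "q > 0"
  shows "q ^ n = hk_length n f q + hk_rank n f q"
  using colength_add[OF fin_colength_frob_ideal[OF assms(2)] fin_colength_hk_length(1,2)[OF assms]] colength_frob_ideal[OF assms(2), of n, where 'a = 'a]
  by (simp add: hk_length_def hk_rank_def)

lemma fin_codim_hk_length:
  assumes "f \<in> series n" "q > 0"
  shows "ser.fin_codim (isum (frob_ideal n q) (princ n f)) (frob_ideal n q)"
  using ser.fin_codim_sub[of "series n" "frob_ideal n q"] fin_colength_frob_ideal[OF assms(2), of n] is_idealD(1)[OF fin_colength_hk_length(1)[OF assms]]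
    is_ideal_subspace unfolding fin_colength_def by blast

lemma mset_divmod:
  fixes e :: "nat multiset"
  assumes "p > 0"
  obtains d b where "e = repeat_mset p d + b" "\<And>i. count b i < p"
proof -
  have "\<exists>d b. e = repeat_mset p d + b \<and> (\<forall>i. count b i < p)"
  proof (induction "size e" arbitrary: e rule: less_induct)
    case less
    show ?case
    proof (cases "\<forall>i. count e i < p")
      case True
      then show ?thesis by (intro exI[of _ "{#}"] exI[of _ e]) simp
    next
      case False
      then obtain i where "p \<le> count e i" by (auto simp: not_less)
      then have sub: "replicate_mset p i \<subseteq># e" by (simp add: count_le_replicate_mset_subset_eq)
      then obtain c where c: "e = replicate_mset p i + c" by (auto simp: mset_subset_eq_exists_conv)
      then have "size c < size e" using assms by simp
      then obtain d b where "c = repeat_mset p d + b" "\<forall>i. count b i < p" using less by blast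
      then show ?thesis using c by (intro exI[of _ "add_mset i d"] exI[of _ b]) simp
    qed
  qed
  then show ?thesis using that by blast
qed

text \<open>Writing a monomial as \<open>x\<^sup>b (x\<^sup>d)\<^sup>p\<close> turns a spanning set \<open>S\<close> of \<open>(f)\<close> modulo \<open>J\<^sub>q\<close> into
  the spanning set of all \<open>x\<^sup>b s\<^sup>p\<close> of \<open>(f\<^sup>p)\<close> modulo \<open>J\<^sub>p\<^sub>q\<close>, because \<open>p\<close>-th powers are additive.\<close>

lemma frob_span_mem:
  fixes f :: "'a::field ser"
  assumes f: "f \<in> series n" and q: "q > 0" and p: "prime CHAR('a)" and h: "h \<in> series n"
    and S: "finite S" "isum (frob_ideal n q) (princ n f) \<subseteq> ser.span (frob_ideal n q \<union> S)"
  shows "f ^ CHAR('a) * h \<in> ser.span (frob_ideal n (q * CHAR('a)) \<union>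
    (\<lambda>(b, s). xmonom b * s ^ CHAR('a)) ` (({e. \<forall>i. count e i < CHAR('a)} \<inter> exponents n) \<times> S))"
    (is "_ \<in> ser.span (?J \<union> ?S')")
proof -
  let ?p = "CHAR('a)"
  have p0: "?p > 0" using p prime_gt_0_nat by blast
  have Q: "q * ?p > 0" using q p0 by simp
  note iJ = is_ideal_frob_ideal[OF Q, of n, where 'a = 'a]
  let ?B = "{e. \<forall>i. count e i < q * ?p}"
  have fB: "finite (?B \<inter> exponents n)" using card_box[OF Q, of n] by blast
  have mon: "f ^ ?p * xmonom e \<in> ser.span (?J \<union> ?S')" if e: "e \<in> exponents n" for e
  proof -
    obtain d b where db: "e = repeat_mset ?p d + b" "\<And>i. count b i < ?p"
      using mset_divmod[OF p0, of e] by metis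
    have bn: "b \<in> exponents n" "d \<in> exponents n"
    proof -
      have "x \<in># repeat_mset ?p d" if "x \<in># d" for x
        using that p0 by (simp flip: count_greater_zero_iff)
      then show "b \<in> exponents n" "d \<in> exponents n" using e db(1) by (auto simp: exponents_def)
    qed
    have "f * xmonom d \<in> isum (frob_ideal n q) (princ n f)"
      using isum_upper(2)[OF is_ideal_frob_ideal[OF q] is_ideal_princ[OF f]] series_mono[OF bn(2)] unfolding princ_def by blast
    then have "f * xmonom d \<in> ser.span (frob_ideal n q \<union> S)" using S by blast
    then obtain j y where jy: "j \<in> ser.span (frob_ideal n q)" "y \<in> ser.span S" "f * xmonom d = j + y"
      unfolding ser.span_Un by blast
    have j: "j \<in> frob_ideal n q" using jy(1) is_ideal_subspace[OF is_ideal_frob_ideal[OF q, of n, where 'a = 'a]]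
      by (simp add: ser.span_eq_iff[THEN iffD2])
    obtain c where c: "y = (\<Sum>s\<in>S. scale_ser (c s) s)"
      using jy(2) unfolding ser.span_finite[OF S(1)] by blast
    \<comment> \<open>Frobenius is not k-linear: coefficients become their p-th powers, which are
      still scalars.\<close>
    have sc: "scale_ser a s ^ k = scale_ser (a ^ k) (s ^ k)" for a and s :: "'a ser" and k
      by (induction k) (auto simp: scale_ser_mult intro: ser_eqI)
    have "(f * xmonom d) ^ ?p = j ^ ?p + y ^ ?p"
      unfolding jy(3) by (rule freshmans_dream) (use p in auto)
    also have "y ^ ?p = (\<Sum>s\<in>S. scale_ser (c s ^ ?p) (s ^ ?p))"
      unfolding c by (subst freshmans_dream_sum[OF _ CHAR_ser[symmetric]]) (use p in \<open>auto simp: sc\<close>)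
    finally have "f ^ ?p * xmonom e = xmonom b * (j ^ ?p + (\<Sum>s\<in>S. scale_ser (c s ^ ?p) (s ^ ?p)))"
      by (simp add: db(1) mono_add mono_power[symmetric] power_mult_distrib ac_simps)
    also have "\<dots> = xmonom b * j ^ ?p + (\<Sum>s\<in>S. scale_ser (c s ^ ?p) (xmonom b * s ^ ?p))"
      by (simp add: distrib_left sum_distrib_left scale_ser_mult)
    also have "\<dots> \<in> ser.span (?J \<union> ?S')"
    proof (rule ser.span_add)
      have "j ^ ?p \<in> ?J" using frob_ideal_frob[OF j q p, of 1] by simp
      then have "xmonom b * j ^ ?p \<in> ?J" using series_mono[OF bn(1)] by (intro is_idealD(4)[OF iJ])
      then show "xmonom b * j ^ ?p \<in> ser.span (?J \<union> ?S')" by (intro ser.span_base) blast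
      show "(\<Sum>s\<in>S. scale_ser (c s ^ ?p) (xmonom b * s ^ ?p)) \<in> ser.span (?J \<union> ?S')"
      proof (rule ser.span_sum, rule ser.span_scale, rule ser.span_base)
        fix s assume "s \<in> S"
        then have "xmonom b * s ^ ?p \<in> ?S'" using bn db(2) by (intro image_eqI[of _ _ "(b, s)"]) auto
        then show "xmonom b * s ^ ?p \<in> ?J \<union> ?S'" by blast
      qed
    qed
    finally show ?thesis .
  qed
  \<comment> \<open>Modulo J_pq only the finitely many monomials of h in the box matter, and to
    those \<open>mon\<close> applies.\<close>
  let ?P = "\<Sum>e\<in>?B \<inter> exponents n. scale_ser (coef h e) (xmonom e)"
  have "f ^ ?p * (h - ?P) \<in> ?J"
    using trunc_in_vanish[OF h fB] unfolding frob_ideal_def[symmetric]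
    by (intro is_idealD(4)[OF iJ] series_power[OF f])
  then have 1: "f ^ ?p * (h - ?P) \<in> ser.span (?J \<union> ?S')" by (intro ser.span_base) blast
  have "f ^ ?p * ?P = (\<Sum>e\<in>?B \<inter> exponents n. scale_ser (coef h e) (f ^ ?p * xmonom e))"
    by (simp add: sum_distrib_left scale_ser_mult)
  also have "\<dots> \<in> ser.span (?J \<union> ?S')"
    by (rule ser.span_sum, rule ser.span_scale) (use mon in blast)
  finally have 2: "f ^ ?p * ?P \<in> ser.span (?J \<union> ?S')" .
  have "f ^ ?p * h = f ^ ?p * (h - ?P) + f ^ ?p * ?P" by (simp add: algebra_simps)
  with ser.span_add[OF 1 2] show ?thesis by simp
qed

text \<open>The spanning set of \<open>frob_span_mem\<close> has at most p^n elements for each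
  element of S, one for each b in the box of side p.\<close>

lemma hk_rank_frob:
  fixes f :: "'a::field ser"
  assumes f: "f \<in> series n" and q: "q > 0" and p: "prime CHAR('a)"
  shows "hk_rank n (f ^ CHAR('a)) (q * CHAR('a)) \<le> CHAR('a) ^ n * hk_rank n f q"
proof -
  let ?p = "CHAR('a)"
  let ?J = "frob_ideal n (q * ?p) :: 'a ser set"
  let ?W = "isum ?J (princ n (f ^ ?p))"
  have p0: "?p > 0" using p prime_gt_0_nat by blast
  have Q: "q * ?p > 0" using q p0 by simp
  have fp: "f ^ ?p \<in> series n" using f by (rule series_power)
  obtain S where S: "finite S" "card S = hk_rank n f q" "S \<subseteq> isum (frob_ideal n q) (princ n f)"
    "isum (frob_ideal n q) (princ n f) \<subseteq> ser.span (frob_ideal n q \<union> S)"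
    using ser.fin_codim_basis[OF fin_codim_hk_length[OF f q] is_ideal_subspace[OF is_ideal_frob_ideal[OF q]]] unfolding hk_rank_def by metis
  let ?B = "{e. \<forall>i. count e i < ?p} \<inter> exponents n"
  let ?S' = "(\<lambda>(b, s). xmonom b * s ^ ?p) ` (?B \<times> S)"
  have fB: "finite ?B" "card ?B = ?p ^ n" using card_box[OF p0, of n] by auto
  note iW = fin_colength_hk_length(1)[OF fp Q]
  \<comment> \<open>\<open>rel_dim\<close> admits only spanning sets inside the space; membership
    follows from s^p = j^p + f^p h^p.\<close>
  have "?S' \<subseteq> ?W"
  proof clarify
    fix b s assume b: "b \<in> exponents n" and s: "s \<in> S"
    then obtain j h where jh: "j \<in> frob_ideal n q" "h \<in> series n" "s = j + f * h"
      using S(3) unfolding isum_def princ_def by blast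
    have "s ^ ?p = j ^ ?p + (f * h) ^ ?p"
      unfolding jh(3) by (rule freshmans_dream) (use p in auto)
    then have "s ^ ?p = j ^ ?p + f ^ ?p * h ^ ?p" by (simp add: power_mult_distrib)
    moreover have "j ^ ?p \<in> ?J" using frob_ideal_frob[OF jh(1) q p, of 1] by simp
    ultimately have "s ^ ?p \<in> ?W"
      using series_power[OF jh(2)] unfolding isum_def princ_def by blast
    then show "xmonom b * s ^ ?p \<in> ?W" using b by (intro is_idealD(4)[OF iW] series_mono)
  qed
  moreover have "?W \<subseteq> ser.span (?J \<union> ?S')"
  proof
    fix w assume "w \<in> ?W"
    then obtain j h where jh: "j \<in> ?J" "h \<in> series n" "w = j + f ^ ?p * h"
      unfolding isum_def princ_def by blast
    have "j \<in> ser.span (?J \<union> ?S')" using jh(1) by (intro ser.span_base) blast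
    then show "w \<in> ser.span (?J \<union> ?S')"
      unfolding jh(3) using frob_span_mem[OF f q p jh(2) S(1,4)] by (rule ser.span_add)
  qed
  moreover have "finite ?S'" using fB S by blast
  ultimately have "hk_rank n (f ^ ?p) (q * ?p) \<le> card ?S'" unfolding hk_rank_def by (intro ser.rel_dim_le)
  also have "\<dots> \<le> card (?B \<times> S)" using fB S by (intro card_image_le) blast
  also have "\<dots> = ?p ^ n * hk_rank n f q" using fB S by (simp add: card_cartesian_product)
  finally show ?thesis .
qed

text \<open>The Frobenius comparison is an upper bound for ranks; taking complements in (pq)^n
  reverses it into a lower bound for the length of R modulo J_pq + (f^p).\<close>

lemma hk_length_frob_le:
  fixes f :: "'a::field ser"
  assumes f: "f \<in> series n" and q: "q > 0" and p: "prime CHAR('a)"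
  shows "CHAR('a) ^ n * hk_length n f q \<le> CHAR('a) * hk_length n f (q * CHAR('a))"
proof -
  let ?p = "CHAR('a)"
  have p0: "?p > 0" using p prime_gt_0_nat by blast
  have Q: "q * ?p > 0" using q p0 by simp
  have "?p ^ n * hk_length n f q + ?p ^ n * hk_rank n f q = ?p ^ n * q ^ n"
    unfolding hk_length_hk_rank[OF f q] by (simp add: distrib_left)
  also have "\<dots> = hk_length n (f ^ ?p) (q * ?p) + hk_rank n (f ^ ?p) (q * ?p)"
    using hk_length_hk_rank[OF series_power[OF f] Q] by (simp add: power_mult_distrib mult.commute)
  also have "\<dots> \<le> ?p * hk_length n f (q * ?p) + ?p ^ n * hk_rank n f q"
    using colength_isum_power_le[OF fin_colength_frob_ideal[OF Q] f, of ?p] hk_rank_frob[OF f q p]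
    unfolding hk_length_def by (intro add_mono)
  finally show ?thesis by simp
qed

text \<open>The ideal J_1 is the maximal ideal and contains f; this starts the induction in
  \<open>hk_length_ge\<close>.\<close>

lemma hk_length_1:
  assumes "f \<in> nu_filtration n 1"
  shows "hk_length n (f :: 'a::field ser) 1 = 1"
proof -
  have f: "f \<in> frob_ideal n 1" using assms nu_filtration_1_eq_frob_ideal by blast
  have i: "is_ideal n (frob_ideal n 1 :: 'a ser set)" by (rule is_ideal_frob_ideal) simp
  have fR: "f \<in> series n" using is_idealD(1)[OF i f] .
  have "isum (frob_ideal n 1) (princ n f) = frob_ideal n 1"
    using isum_least[OF i order_refl princ_least[OF i f]] isum_upper(1)[OF i is_ideal_princ[OF fR]] by blast
  then show ?thesis using colength_frob_ideal[of 1 n, where 'a = 'a] by (simp add: hk_length_def)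
qed

section \<open>Leading exponents and an upper bound for the lengths\<close>

lemma lead_exponent:
  assumes "F \<noteq> 0"
  obtains g where "coef F g \<noteq> 0" "\<And>e. coef F e \<noteq> 0 \<Longrightarrow> nu g \<le> nu e"
proof -
  have "\<exists>e. coef F e \<noteq> 0" using assms by (metis ser_eqI coef_0)
  then show ?thesis using that ex_has_least_nat[of "\<lambda>e. coef F e \<noteq> 0" _ nu] by blast
qed

text \<open>Among the b with nonzero coefficient take the one with least nu. No other multiple
  reaches the exponent b0 + g, so the combination has a nonzero coefficient there, inside the box
  where elements of J_q vanish.\<close>

lemma indep_mod_shift:
  fixes f :: "'a::field ser"
  assumes g: "coef f g \<noteq> 0" "\<And>e. coef f e \<noteq> 0 \<Longrightarrow> nu g \<le> nu e" and X: "finite X"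
    and box: "\<And>b i. b \<in> X \<Longrightarrow> count (b + g) i < q"
  shows "ser.indep_mod (frob_ideal n q) X (\<lambda>b. xmonom b * f)"
  unfolding ser.indep_mod_def
proof (intro allI impI, rule ccontr)
  fix c assume V: "(\<Sum>b\<in>X. scale_ser (c b) (xmonom b * f)) \<in> frob_ideal n q" and "\<not> (\<forall>b\<in>X. c b = 0)"
  then have "\<exists>b. b \<in> X \<and> c b \<noteq> 0" by blast
  then obtain b0 where b0: "b0 \<in> X" "c b0 \<noteq> 0" and min: "\<And>b. b \<in> X \<Longrightarrow> c b \<noteq> 0 \<Longrightarrow> nu b0 \<le> nu b"
    using ex_has_least_nat[of "\<lambda>b. b \<in> X \<and> c b \<noteq> 0" _ nu] by blast
  have z: "c b * coef (xmonom b * f) (b0 + g) = 0" if b: "b \<in> X - {b0}" for b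
  proof (rule ccontr)
    assume nz: "\<not> ?thesis"
    then have cb: "c b \<noteq> 0" and sub: "b \<subseteq># b0 + g" and nf: "coef f (b0 + g - b) \<noteq> 0"
      by (auto simp: coef_mono_mult split: if_splits)
    from sub obtain r where r: "b0 + g = b + r" by (auto simp: mset_subset_eq_exists_conv)
    with nf have "nu g \<le> nu r" using g(2) by simp
    moreover have "nu b0 * nu g = nu b * nu r" using r by (metis nu_add)
    moreover have "nu b0 \<le> nu b" using min b cb by blast
    moreover have "nu b * nu r \<le> nu b0 * nu r"
      using \<open>nu g \<le> nu r\<close> \<open>nu b0 * nu g = nu b * nu r\<close> by (metis mult_le_mono2)
    ultimately have "nu b0 = nu b" by simp
    then have "b0 = b" by (rule injD[OF inj_nu])
    with b show False by simp
  qed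
  have "coef (\<Sum>b\<in>X. scale_ser (c b) (xmonom b * f)) (b0 + g) = (\<Sum>b\<in>X. c b * coef (xmonom b * f) (b0 + g))"
    by simp
  also have "\<dots> = c b0 * coef (xmonom b0 * f) (b0 + g)"
  proof -
    have "(\<Sum>b\<in>X - {b0}. c b * coef (xmonom b * f) (b0 + g)) = 0" by (rule sum.neutral) (use z in blast)
    then show ?thesis by (simp add: sum.remove[OF X b0(1)])
  qed
  also have "\<dots> = c b0 * coef f g" by (simp add: coef_mono_mult)
  finally have "coef (\<Sum>b\<in>X. scale_ser (c b) (xmonom b * f)) (b0 + g) \<noteq> 0" using b0 g(1) by simp
  then show False using V box[OF b0(1)] by (auto simp: frob_ideal_def vanish_def)
qed

text \<open>A discrete mean value estimate; truncated subtraction makes it valid for q < g as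
  well.\<close>

lemma power_diff_le: "(q::nat) ^ Suc m \<le> (q - g) ^ Suc m + Suc m * g * q ^ m"
proof (induction m)
  case (Suc m)
  define r where "r = q - g"
  have rq: "q \<le> r + g" "r \<le> q" by (auto simp: r_def)
  have "q ^ Suc (Suc m) \<le> q * (r ^ Suc m + Suc m * g * q ^ m)"
    using Suc by (simp add: r_def)
  also have "\<dots> = q * r ^ Suc m + Suc m * g * q ^ Suc m" by (simp add: algebra_simps)
  also have "q * r ^ Suc m \<le> (r + g) * r ^ Suc m"
    using rq by (intro mult_right_mono) auto
  also have "\<dots> = r ^ Suc (Suc m) + g * r ^ Suc m" by (simp add: algebra_simps)
  also have "g * r ^ Suc m \<le> g * q ^ Suc m" using rq by (intro mult_left_mono power_mono) auto
  finally show ?case unfolding r_def by (simp add: algebra_simps)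
qed simp

lemma hk_length_bound:
  fixes f :: "'a::field ser"
  assumes f: "f \<in> series n" "f \<noteq> 0" and n: "n \<ge> 1"
  obtains C where "\<And>q. q > 0 \<Longrightarrow> hk_length n f q \<le> C * q ^ (n - 1)"
proof -
  obtain g where g: "coef f g \<noteq> 0" "\<And>e. coef f e \<noteq> 0 \<Longrightarrow> nu g \<le> nu e"
    using lead_exponent[OF f(2)] by blast
  \<comment> \<open>A box of side q - size g, shifted by g, stays in the box of side q, since no
    coordinate of g exceeds size g.\<close>
  have "hk_length n f q \<le> (n * size g) * q ^ (n - 1)" if q: "q > 0" for q
  proof -
    let ?X = "{e. \<forall>i. count e i < q - size g} \<inter> exponents n"
    have X: "(q - size g) ^ n \<le> card ?X \<and> finite ?X"
    proof (cases "q - size g = 0")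
      case True
      then have "?X = {}" by simp
      then show ?thesis using True n by simp
    next
      case False
      then show ?thesis using card_box[of "q - size g" n] by simp
    qed
    have "count (b + g) i < q" if "b \<in> ?X" for b i
    proof -
      have "count b i < q - size g" using that by blast
      then show ?thesis using count_le_size[of g i] by simp
    qed
    then have ind: "ser.indep_mod (frob_ideal n q) ?X (\<lambda>b. xmonom b * f)"
      using g X by (intro indep_mod_shift[of f g]) auto
    have im: "(\<lambda>b. xmonom b * f) ` ?X \<subseteq> isum (frob_ideal n q) (princ n f)"
    proof clarify
      fix b assume "b \<in> exponents n"
      then have "xmonom b * f \<in> princ n f"
        using series_mono[of b n] by (auto simp: princ_def mult.commute)
      then show "xmonom b * f \<in> isum (frob_ideal n q) (princ n f)"
        using isum_upper(2)[OF is_ideal_frob_ideal[OF q] is_ideal_princ[OF f(1)]] by blast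
    qed
    have "(q - size g) ^ n \<le> hk_rank n f q"
      using ser.rel_dim_ge[OF fin_codim_hk_length[OF f(1) q] is_ideal_subspace[OF is_ideal_frob_ideal[OF q]] _ ind im] X
      unfolding hk_rank_def by simp
    moreover have "q ^ n \<le> (q - size g) ^ n + n * size g * q ^ (n - 1)"
      using power_diff_le[of q "n - 1" "size g"] n by simp
    ultimately show ?thesis using hk_length_hk_rank[OF f(1) q] by linarith
  qed
  then show ?thesis using that by blast
qed

text \<open>Lift a basis of the image of f to multipliers \<open>h s\<close>. Independence of the
  products (f + \<alpha>g) h s modulo J_q is a condition on coefficient vectors with entries of
  degree at most 1 in \<alpha>, so it passes from \<alpha> = 0 to all but finitely many \<alpha>,
  and the rank does not drop there.\<close>

lemma hk_length_semicont:
  fixes f g :: "'a::field ser"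
  assumes f: "f \<in> series n" and g: "g \<in> series n" and q: "q > 0"
  shows "finite {\<alpha>. hk_length n f q < hk_length n (f + scale_ser \<alpha> g) q}"
proof -
  obtain S where S: "finite S" "card S = hk_rank n f q" "S \<subseteq> isum (frob_ideal n q) (princ n f)"
    "ser.indep_mod (frob_ideal n q) S (\<lambda>x. x)"
    using ser.fin_codim_basis[OF fin_codim_hk_length[OF f q] is_ideal_subspace[OF is_ideal_frob_ideal[OF q]]] unfolding hk_rank_def by metis
  note iJ = is_ideal_frob_ideal[OF q, of n, where 'a = 'a]
  have "\<forall>s\<in>S. \<exists>h. h \<in> series n \<and> s - f * h \<in> frob_ideal n q"
  proof
    fix s assume "s \<in> S"
    then obtain j h where "j \<in> frob_ideal n q" "h \<in> series n" "s = j + f * h"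
      using S(3) unfolding isum_def princ_def by blast
    then show "\<exists>h. h \<in> series n \<and> s - f * h \<in> frob_ideal n q" by (intro exI[of _ h]) simp
  qed
  then obtain h where h: "\<And>s. s \<in> S \<Longrightarrow> h s \<in> series n" "\<And>s. s \<in> S \<Longrightarrow> s - f * h s \<in> frob_ideal n q"
    by metis
  \<comment> \<open>Coefficients outside the box are set to 0, as they do not affect membership in
    J_q.\<close>
  define v where "v s e = (if \<forall>i. count e i < q then [:coef (f * h s) e, coef (g * h s) e:] else 0)" for s e
  have vp: "(\<Sum>s\<in>S. c s * poly (v s e) \<alpha>) = (if \<forall>i. count e i < q
      then coef (\<Sum>s\<in>S. scale_ser (c s) ((f + scale_ser \<alpha> g) * h s)) e else 0)" for c e \<alpha>
  proof (cases "\<forall>i. count e i < q")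
    case True
    then show ?thesis by (simp add: v_def distrib_right scale_ser_mult)
  next
    case False
    then have "v s e = 0" for s unfolding v_def by (rule if_not_P)
    then show ?thesis unfolding if_not_P[OF False] by simp
  qed
  have mem: "(\<Sum>s\<in>S. scale_ser (c s) ((f + scale_ser \<alpha> g) * h s)) \<in> frob_ideal n q \<longleftrightarrow>
      (\<forall>e. (\<Sum>s\<in>S. c s * poly (v s e) \<alpha>) = 0)" for c \<alpha>
  proof -
    have "(\<Sum>s\<in>S. scale_ser (c s) ((f + scale_ser \<alpha> g) * h s)) \<in> series n"
      using h f g by (intro series_sum) (auto intro!: series_closed)
    then show ?thesis unfolding frob_ideal_def vanish_def vp by auto
  qed
  have "finite {\<alpha>. \<not> (\<forall>c. (\<forall>e. (\<Sum>i\<in>S. c i * poly (v i e) \<alpha>) = 0) \<longrightarrow> (\<forall>i\<in>S. c i = 0))}"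
  proof (rule indep_poly[OF S(1)])
    fix c assume "\<And>e. (\<Sum>i\<in>S. c i * poly (v i e) 0) = 0"
    then have "(\<Sum>s\<in>S. scale_ser (c s) ((f + scale_ser 0 g) * h s)) \<in> frob_ideal n q" using mem[of c 0] by blast
    then have 1: "(\<Sum>s\<in>S. scale_ser (c s) (f * h s)) \<in> frob_ideal n q" by simp
    have 2: "(\<Sum>s\<in>S. scale_ser (c s) (s - f * h s)) \<in> frob_ideal n q"
      using h by (intro is_ideal_sum[OF iJ] is_idealD(6)[OF iJ])
    have "(\<Sum>s\<in>S. scale_ser (c s) s) = (\<Sum>s\<in>S. scale_ser (c s) (f * h s)) + (\<Sum>s\<in>S. scale_ser (c s) (s - f * h s))"
      by (simp add: ser.scale_right_diff_distrib sum_subtractf)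
    then have "(\<Sum>s\<in>S. scale_ser (c s) s) \<in> frob_ideal n q" using is_idealD(3)[OF iJ 1 2] by simp
    then show "\<forall>i\<in>S. c i = 0" by (intro ballI ser.indep_modD[OF S(4)])
  qed
  moreover have le: "hk_length n (f + scale_ser \<alpha> g) q \<le> hk_length n f q"
    if good: "\<forall>c. (\<forall>e. (\<Sum>i\<in>S. c i * poly (v i e) \<alpha>) = 0) \<longrightarrow> (\<forall>i\<in>S. c i = 0)" for \<alpha>
  proof -
    let ?F = "f + scale_ser \<alpha> g"
    have F: "?F \<in> series n" using f g by (auto intro: series_closed)
    have ind: "ser.indep_mod (frob_ideal n q) S (\<lambda>s. ?F * h s)"
      unfolding ser.indep_mod_def mem using good by blast
    have im: "(\<lambda>s. ?F * h s) ` S \<subseteq> isum (frob_ideal n q) (princ n ?F)"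
    proof clarify
      fix s assume "s \<in> S"
      then have "?F * h s \<in> princ n ?F" using h unfolding princ_def by blast
      then show "?F * h s \<in> isum (frob_ideal n q) (princ n ?F)"
        using isum_upper(2)[OF iJ is_ideal_princ[OF F]] by blast
    qed
    have "hk_rank n f q \<le> hk_rank n ?F q"
      using ser.rel_dim_ge[OF fin_codim_hk_length[OF F q] is_ideal_subspace[OF iJ] S(1) ind im] S(2)
      unfolding hk_rank_def by simp
    then show ?thesis using hk_length_hk_rank[OF f q] hk_length_hk_rank[OF F q] by linarith
  qed
  have "{\<alpha>. hk_length n f q < hk_length n (f + scale_ser \<alpha> g) q} \<subseteq>
      {\<alpha>. \<not> (\<forall>c. (\<forall>e. (\<Sum>i\<in>S. c i * poly (v i e) \<alpha>) = 0) \<longrightarrow> (\<forall>i\<in>S. c i = 0))}"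
  proof (rule Collect_mono, rule impI, rule notI)
    fix \<alpha> assume lt: "hk_length n f q < hk_length n (f + scale_ser \<alpha> g) q"
      and good: "\<forall>c. (\<forall>e. (\<Sum>i\<in>S. c i * poly (v i e) \<alpha>) = 0) \<longrightarrow> (\<forall>i\<in>S. c i = 0)"
    from le[OF good] lt show False by linarith
  qed
  ultimately show ?thesis by (rule finite_subset[rotated])
qed

section \<open>Standard bases\<close>

text \<open>A refinement of \<open>nu_filtration\<close>: nu is injective, so consecutive members
  differ by at most one monomial.\<close>

definition nu_ge :: "nat \<Rightarrow> nat \<Rightarrow> 'a::comm_ring_1 ser set" where
  "nu_ge n N = vanish n {e. nu e < N}"

lemma nu_ge_iff: "F \<in> nu_ge n N \<longleftrightarrow> F \<in> series n \<and> (\<forall>e. nu e < N \<longrightarrow> coef F e = 0)"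
  by (simp add: nu_ge_def vanish_def)

lemma nu_filtration_nu_ge: "nu_filtration n M = nu_ge n (2 ^ M)"
  by (simp add: nu_filtration_def nu_ge_def)

text \<open>K measures the loss when a series of order N is divided by elements whose leading
  exponents have nu at most K. In the index M of \<open>nu_filtration\<close> a factor K becomes an
  additive shift, which is the form Artin--Rees takes.\<close>

definition nu_bounded :: "nat \<Rightarrow> nat \<Rightarrow> nat \<Rightarrow> 'l set \<Rightarrow> ('l \<Rightarrow> 'a::comm_ring_1 ser) \<Rightarrow> bool" where
  "nu_bounded n K N L h \<longleftrightarrow> (\<forall>l\<in>L. h l \<in> series n \<and> (\<forall>e. coef (h l) e \<noteq> 0 \<longrightarrow> N \<le> nu e * K))"

text \<open>Division iterated infinitely often. The k-th correction involves only exponents with nu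
  at least (N + k)/K, so each coefficient receives finitely many contributions and the corrections
  can be summed.\<close>

lemma successive_approximation:
  fixes g :: "'l \<Rightarrow> 'a::comm_ring_1 ser"
  assumes g: "\<And>l. l \<in> L \<Longrightarrow> g l \<in> series n" and K: "K \<ge> 1"
    and step: "\<And>N F. F \<in> X \<Longrightarrow> F \<in> nu_ge n N \<Longrightarrow>
      \<exists>h. nu_bounded n K N L h \<and> F - (\<Sum>l\<in>L. h l * g l) \<in> X \<and> F - (\<Sum>l\<in>L. h l * g l) \<in> nu_ge n (Suc N)"
    and F: "F \<in> X" "F \<in> nu_ge n N"
  shows "\<exists>h. nu_bounded n K N L h \<and> F = (\<Sum>l\<in>L. h l * g l)"
proof -
  define good where "good N F h \<longleftrightarrow> nu_bounded n K N L h \<and> F - (\<Sum>l\<in>L. h l * g l) \<in> X \<and>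
      F - (\<Sum>l\<in>L. h l * g l) \<in> nu_ge n (Suc N)" for N F h
  define st where "st N F = (SOME h. good N F h)" for N F
  have "good N F (st N F)" if "F \<in> X" "F \<in> nu_ge n N" for N F
  proof -
    have "\<exists>h. good N F h" using step[OF that] unfolding good_def .
    then show ?thesis unfolding st_def by (rule someI_ex)
  qed
  then have st: "\<And>N F. F \<in> X \<Longrightarrow> F \<in> nu_ge n N \<Longrightarrow> nu_bounded n K N L (st N F)"
    "\<And>N F. F \<in> X \<Longrightarrow> F \<in> nu_ge n N \<Longrightarrow> F - (\<Sum>l\<in>L. st N F l * g l) \<in> X"
    "\<And>N F. F \<in> X \<Longrightarrow> F \<in> nu_ge n N \<Longrightarrow> F - (\<Sum>l\<in>L. st N F l * g l) \<in> nu_ge n (Suc N)"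
    unfolding good_def by simp_all
  define Fs where "Fs = rec_nat F (\<lambda>k G. G - (\<Sum>l\<in>L. st (N + k) G l * g l))"
  have Fs0: "Fs 0 = F" and FsS: "Fs (Suc k) = Fs k - (\<Sum>l\<in>L. st (N + k) (Fs k) l * g l)" for k
    by (simp_all add: Fs_def)
  have inv: "Fs k \<in> X \<and> Fs k \<in> nu_ge n (N + k)" for k
  proof (induction k)
    case (Suc k)
    then show ?case using st(2,3)[of "Fs k" "N + k"] by (simp add: FsS)
  qed (use F Fs0 in auto)
  define H where "H k l = st (N + k) (Fs k) l" for k l
  have H: "nu_bounded n K (N + k) L (H k)" for k
    using st(1)[of "Fs k" "N + k"] inv[of k] unfolding H_def by blast
  have Fsum: "F = Fs m + (\<Sum>k<m. \<Sum>l\<in>L. H k l * g l)" for m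
    by (induction m) (simp_all add: Fs0 FsS H_def)
  \<comment> \<open>Corrections with k > nu e * K vanish at e, so the sum stops at
    \<open>nu e * K\<close> inclusive; \<open>hcoef\<close> allows any longer range.\<close>
  define h where "h l = Ser (\<lambda>e. \<Sum>k<Suc (nu e * K). coef (H k l) e)" for l
  have hcoef: "coef (h l) e = (\<Sum>k<m. coef (H k l) e)" if "l \<in> L" "nu e * K < m" for l e m
  proof -
    have "(\<Sum>k<m. coef (H k l) e) = (\<Sum>k<Suc (nu e * K). coef (H k l) e)"
    proof (rule sum.mono_neutral_right)
      show "\<forall>k\<in>{..<m} - {..<Suc (nu e * K)}. coef (H k l) e = 0"
      proof
        fix k assume "k \<in> {..<m} - {..<Suc (nu e * K)}"
        then have "\<not> N + k \<le> nu e * K" by auto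
        with H[of k] \<open>l \<in> L\<close> show "coef (H k l) e = 0" unfolding nu_bounded_def by blast
      qed
    qed (use that in auto)
    then show ?thesis by (simp add: h_def)
  qed
  have "nu_bounded n K N L h"
    unfolding nu_bounded_def
  proof (intro ballI conjI allI impI)
    fix l assume l: "l \<in> L"
    have HR: "H k l \<in> series n" for k using H[of k] l unfolding nu_bounded_def by blast
    show "h l \<in> series n"
      unfolding series_def
    proof (rule CollectI, intro allI impI, rule ccontr)
      fix e assume "coef (h l) e \<noteq> 0" "e \<notin> exponents n"
      moreover have "(\<Sum>k<Suc (nu e * K). coef (H k l) e) = 0"
        by (rule sum.neutral) (use series_coef[OF HR \<open>e \<notin> exponents n\<close>] in blast)
      ultimately show False by (simp add: h_def)
    qed
    fix e assume "coef (h l) e \<noteq> 0"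
    then have "(\<Sum>k<Suc (nu e * K). coef (H k l) e) \<noteq> 0" by (simp add: h_def)
    then obtain k where "coef (H k l) e \<noteq> 0"
      by (rule sum.not_neutral_contains_not_neutral)
    then have "N + k \<le> nu e * K" using H[of k] l unfolding nu_bounded_def by blast
    then show "N \<le> nu e * K" by simp
  qed
  moreover have "F = (\<Sum>l\<in>L. h l * g l)"
  proof (rule ser_eqI)
    fix e
    \<comment> \<open>One m serves the whole coefficient at e: every divisor of e has nu at most nu
      e, and the remainder \<open>Fs m\<close> has no terms with nu below N + m, hence none at
      e.\<close>
    define m where "m = Suc (nu e * K)"
    have "nu e < N + m" using K by (simp add: m_def less_Suc_eq_le trans_le_add2)
    then have "coef (Fs m) e = 0" using inv[of m] by (simp add: nu_ge_iff)
    then have "coef F e = (\<Sum>k<m. \<Sum>l\<in>L. coef (H k l * g l) e)"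
      using arg_cong[OF Fsum[of m], of "\<lambda>G. coef G e"] by simp
    also have "\<dots> = (\<Sum>l\<in>L. \<Sum>k<m. coef (H k l * g l) e)" by (rule sum.swap)
    also have "\<dots> = (\<Sum>l\<in>L. coef (h l * g l) e)"
    proof (rule sum.cong)
      fix l assume l: "l \<in> L"
      have "coef (h l * g l) e = (\<Sum>x\<in>splits e. (\<Sum>k<m. coef (H k l) (fst x)) * coef (g l) (snd x))"
        unfolding coef_mult case_prod_unfold
      proof (rule sum.cong)
        fix x assume "x \<in> splits e"
        then have "nu (fst x) \<le> nu e" by (auto simp: splits_def intro: nu_mono)
        then have "nu (fst x) * K < m" by (simp add: m_def less_Suc_eq_le)
        then show "coef (h l) (fst x) * coef (g l) (snd x) =
            (\<Sum>k<m. coef (H k l) (fst x)) * coef (g l) (snd x)"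
          by (subst hcoef[OF l]) auto
      qed simp
      also have "\<dots> = (\<Sum>x\<in>splits e. \<Sum>k<m. coef (H k l) (fst x) * coef (g l) (snd x))"
        by (simp add: sum_distrib_right)
      also have "\<dots> = (\<Sum>k<m. \<Sum>x\<in>splits e. coef (H k l) (fst x) * coef (g l) (snd x))"
        by (rule sum.swap)
      finally show "(\<Sum>k<m. coef (H k l * g l) e) = coef (h l * g l) e"
        by (simp add: coef_mult case_prod_unfold)
    qed simp
    finally show "coef F e = coef (\<Sum>l\<in>L. h l * g l) e" by simp
  qed
  ultimately show ?thesis by blast
qed

definition lead :: "'a::comm_ring_1 ser \<Rightarrow> nat multiset \<Rightarrow> bool" where
  "lead F l \<longleftrightarrow> coef F l \<noteq> 0 \<and> (\<forall>e. coef F e \<noteq> 0 \<longrightarrow> nu l \<le> nu e)"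

text \<open>The monomial multiple of G has leading exponent e; it cancels that coefficient and
  otherwise touches only exponents with larger nu.\<close>

lemma reduction_step:
  fixes F G :: "'a::field ser"
  assumes F: "F \<in> nu_ge n (nu e)" and G: "G \<in> series n" "lead G l" and le: "l \<subseteq># e" and e: "e \<in> exponents n"
  shows "F - scale_ser (coef F e / coef G l) (xmonom (e - l)) * G \<in> nu_ge n (Suc (nu e))"
proof -
  let ?c = "coef F e / coef G l"
  have "e - l \<in> exponents n" using e le by (metis exponents_add_iff subset_mset.add_diff_inverse)
  then have 1: "F - scale_ser ?c (xmonom (e - l)) * G \<in> series n"
    using F G by (auto simp: nu_ge_iff intro!: series_closed series_mono)
  have nue: "nu e = nu (e - l) * nu l" using le by (metis nu_add subset_mset.diff_add)
  have "coef (F - scale_ser ?c (xmonom (e - l)) * G) d = 0" if "nu d < Suc (nu e)" for d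
  proof (cases "d = e")
    case True
    have "e - (e - l) = l" "e - l \<subseteq># e"
      using le by (simp_all add: multiset_eq_iff mset_subset_eq_count subseteq_mset_def)
    then show ?thesis using True G(2) by (simp add: scale_ser_mult coef_mono_mult lead_def)
  next
    case False
    then have "nu d \<noteq> nu e" using injD[OF inj_nu] by blast
    with that have less: "nu d < nu e" by simp
    have "coef (xmonom (e - l) * G) d = 0"
    proof (rule ccontr)
      assume "coef (xmonom (e - l) * G) d \<noteq> 0"
      then have sub: "e - l \<subseteq># d" and nz: "coef G (d - (e - l)) \<noteq> 0"
        by (auto simp: coef_mono_mult split: if_splits)
      have "nu l \<le> nu (d - (e - l))" using G(2) nz unfolding lead_def by blast
      moreover have "nu d = nu (e - l) * nu (d - (e - l))"
        using sub by (metis nu_add subset_mset.add_diff_inverse)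
      ultimately have "nu e \<le> nu d" using nue by simp
      with less show False by simp
    qed
    with F less show ?thesis by (simp add: scale_ser_mult nu_ge_iff)
  qed
  with 1 show ?thesis unfolding nu_ge_iff by blast
qed

section \<open>Dickson's lemma\<close>

lemma incseq_subseq_nat:
  fixes s :: "nat \<Rightarrow> nat"
  obtains r where "strict_mono r" "incseq (\<lambda>m. s (r m))"
proof -
  obtain r where r: "strict_mono r" "monoseq (\<lambda>m. s (r m))" using seq_monosub[of s] by blast
  show ?thesis
  proof (cases "incseq (\<lambda>m. s (r m))")
    case False
    then have dec: "decseq (\<lambda>m. s (r m))" using r(2) by (simp add: monoseq_iff)
    \<comment> \<open>A nonincreasing sequence of natural numbers is constant from its minimum
      on.\<close>
    obtain k where k: "\<And>m. s (r k) \<le> s (r m)"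
      using ex_has_least_nat[of "\<lambda>_. True" 0 "\<lambda>m. s (r m)"] by blast
    have eq: "s (r (m + k)) = s (r k)" for m
      using decseqD[OF dec, of k "m + k"] k[of "m + k"] by simp
    have "strict_mono (\<lambda>m. r (m + k))" using r(1) by (simp add: strict_mono_def)
    moreover have "incseq (\<lambda>m. s (r (m + k)))" by (simp add: eq incseq_def)
    ultimately show ?thesis using that by blast
  next
    case True
    then show ?thesis by (rule that[OF r(1)])
  qed
qed

text \<open>Passing to subsequences one variable at a time makes every coordinate nondecreasing; any
  two terms of the result are then comparable.\<close>

lemma dickson_pair:
  fixes f :: "nat \<Rightarrow> nat multiset"
  assumes "\<And>i. f i \<in> exponents n"
  obtains i j where "i < j" "f i \<subseteq># f j"
proof -
  have "\<exists>r. strict_mono r \<and> (\<forall>i<k. incseq (\<lambda>m. count (f (r m)) i))" for k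
  proof (induction k)
    case 0
    show ?case by (intro exI[of _ "\<lambda>x. x"]) (simp add: strict_mono_def)
  next
    case (Suc k)
    then obtain r where r: "strict_mono r" "\<And>i. i < k \<Longrightarrow> incseq (\<lambda>m. count (f (r m)) i)" by blast
    obtain r' where r': "strict_mono r'" "incseq (\<lambda>m. count (f (r (r' m))) k)"
      using incseq_subseq_nat[of "\<lambda>m. count (f (r m)) k"] by blast
    have "incseq (\<lambda>m. count (f (r (r' m))) i)" if "i < Suc k" for i
    proof (cases "i = k")
      case False
      then have "incseq (\<lambda>m. count (f (r m)) i)" using r(2) that by simp
      then show ?thesis using r'(1) by (simp add: incseq_def strict_mono_less_eq)
    qed (use r' in simp)
    moreover have "strict_mono (\<lambda>m. r (r' m))" using r(1) r'(1) by (simp add: strict_mono_def)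
    ultimately show ?case by (intro exI[of _ "\<lambda>m. r (r' m)"]) blast
  qed
  then obtain r where r: "strict_mono r" "\<And>i. i < n \<Longrightarrow> incseq (\<lambda>m. count (f (r m)) i)" by blast
  have "f (r 0) \<subseteq># f (r 1)"
  proof (rule mset_subset_eqI)
    fix i
    show "count (f (r 0)) i \<le> count (f (r 1)) i"
    proof (cases "i < n")
      case True
      then show ?thesis using incseqD[OF r(2), of i 0 1] by simp
    next
      case False
      then have "i \<notin># f (r 0)" using assms[of "r 0"] by (auto simp: exponents_def)
      then show ?thesis by (simp add: not_in_iff)
    qed
  qed
  moreover have "r 0 < r 1" using r(1) by (simp add: strict_mono_def)
  ultimately show ?thesis using that by blast
qed

text \<open>The minimal elements of A are pairwise incomparable, so by \<open>dickson_pair\<close>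
  there are only finitely many.\<close>

lemma dickson:
  assumes A: "A \<subseteq> exponents n"
  obtains L where "finite L" "L \<subseteq> A" "\<And>e. e \<in> A \<Longrightarrow> \<exists>l\<in>L. l \<subseteq># e"
proof -
  define L where "L = {l \<in> A. \<forall>d\<in>A. d \<subseteq># l \<longrightarrow> d = l}"
  have "\<exists>l\<in>L. l \<subseteq># e" if "e \<in> A" for e
    using that
  proof (induction "size e" arbitrary: e rule: less_induct)
    case less
    show ?case
    proof (cases "e \<in> L")
      case False
      then obtain d where d: "d \<in> A" "d \<subseteq># e" "d \<noteq> e" using less.prems by (auto simp: L_def)
      then have "size d < size e" by (simp add: mset_subset_size subset_mset.less_le)
      then obtain l where "l \<in> L" "l \<subseteq># d" using less.hyps d(1) by blast
      then show ?thesis using d(2) subset_mset.order_trans by blast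
    qed blast
  qed
  moreover have "finite L"
  proof (rule ccontr)
    assume "infinite L"
    then obtain f :: "nat \<Rightarrow> nat multiset" where f: "inj f" "range f \<subseteq> L"
      using infinite_countable_subset by blast
    have "f i \<in> exponents n" for i using f(2) A by (auto simp: L_def)
    then obtain i j where ij: "i < j" "f i \<subseteq># f j" using dickson_pair by blast
    have "f i \<in> A" "f j \<in> L" using f(2) by (auto simp: L_def)
    with ij(2) have "f i = f j" by (auto simp: L_def)
    with f(1) ij(1) show False by (metis injD less_irrefl)
  qed
  ultimately show ?thesis using that[of L] by (auto simp: L_def)
qed

text \<open>L generates the leading exponents of I, and \<open>g l\<close> has leading exponent l.
  The gain over mere generation of I is that K depends on neither N nor F.\<close>

lemma standard_basis:
  fixes I :: "'a::field ser set"
  assumes I: "is_ideal n I"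
  obtains L K and g :: "nat multiset \<Rightarrow> 'a ser" where "finite L" "g ` L \<subseteq> I"
    "\<forall>N F. F \<in> I \<longrightarrow> F \<in> nu_ge n N \<longrightarrow> (\<exists>h. nu_bounded n K N L h \<and> F = (\<Sum>l\<in>L. h l * g l))"
proof -
  define A where "A = {l. \<exists>F\<in>I. lead F l}"
  have Aexpo: "A \<subseteq> exponents n" using is_idealD(1)[OF I] by (auto simp: A_def lead_def series_def)
  obtain L where L: "finite L" "L \<subseteq> A" "\<And>e. e \<in> A \<Longrightarrow> \<exists>l\<in>L. l \<subseteq># e"
    using dickson[OF Aexpo] by blast
  have "\<forall>l\<in>L. \<exists>G. G \<in> I \<and> lead G l" using L(2) by (auto simp: A_def)
  then obtain g where g: "\<And>l. l \<in> L \<Longrightarrow> g l \<in> I" "\<And>l. l \<in> L \<Longrightarrow> lead (g l) l" by metis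
  \<comment> \<open>Any common bound for the \<open>nu l\<close> works: cancelling at e uses the
    monomial e - l, and N = nu (e - l) * nu l. The summand 1 keeps K positive when L is
    empty.\<close>
  define K where "K = 1 + (\<Sum>l\<in>L. nu l)"
  have Kl: "nu l \<le> K" if "l \<in> L" for l
    using member_le_sum[of l L nu] that L(1) by (simp add: K_def)
  have "\<exists>h. nu_bounded n K N L h \<and> F = (\<Sum>l\<in>L. h l * g l)" if F: "F \<in> I" "F \<in> nu_ge n N" for N F
  proof (rule successive_approximation[of L g n K I])
    fix N F assume F: "F \<in> I" "F \<in> nu_ge n N"
    show "\<exists>h. nu_bounded n K N L h \<and> F - (\<Sum>l\<in>L. h l * g l) \<in> I \<and> F - (\<Sum>l\<in>L. h l * g l) \<in> nu_ge n (Suc N)"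
    proof (cases "\<exists>e. nu e = N \<and> coef F e \<noteq> 0")
      case True
      then obtain e where e: "nu e = N" "coef F e \<noteq> 0" by blast
      have "lead F e" using e F(2) by (auto simp: lead_def nu_ge_iff not_less)
      then have "e \<in> A" using F by (auto simp: A_def)
      then obtain l where l: "l \<in> L" "l \<subseteq># e" using L(3) by blast
      have en: "e \<in> exponents n" using \<open>e \<in> A\<close> Aexpo by blast
      then have eln: "e - l \<in> exponents n" using l by (metis exponents_add_iff subset_mset.add_diff_inverse)
      define q where "q = scale_ser (coef F e / coef (g l) l) (xmonom (e - l) :: 'a ser)"
      have qR: "q \<in> series n" unfolding q_def using eln by (auto intro: series_closed series_mono)
      define h where "h l' = (if l' = l then q else 0)" for l'
      have "(\<Sum>l'\<in>L. h l' * g l') = (\<Sum>l'\<in>L. if l = l' then q * g l' else 0)"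
        by (rule sum.cong) (auto simp: h_def)
      then have sum: "(\<Sum>l'\<in>L. h l' * g l') = q * g l" using l L(1) by simp
      have "nu_bounded n K N L h"
        unfolding nu_bounded_def
      proof (intro ballI conjI allI impI)
        fix l' d assume "coef (h l') d \<noteq> 0"
        then have "d = e - l" by (auto simp: h_def q_def coef_mono split: if_splits)
        then have "N = nu d * nu l" using l(2) e(1) by (metis nu_add subset_mset.diff_add)
        then show "N \<le> nu d * K" using Kl[OF l(1)] by simp
      qed (auto simp: h_def qR)
      moreover have "F - q * g l \<in> I"
        using F g l qR by (auto intro: is_idealD[OF I])
      moreover have "F - q * g l \<in> nu_ge n (Suc N)"
        using reduction_step[of F n e "g l" l] F e(1) g[OF l(1)] l en is_idealD(1)[OF I] unfolding q_def by simp
      ultimately show ?thesis using sum by (intro exI[of _ h]) simp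
    next
      case False
      then have "F \<in> nu_ge n (Suc N)" using F by (auto simp: nu_ge_iff less_Suc_eq)
      then show ?thesis using F by (intro exI[of _ "\<lambda>_. 0"]) (simp add: nu_bounded_def)
    qed
  qed (use g F is_idealD(1)[OF I] in \<open>auto simp: K_def\<close>)
  then have "\<forall>N F. F \<in> I \<longrightarrow> F \<in> nu_ge n N \<longrightarrow> (\<exists>h. nu_bounded n K N L h \<and> F = (\<Sum>l\<in>L. h l * g l))"
    by blast
  moreover have "g ` L \<subseteq> I" using g(1) by blast
  ultimately show ?thesis using that L(1) by blast
qed

section \<open>Units, the maximal ideal and ascending chains of ideals\<close>

lemma is_ideal_unit:
  fixes I :: "'a::field ser set"
  assumes I: "is_ideal n I" and F: "F \<in> I" "coef F {#} \<noteq> 0"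
  shows "I = series n"
proof -
  have FR: "F \<in> series n" using is_idealD(1)[OF I F(1)] .
  have ld: "lead F {#}" using F(2) by (simp add: lead_def Suc_leI)
  \<comment> \<open>A nonzero constant term means leading exponent \<open>{#}\<close> of nu value 1,
    so division by F loses nothing (K = 1) and exhibits the series 1 as a multiple of F.\<close>
  have "\<exists>h. nu_bounded n 1 0 {()} h \<and> (1 :: 'a ser) = (\<Sum>l\<in>{()}. h l * F)"
  proof (rule successive_approximation[of "{()}" "\<lambda>_. F" n 1 "series n"])
    fix N and G :: "'a ser" assume G: "G \<in> series n" "G \<in> nu_ge n N"
    show "\<exists>h. nu_bounded n 1 N {()} h \<and> G - (\<Sum>l\<in>{()}. h l * F) \<in> series n \<and> G - (\<Sum>l\<in>{()}. h l * F) \<in> nu_ge n (Suc N)"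
    proof (cases "\<exists>e. nu e = N \<and> coef G e \<noteq> 0")
      case True
      then obtain e where e: "nu e = N" "coef G e \<noteq> 0" by blast
      then have en: "e \<in> exponents n" using G(1) by (auto simp: series_def)
      let ?q = "scale_ser (coef G e / coef F {#}) (xmonom e) :: 'a ser"
      have q: "G - ?q * F \<in> nu_ge n (Suc N)"
        using reduction_step[of G n e F "{#}"] G(2) e(1) FR ld en by simp
      have "?q \<in> series n" using en by (auto intro: series_closed series_mono)
      then have "nu_bounded n 1 N {()} (\<lambda>_. ?q)" using e by (auto simp: nu_bounded_def coef_mono split: if_splits)
      with q show ?thesis by (intro exI[of _ "\<lambda>_. ?q"]) (simp add: nu_ge_iff)
    next
      case False
      then have "G \<in> nu_ge n (Suc N)" using G by (auto simp: nu_ge_iff less_Suc_eq)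
      then show ?thesis using G by (intro exI[of _ "\<lambda>_. 0"]) (simp add: nu_bounded_def)
    qed
  qed (use FR in \<open>auto simp: nu_ge_iff\<close>)
  then obtain h where "h () \<in> series n" "1 = h () * F" by (auto simp: nu_bounded_def)
  then have "1 \<in> I" using is_idealD(4)[OF I F(1)] by metis
  then show ?thesis by (rule is_ideal_one[OF I])
qed

lemma is_ideal_le_max:
  fixes I :: "'a::field ser set"
  assumes "is_ideal n I" "I \<noteq> series n"
  shows "I \<subseteq> nu_filtration n 1"
proof
  fix F assume F: "F \<in> I"
  then have "coef F {#} = 0" using is_ideal_unit[OF assms(1) F] assms(2) by blast
  then show "F \<in> nu_filtration n 1" using is_idealD(1)[OF assms(1) F] nu_filtration_1 by blast
qed

text \<open>Zorn's lemma: the union of a chain of ideals is an ideal, and its finite standard basis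
  already lies in one member of the chain, which is therefore the union.\<close>

lemma noetherian_maximal:
  fixes A :: "'a::field ser set set"
  assumes A: "\<And>I. I \<in> A \<Longrightarrow> is_ideal n I" and ne: "A \<noteq> {}"
  obtains M where "M \<in> A" "\<And>I. I \<in> A \<Longrightarrow> M \<subseteq> I \<Longrightarrow> I = M"
proof -
  have "\<exists>M\<in>A. \<forall>X\<in>A. M \<subseteq> X \<longrightarrow> X = M"
  proof (rule subset_Zorn_nonempty[OF ne])
    fix C assume C: "C \<noteq> {}" "subset.chain A C"
    then have CA: "C \<subseteq> A" and lin: "\<And>X Y. X \<in> C \<Longrightarrow> Y \<in> C \<Longrightarrow> X \<subseteq> Y \<or> Y \<subseteq> X"
      by (auto simp: subset.chain_def)
    have iC: "is_ideal n X" if "X \<in> C" for X using A CA that by blast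
    have iU: "is_ideal n (\<Union>C)"
      unfolding is_ideal_def
    proof (intro conjI ballI)
      show "\<Union>C \<subseteq> series n" using iC is_idealD(1) by blast
      show "0 \<in> \<Union>C" using C(1) iC is_idealD(2) by blast
    next
      fix F G assume "F \<in> \<Union>C" "G \<in> \<Union>C"
      then obtain X Y where XY: "X \<in> C" "Y \<in> C" "F \<in> X" "G \<in> Y" by blast
      from lin[OF XY(1,2)] show "F + G \<in> \<Union>C"
      proof
        assume "X \<subseteq> Y"
        then have "F + G \<in> Y" using XY is_idealD(3)[OF iC[OF XY(2)]] by blast
        then show ?thesis using XY by blast
      next
        assume "Y \<subseteq> X"
        then have "F + G \<in> X" using XY is_idealD(3)[OF iC[OF XY(1)]] by blast
        then show ?thesis using XY by blast
      qed
    next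
      fix F H :: "'a ser" assume "F \<in> \<Union>C" "H \<in> series n"
      then obtain X where X: "X \<in> C" "F \<in> X" by blast
      then have "H * F \<in> X" using is_idealD(4)[OF iC[OF X(1)]] \<open>H \<in> series n\<close> by blast
      then show "H * F \<in> \<Union>C" using X by blast
    qed
    obtain L K and g :: "nat multiset \<Rightarrow> 'a ser" where L: "finite L" "g ` L \<subseteq> \<Union>C"
      "\<forall>N F. F \<in> \<Union>C \<longrightarrow> F \<in> nu_ge n N \<longrightarrow> (\<exists>h. nu_bounded n K N L h \<and> F = (\<Sum>l\<in>L. h l * g l))"
      by (rule standard_basis[OF iU])
    have "finite (g ` L)" using L by simp
    then obtain Z where Z: "Z \<in> C" "g ` L \<subseteq> Z"
      using finite_subset_Union_chain[OF _ L(2) C] by blast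
    have "\<Union>C \<subseteq> Z"
    proof
      fix F assume F: "F \<in> \<Union>C"
      then have "F \<in> nu_ge n 0" using is_idealD(1)[OF iU] by (simp add: nu_ge_iff)
      then obtain h where h: "nu_bounded n K 0 L h" "F = (\<Sum>l\<in>L. h l * g l)" using L(3) F by blast
      have "h l * g l \<in> Z" if "l \<in> L" for l
        using h(1) Z(2) that by (intro is_idealD(4)[OF iC[OF Z(1)]]) (auto simp: nu_bounded_def)
      then show "F \<in> Z" unfolding h(2) by (intro is_ideal_sum[OF iC[OF Z(1)]])
    qed
    then have "\<Union>C = Z" using Z by blast
    then show "\<Union>C \<in> A" using Z CA by blast
  qed
  then obtain M where M: "M \<in> A" "\<forall>X\<in>A. M \<subseteq> X \<longrightarrow> X = M" by (elim bexE)
  from M(2) have "\<And>I. I \<in> A \<Longrightarrow> M \<subseteq> I \<Longrightarrow> I = M" by simp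
  with M(1) show ?thesis by (rule that)
qed

section \<open>Krull dimension from growth of colength\<close>

definition is_prime :: "nat \<Rightarrow> 'a::comm_ring_1 ser set \<Rightarrow> bool" where
  "is_prime n P \<longleftrightarrow> is_ideal n P \<and> P \<noteq> series n \<and>
    (\<forall>F\<in>series n. \<forall>G\<in>series n. F * G \<in> P \<longrightarrow> F \<in> P \<or> G \<in> P)"

text \<open>The Hilbert--Samuel function of R/I, with \<open>nu_filtration\<close> in place of the
  powers of the maximal ideal.\<close>

definition trunc_length :: "nat \<Rightarrow> 'a::field ser set \<Rightarrow> nat \<Rightarrow> nat" where
  "trunc_length n I M = colength n (isum I (nu_filtration n M))"

lemma fin_colength_isum_nu_filtration:
  assumes "is_ideal n (I :: 'a::field ser set)"
  shows "fin_colength n (isum I (nu_filtration n M))"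
  using fin_colength_mono[OF fin_colength_nu_filtration is_ideal_isum[OF assms is_ideal_nu_filtration] isum_upper(2)[OF assms is_ideal_nu_filtration]] .

lemma trunc_length_le: "is_ideal n (I :: 'a::field ser set) \<Longrightarrow> trunc_length n I M \<le> M ^ n"
  unfolding trunc_length_def
  using colength_mono[OF fin_colength_nu_filtration is_ideal_isum[OF _ is_ideal_nu_filtration] isum_upper(2)[OF _ is_ideal_nu_filtration]] colength_nu_filtration_le order_trans
  by blast

text \<open>The weak Artin--Rees property of \<open>(x)\<close> modulo \<open>P\<close>, read off a standard basis of \<open>P + (x)\<close>.\<close>

lemma artin_rees:
  fixes P :: "'a::field ser set"
  assumes P: "is_prime n P" and x: "x \<in> series n" "x \<notin> P"
  obtains c where "\<forall>M. \<forall>y\<in>series n. x * y \<in> isum P (nu_filtration n M) \<longrightarrow> y \<in> isum P (nu_filtration n (M - c))"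
proof -
  have iP: "is_ideal n P" using P by (simp add: is_prime_def)
  define I where "I = isum P (princ n x)"
  have iI: "is_ideal n I" unfolding I_def using iP x by (intro is_ideal_isum is_ideal_princ)
  obtain L K and g :: "nat multiset \<Rightarrow> 'a ser" where L: "finite L" "g ` L \<subseteq> I"
    "\<forall>N F. F \<in> I \<longrightarrow> F \<in> nu_ge n N \<longrightarrow> (\<exists>h. nu_bounded n K N L h \<and> F = (\<Sum>l\<in>L. h l * g l))"
    by (rule standard_basis[OF iI])
  have "\<forall>l\<in>L. \<exists>p r. p \<in> P \<and> r \<in> series n \<and> g l = p + x * r"
    using L(2) unfolding I_def isum_def princ_def by blast
  then obtain p r where pr: "\<And>l. l \<in> L \<Longrightarrow> p l \<in> P" "\<And>l. l \<in> L \<Longrightarrow> r l \<in> series n"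
    "\<And>l. l \<in> L \<Longrightarrow> g l = p l + x * r l" by metis
  have "y \<in> isum P (nu_filtration n (M - K))" if y: "y \<in> series n" and xy: "x * y \<in> isum P (nu_filtration n M)" for M y
  proof -
    obtain a w where aw: "a \<in> P" "w \<in> nu_filtration n M" "x * y = a + w"
      using xy unfolding isum_def by blast
    have "x * y \<in> I" "a \<in> I"
      using isum_upper[OF iP is_ideal_princ[OF x(1)]] aw(1) y unfolding I_def princ_def by blast+
    then have "x * y - a \<in> I" by (rule is_idealD(8)[OF iI])
    then have "w \<in> I" using aw(3) by simp
    then obtain h where h: "nu_bounded n K (2 ^ M) L h" "w = (\<Sum>l\<in>L. h l * g l)"
      using L(3) aw(2) unfolding nu_filtration_nu_ge by blast
    have hR: "h l \<in> series n" if "l \<in> L" for l using h(1) that by (simp add: nu_bounded_def)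
    have hD: "h l \<in> nu_filtration n (M - K)" if l: "l \<in> L" for l
      unfolding nu_filtration_nu_ge nu_ge_iff
    proof (intro conjI allI impI hR[OF l], rule ccontr)
      fix e assume e: "nu e < 2 ^ (M - K)" "coef (h l) e \<noteq> 0"
      have "2 ^ M \<le> nu e * K" using h(1) l e(2) unfolding nu_bounded_def by blast
      \<comment> \<open>Since K < 2^K, the factor K costs at most K in the index M.\<close>
      also have "\<dots> \<le> nu e * 2 ^ K" by (simp add: less_imp_le less_exp)
      finally have *: "2 ^ M \<le> nu e * 2 ^ K" .
      show False
      proof (cases "K \<le> M")
        case True
        have "nu e * 2 ^ K < 2 ^ (M - K) * 2 ^ K" using e(1) by simp
        also have "\<dots> = 2 ^ M" using True by (simp flip: power_add)
        finally show False using * by simp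
      next
        case False
        then show False using e(1) by simp
      qed
    qed
    let ?s = "\<Sum>l\<in>L. h l * r l"
    have "w = (\<Sum>l\<in>L. h l * p l) + x * ?s"
      unfolding h(2) using pr(3) by (simp add: distrib_left sum.distrib sum_distrib_left ac_simps)
    \<comment> \<open>Up to P, the series w is the multiple x * \<open>?s\<close>; so x * (y -
      \<open>?s\<close>) lies in P and primality cancels x.\<close>
    then have "x * (y - ?s) = a + (\<Sum>l\<in>L. h l * p l)"
      using aw(3) by (simp add: right_diff_distrib)
    also have "\<dots> \<in> P"
      using pr(1) hR by (intro is_idealD(3)[OF iP] aw(1) is_ideal_sum[OF iP] is_idealD(4)[OF iP])
    finally have "x * (y - ?s) \<in> P" .
    moreover have sD: "?s \<in> nu_filtration n (M - K)"
      using pr(2) hD by (intro is_ideal_sum[OF is_ideal_nu_filtration] is_idealD(5)[OF is_ideal_nu_filtration])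
    moreover have "y - ?s \<in> series n" using y is_idealD(1)[OF is_ideal_nu_filtration sD] by (rule series_closed)
    ultimately have "y - ?s \<in> P" using P x unfolding is_prime_def by blast
    then show ?thesis using sD unfolding isum_def by (intro CollectI exI[of _ "y - ?s"] exI[of _ ?s]) simp
  qed
  then show ?thesis using that by blast
qed

lemma artin_rees_power:
  fixes P :: "'a::field ser set"
  assumes x: "x \<in> series n"
    and c: "\<forall>M. \<forall>y\<in>series n. x * y \<in> isum P (nu_filtration n M) \<longrightarrow> y \<in> isum P (nu_filtration n (M - c))"
    and y: "y \<in> series n" "x ^ j * y \<in> isum P (nu_filtration n M)"
  shows "y \<in> isum P (nu_filtration n (M - j * c))"
  using y
proof (induction j arbitrary: y)
  case (Suc j)
  have "x ^ j * (x * y) \<in> isum P (nu_filtration n M)" using Suc.prems(2) by (simp add: ac_simps)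
  moreover have "x * y \<in> series n" using x Suc.prems(1) by (rule series_closed)
  ultimately have "x * y \<in> isum P (nu_filtration n (M - j * c))" using Suc.IH by blast
  then have "y \<in> isum P (nu_filtration n (M - j * c - c))" using c Suc.prems(1) by blast
  then show ?case by (simp add: algebra_simps)
qed simp

text \<open>Write D_M for \<open>nu_filtration n M\<close> and filter R/(P + D_M) by powers of some
  x in Q outside P. Each of T successive quotients is R modulo a colon ideal, which Artin--Rees
  places inside Q + D_T; so each contributes at least the truncated length of Q.\<close>

lemma trunc_length_step:
  fixes P :: "'a::field ser set"
  assumes P: "is_prime n P" and Q: "is_ideal n Q" "P \<subset> Q"
  obtains c where "\<forall>T. T * trunc_length n Q T \<le> trunc_length n P (Suc c * T)"
proof -
  have iP: "is_ideal n P" using P by (simp add: is_prime_def)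
  obtain x where xQ: "x \<in> Q" and xP: "x \<notin> P" using Q(2) by blast
  have x: "x \<in> series n" using is_idealD(1)[OF Q(1) xQ] .
  obtain c where c: "\<forall>M. \<forall>y\<in>series n. x * y \<in> isum P (nu_filtration n M) \<longrightarrow> y \<in> isum P (nu_filtration n (M - c))"
    using artin_rees[OF P x xP] by blast
  have "T * trunc_length n Q T \<le> trunc_length n P (Suc c * T)" for T
  proof -
    \<comment> \<open>Undoing up to T factors x costs c each; the surplus c * T pays for that and
      leaves depth T.\<close>
    let ?M = "Suc c * T"
    let ?I = "isum P (nu_filtration n ?M)"
    have fI: "fin_colength n ?I" using iP by (rule fin_colength_isum_nu_filtration)
    note iI = fin_colength_is_ideal[OF fI]
    have "J \<le> T \<Longrightarrow> J * trunc_length n Q T \<le> colength n (isum ?I (princ n (x ^ J)))" for J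
    proof (induction J)
      case (Suc J)
      have xJ: "x ^ J \<in> series n" "x ^ J * x \<in> series n" using x by (auto intro: series_power series_closed)
      have i2: "is_ideal n (isum ?I (princ n (x ^ J * x)))" using is_ideal_isum[OF iI is_ideal_princ[OF xJ(2)]] .
      have sub: "colon n (isum ?I (princ n (x ^ J * x))) (x ^ J) \<subseteq> isum Q (nu_filtration n T)"
      proof
        fix y assume "y \<in> colon n (isum ?I (princ n (x ^ J * x))) (x ^ J)"
        then obtain u z where y: "y \<in> series n" and u: "u \<in> ?I" and z: "z \<in> series n"
          and eq: "x ^ J * y = u + x ^ J * x * z"
          unfolding colon_def isum_def princ_def by blast
        have "x ^ J * (y - x * z) = u" using eq by (simp add: algebra_simps)
        moreover have "y - x * z \<in> series n" using x y z by (auto intro: series_closed)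
        ultimately have "y - x * z \<in> isum P (nu_filtration n (?M - J * c))"
          using artin_rees_power[OF x c] u by blast
        moreover have "T \<le> ?M - J * c"
        proof -
          have "J * c \<le> T * c" using Suc.prems by simp
          moreover have "Suc c * T = T + T * c" by (simp add: mult.commute)
          ultimately show ?thesis by linarith
        qed
        ultimately have 1: "y - x * z \<in> isum Q (nu_filtration n T)"
          using isum_mono[OF _ nu_filtration_antimono, of P Q T "?M - J * c" n] Q(2) by blast
        have "x * z \<in> Q" using xQ z by (rule is_idealD(5)[OF Q(1)])
        then have 2: "x * z \<in> isum Q (nu_filtration n T)" using isum_upper(1)[OF Q(1) is_ideal_nu_filtration] by blast
        have "(y - x * z) + x * z \<in> isum Q (nu_filtration n T)"
          by (rule is_idealD(3)[OF is_ideal_isum[OF Q(1) is_ideal_nu_filtration] 1 2])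
        then show "y \<in> isum Q (nu_filtration n T)" by simp
      qed
      have "fin_colength n (colon n (isum ?I (princ n (x ^ J * x))) (x ^ J))"
        using fin_colength_mono[OF fI is_ideal_colon[OF i2]] colon_upper[OF i2 xJ(1)] isum_upper(1)[OF iI is_ideal_princ[OF xJ(2)]]
        by blast
      then have "trunc_length n Q T \<le> colength n (colon n (isum ?I (princ n (x ^ J * x))) (x ^ J))"
        unfolding trunc_length_def using sub by (intro colength_mono is_ideal_isum[OF Q(1) is_ideal_nu_filtration])
      moreover have "J * trunc_length n Q T \<le> colength n (isum ?I (princ n (x ^ J)))" using Suc by simp
      ultimately show ?case
        using colength_isum_mult[OF fI xJ(1) x] by (simp add: mult.commute)
    qed simp
    then have "T * trunc_length n Q T \<le> colength n (isum ?I (princ n (x ^ T)))" by simp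
    also have "\<dots> \<le> trunc_length n P ?M"
      unfolding trunc_length_def using series_power[OF x, of T]
      by (intro colength_mono[OF fI] is_ideal_isum[OF iI] isum_upper(1)[OF iI] is_ideal_princ)
    finally show ?thesis .
  qed
  then show ?thesis using that by blast
qed

section \<open>Chains of primes have length at most n\<close>

lemma trunc_length_pos:
  fixes P :: "'a::field ser set"
  assumes P: "is_ideal n P" "P \<noteq> series n" and T: "T \<ge> 1"
  shows "trunc_length n P T \<ge> 1"
proof -
  have "isum P (nu_filtration n T) \<subseteq> nu_filtration n 1"
    using isum_least[OF is_ideal_nu_filtration is_ideal_le_max[OF P] nu_filtration_antimono[OF T]] .
  moreover have "(1 :: 'a ser) \<notin> nu_filtration n 1" by (simp add: nu_filtration_1[unfolded One_nat_def] coef_1)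
  ultimately have "isum P (nu_filtration n T) \<noteq> series n" using series_1[of n] by blast
  then have "trunc_length n P T \<noteq> 0" using colength_eq_0_iff[OF fin_colength_isum_nu_filtration[OF P(1)]] by (simp add: trunc_length_def)
  then show ?thesis by simp
qed

text \<open>By \<open>trunc_length_step\<close> each inclusion contributes a factor T at the cost of
  dilating the argument by a constant; the constants multiply to K.\<close>

lemma prime_chain_growth:
  fixes C :: "nat \<Rightarrow> 'a::field ser set"
  assumes "\<forall>i\<le>l. is_prime n (C i)" "\<forall>i<l. C i \<subset> C (Suc i)"
  shows "\<exists>K\<ge>1. \<forall>T\<ge>1. T ^ l \<le> trunc_length n (C 0) (K * T)"
  using assms
proof (induction l arbitrary: C)
  case 0
  then show ?case using trunc_length_pos[of n "C 0"] by (intro exI[of _ 1]) (auto simp: is_prime_def)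
next
  case (Suc l)
  have "\<exists>K\<ge>1. \<forall>T\<ge>1. T ^ l \<le> trunc_length n (C (Suc 0)) (K * T)"
    using Suc.IH[of "\<lambda>i. C (Suc i)"] Suc.prems by simp
  then obtain K where K: "K \<ge> 1" "\<And>T. T \<ge> 1 \<Longrightarrow> T ^ l \<le> trunc_length n (C 1) (K * T)" by auto
  have p: "is_prime n (C 0)" "is_ideal n (C 1)" "C 0 \<subset> C 1"
    using Suc.prems by (auto simp: is_prime_def)
  obtain c where c: "\<forall>T. T * trunc_length n (C 1) T \<le> trunc_length n (C 0) (Suc c * T)"
    using trunc_length_step[OF p] by blast
  have "T ^ Suc l \<le> trunc_length n (C 0) (Suc c * K * T)" if "T \<ge> 1" for T
  proof -
    have "T ^ Suc l \<le> K * T * trunc_length n (C 1) (K * T)"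
      using K(2)[OF that] K(1) by (simp add: mult_le_mono)
    also have "\<dots> \<le> trunc_length n (C 0) (Suc c * (K * T))" using c by blast
    finally show ?thesis by (simp only: mult.assoc)
  qed
  then show ?case using K(1) by (intro exI[of _ "Suc c * K"]) simp
qed

lemma prime_chain_length_le:
  fixes C :: "nat \<Rightarrow> 'a::field ser set"
  assumes "\<forall>i\<le>l. is_prime n (C i)" "\<forall>i<l. C i \<subset> C (Suc i)"
  shows "l \<le> n"
proof (rule ccontr)
  assume "\<not> l \<le> n"
  obtain K where K: "K \<ge> 1" "\<And>T. T \<ge> 1 \<Longrightarrow> T ^ l \<le> trunc_length n (C 0) (K * T)"
    using prime_chain_growth[OF assms] by blast
  \<comment> \<open>For l > n the two bounds on the truncated length give T \<le> K^n, which this T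
    violates.\<close>
  define T where "T = Suc (K ^ n)"
  have "T * T ^ n \<le> T ^ l"
    using \<open>\<not> l \<le> n\<close> power_increasing[of "Suc n" l T] by (simp add: T_def)
  also have "\<dots> \<le> trunc_length n (C 0) (K * T)" using K(2)[of T] by (simp add: T_def)
  also have "\<dots> \<le> (K * T) ^ n" using assms(1) by (intro trunc_length_le) (simp add: is_prime_def)
  also have "\<dots> = K ^ n * T ^ n" by (simp add: power_mult_distrib)
  finally have "T \<le> K ^ n" by (simp add: T_def)
  then show False by (simp add: T_def)
qed

text \<open>Growth not bounded by a multiple of \<open>M\<^bsup>d-1\<^esup>\<close>; the extra factor \<open>M\<close> on the right avoids
  the exponent \<open>d - 1\<close>, which would truncate for \<open>d = 0\<close>.\<close>

definition growth :: "nat \<Rightarrow> nat \<Rightarrow> 'a::field ser set \<Rightarrow> bool" where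
  "growth n d I \<longleftrightarrow> (\<forall>C. \<exists>M\<ge>1. C * M ^ d < trunc_length n I M * M)"

lemma trunc_length_colon_le:
  fixes P :: "'a::field ser set"
  assumes P: "is_ideal n P" and a: "a \<in> series n"
  shows "trunc_length n P M \<le> trunc_length n (isum P (princ n a)) M + trunc_length n (colon n P a) M"
proof -
  let ?I = "isum P (nu_filtration n M)"
  have fI: "fin_colength n ?I" using P by (rule fin_colength_isum_nu_filtration)
  note iI = fin_colength_is_ideal[OF fI]
  have iPa: "is_ideal n (isum P (princ n a))" using P a by (intro is_ideal_isum is_ideal_princ)
  have iIa: "is_ideal n (isum ?I (princ n a))" using is_ideal_isum[OF iI is_ideal_princ[OF a]] .
  have sub1: "isum (isum P (princ n a)) (nu_filtration n M) \<subseteq> isum ?I (princ n a)"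
    using isum_upper[OF P is_ideal_nu_filtration, of M] isum_upper[OF iI is_ideal_princ[OF a]]
    by (intro isum_least[OF iIa]) blast+
  have sub2: "isum (colon n P a) (nu_filtration n M) \<subseteq> colon n ?I a"
  proof (rule isum_least[OF is_ideal_colon[OF iI]])
    show "colon n P a \<subseteq> colon n ?I a"
      using isum_upper(1)[OF P is_ideal_nu_filtration] by (auto simp: colon_def)
    show "nu_filtration n M \<subseteq> colon n ?I a"
      using isum_upper(2)[OF P is_ideal_nu_filtration] colon_upper[OF iI a] by blast
  qed
  have "trunc_length n P M = colength n (isum ?I (princ n a)) + colength n (colon n ?I a)"
    unfolding trunc_length_def by (rule colength_colon[OF fI a])
  also have "colength n (isum ?I (princ n a)) \<le> trunc_length n (isum P (princ n a)) M"
    unfolding trunc_length_def by (rule colength_mono[OF fin_colength_isum_nu_filtration[OF iPa] iIa sub1])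
  also have "colength n (colon n ?I a) \<le> trunc_length n (colon n P a) M"
    unfolding trunc_length_def by (rule colength_mono[OF fin_colength_isum_nu_filtration[OF is_ideal_colon[OF P]] is_ideal_colon[OF iI] sub2])
  finally show ?thesis by simp
qed

text \<open>Let P be maximal among the ideals above I with this growth. If FG lies in P but neither
  factor does, then P + (F) and P : F are strictly larger and fail the growth condition; by
  \<open>trunc_length_colon_le\<close> their bounds add up to one for P.\<close>

lemma growth_prime:
  fixes I :: "'a::field ser set"
  assumes I: "is_ideal n I" "growth n d I"
  obtains P where "is_prime n P" "I \<subseteq> P" "growth n d P"
proof -
  let ?A = "{P. is_ideal n P \<and> I \<subseteq> P \<and> growth n d P}"
  obtain P where P: "P \<in> ?A" and max: "\<And>Q. Q \<in> ?A \<Longrightarrow> P \<subseteq> Q \<Longrightarrow> Q = P"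
    using noetherian_maximal[of ?A n] I by auto
  have iP: "is_ideal n P" and gP: "growth n d P" and IP: "I \<subseteq> P" using P by auto
  have "P \<noteq> series n"
  proof
    assume eq: "P = series n"
    obtain M where "0 * M ^ d < trunc_length n P M * M" using gP unfolding growth_def by blast
    then have "trunc_length n P M \<noteq> 0" by auto
    moreover have "isum P (nu_filtration n M) = series n"
      using isum_upper(1)[OF iP is_ideal_nu_filtration] is_idealD(1)[OF is_ideal_isum[OF iP is_ideal_nu_filtration]] eq by blast
    ultimately show False using colength_eq_0_iff[OF fin_colength_isum_nu_filtration[OF iP], of M] by (simp add: trunc_length_def)
  qed
  moreover have "F \<in> P \<or> G \<in> P" if FG: "F \<in> series n" "G \<in> series n" "F * G \<in> P" for F G
  proof (rule ccontr)
    assume neg: "\<not> (F \<in> P \<or> G \<in> P)"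
    have i1: "is_ideal n (isum P (princ n F))" using iP FG by (intro is_ideal_isum is_ideal_princ)
    have i2: "is_ideal n (colon n P F)" using iP by (rule is_ideal_colon)
    have s1: "P \<subseteq> isum P (princ n F)" "F \<in> isum P (princ n F)"
      using isum_upper[OF iP is_ideal_princ[OF FG(1)]] princ_self by blast+
    have s2: "P \<subseteq> colon n P F" "G \<in> colon n P F"
      using colon_upper[OF iP FG(1)] FG by (auto simp: colon_def)
    have "\<not> growth n d (isum P (princ n F))" using max[of "isum P (princ n F)"] i1 s1 neg IP by blast
    then obtain C1 where C1: "\<And>M. M \<ge> 1 \<Longrightarrow> trunc_length n (isum P (princ n F)) M * M \<le> C1 * M ^ d"
      unfolding growth_def by (auto simp: not_less)
    have "\<not> growth n d (colon n P F)" using max[of "colon n P F"] i2 s2 neg IP by blast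
    then obtain C2 where C2: "\<And>M. M \<ge> 1 \<Longrightarrow> trunc_length n (colon n P F) M * M \<le> C2 * M ^ d"
      unfolding growth_def by (auto simp: not_less)
    obtain M where M: "M \<ge> 1" "(C1 + C2) * M ^ d < trunc_length n P M * M" using gP unfolding growth_def by blast
    have "trunc_length n P M * M \<le> (trunc_length n (isum P (princ n F)) M + trunc_length n (colon n P F) M) * M"
      using trunc_length_colon_le[OF iP FG(1)] by (intro mult_right_mono) auto
    also have "\<dots> \<le> C1 * M ^ d + C2 * M ^ d"
      using C1[OF M(1)] C2[OF M(1)] by (simp add: distrib_right)
    also have "\<dots> = (C1 + C2) * M ^ d" by (simp add: distrib_right)
    finally show False using M(2) by simp
  qed
  ultimately have "is_prime n P" using iP by (simp add: is_prime_def)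
  then show ?thesis using that IP gP by blast
qed

text \<open>The power x^M lies in \<open>nu_filtration n M\<close>, so M steps of the filtration by
  powers of x exhaust the truncated quotient.\<close>

lemma trunc_length_le_mult:
  fixes P :: "'a::field ser set"
  assumes P: "is_ideal n P" and x: "x \<in> nu_filtration n 1"
  shows "trunc_length n P M \<le> M * trunc_length n (isum P (princ n x)) M"
proof -
  let ?I = "isum P (nu_filtration n M)"
  have fI: "fin_colength n ?I" using P by (rule fin_colength_isum_nu_filtration)
  note iI = fin_colength_is_ideal[OF fI]
  have xR: "x \<in> series n" using x nu_filtration_1 by blast
  have iPx: "is_ideal n (isum P (princ n x))" using P xR by (intro is_ideal_isum is_ideal_princ)
  have iIx: "is_ideal n (isum ?I (princ n x))" using is_ideal_isum[OF iI is_ideal_princ[OF xR]] .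
  have "x ^ M \<in> ?I" using nu_filtration_power[OF x] isum_upper(2)[OF P is_ideal_nu_filtration] by blast
  then have "princ n (x ^ M) \<subseteq> ?I" by (rule princ_least[OF iI])
  then have eq: "isum ?I (princ n (x ^ M)) = ?I"
    using isum_least[OF iI order_refl] isum_upper(1)[OF iI is_ideal_princ[OF series_power[OF xR]]] by blast
  have "trunc_length n P M \<le> M * colength n (isum ?I (princ n x))"
    using colength_isum_power_le[OF fI xR, of M] unfolding eq trunc_length_def .
  also have "colength n (isum ?I (princ n x)) \<le> trunc_length n (isum P (princ n x)) M"
    unfolding trunc_length_def
  proof (rule colength_mono[OF fin_colength_isum_nu_filtration[OF iPx] iIx])
    show "isum (isum P (princ n x)) (nu_filtration n M) \<subseteq> isum ?I (princ n x)"
      using isum_upper[OF P is_ideal_nu_filtration, of M] isum_upper[OF iI is_ideal_princ[OF xR]]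
      by (intro isum_least[OF iIx]) blast+
  qed
  finally show ?thesis by simp
qed

lemma colength_max: "colength n (nu_filtration n 1 :: 'a::field ser set) = 1"
  using colength_frob_ideal[of 1 n, where 'a = 'a] by (simp add: nu_filtration_1_eq_frob_ideal[unfolded One_nat_def])

text \<open>Start with a prime P above I of the same growth. Adding an element x of the maximal
  ideal outside P costs at most one degree, and the induction hypothesis for P + (x) supplies the
  rest of the chain.\<close>

lemma growth_chain:
  fixes I :: "'a::field ser set"
  assumes "is_ideal n I" "growth n d I"
  shows "\<exists>C. (\<forall>i\<le>d. is_prime n (C i) \<and> I \<subseteq> C i) \<and> (\<forall>i<d. C i \<subset> C (Suc i))"
  using assms
proof (induction d arbitrary: I)
  case 0
  obtain P where "is_prime n P" "I \<subseteq> P" using growth_prime[OF 0] by blast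
  then show ?case by (intro exI[of _ "\<lambda>_. P"]) simp
next
  case (Suc d)
  obtain P where P: "is_prime n P" "I \<subseteq> P" "growth n (Suc d) P" using growth_prime[OF Suc.prems] by blast
  have iP: "is_ideal n P" using P by (simp add: is_prime_def)
  obtain x where x: "x \<in> nu_filtration n 1" "x \<notin> P"
  proof (rule ccontr)
    assume "\<not> thesis"
    then have sub: "nu_filtration n 1 \<subseteq> P" using that by blast
    \<comment> \<open>If P contained the maximal ideal, its truncated length would be at most 1,
      contradicting the growth condition for the constant 1.\<close>
    obtain M where M: "M \<ge> 1" "1 * M ^ Suc d < trunc_length n P M * M" using P(3) unfolding growth_def by blast
    have "nu_filtration n 1 \<subseteq> isum P (nu_filtration n M)" using sub isum_upper(1)[OF iP is_ideal_nu_filtration] by blast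
    then have "trunc_length n P M \<le> 1"
      using colength_mono[OF fin_colength_nu_filtration is_ideal_isum[OF iP is_ideal_nu_filtration]] colength_max[of n, where 'a = 'a] unfolding trunc_length_def by metis
    then have "trunc_length n P M * M \<le> M" by simp
    moreover have "M \<le> M ^ Suc d" using M(1) by simp
    ultimately show False using M(2) by linarith
  qed
  have xR: "x \<in> series n" using x nu_filtration_1 by blast
  let ?Q = "isum P (princ n x)"
  have iQ: "is_ideal n ?Q" using iP xR by (intro is_ideal_isum is_ideal_princ)
  have "growth n d ?Q"
    unfolding growth_def
  proof
    fix C
    obtain M where M: "M \<ge> 1" "C * M ^ Suc d < trunc_length n P M * M" using P(3) unfolding growth_def by blast
    have "M * (C * M ^ d) < trunc_length n P M * M" using M(2) by (simp add: ac_simps)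
    also have "\<dots> \<le> (M * trunc_length n ?Q M) * M" using trunc_length_le_mult[OF iP x(1)] by (rule mult_right_mono) simp
    finally have "M * (C * M ^ d) < M * (trunc_length n ?Q M * M)" by (simp add: ac_simps)
    then have "C * M ^ d < trunc_length n ?Q M * M" by simp
    then show "\<exists>M\<ge>1. C * M ^ d < trunc_length n ?Q M * M" using M(1) by blast
  qed
  then obtain C where C: "\<forall>i\<le>d. is_prime n (C i) \<and> ?Q \<subseteq> C i" "\<forall>i<d. C i \<subset> C (Suc i)"
    using Suc.IH[OF iQ] by blast
  have PQ: "P \<subset> ?Q"
    using isum_upper[OF iP is_ideal_princ[OF xR]] princ_self[of x n] x(2) by blast
  define D where "D i = (case i of 0 \<Rightarrow> P | Suc j \<Rightarrow> C j)" for i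
  have "is_prime n (D i) \<and> I \<subseteq> D i" if "i \<le> Suc d" for i
  proof (cases i)
    case (Suc j)
    then have "is_prime n (C j)" "?Q \<subseteq> C j" using C(1) that by auto
    then show ?thesis using Suc PQ P(2) by (auto simp: D_def)
  qed (use P in \<open>simp add: D_def\<close>)
  moreover have "D i \<subset> D (Suc i)" if "i < Suc d" for i
  proof (cases i)
    case 0
    have "?Q \<subseteq> C 0" using C(1) by blast
    then show ?thesis using PQ 0 by (auto simp: D_def)
  next
    case (Suc j)
    then show ?thesis using C(2) that by (simp add: D_def)
  qed
  ultimately show ?case by (intro exI[of _ D]) blast
qed

text \<open>On the box of side q, nu is at most w^q, where w is the product of the primes attached
  to the n variables; hence a constant factor K with w < 2^K suffices.\<close>

lemma nu_filtration_le_frob_ideal: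
  obtains K where "K \<ge> 1" "\<forall>q\<ge>1. (nu_filtration n (K * q) :: 'a::comm_ring_1 ser set) \<subseteq> frob_ideal n q"
proof -
  have pos: "0 < enumerate {p::nat. prime p} i" for i using prime_enumerate prime_gt_0_nat by blast
  define w where "w = (\<Prod>i<n. enumerate {p::nat. prime p} i)"
  define K where "K = Suc w"
  have box: "nu e < 2 ^ (K * q)" if e: "e \<in> exponents n" "\<forall>i. count e i < q" and q: "q \<ge> 1" for e q
  proof -
    have "nu e = (\<Prod>i\<in>set_mset e. enumerate {p::nat. prime p} i ^ count e i)"
      by (simp add: nu_def image_prod_mset_multiplicity)
    also have "\<dots> = (\<Prod>i<n. enumerate {p::nat. prime p} i ^ count e i)"
      using e(1) by (intro prod.mono_neutral_left) (auto simp: exponents_def not_in_iff)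
    also have "\<dots> \<le> (\<Prod>i<n. enumerate {p::nat. prime p} i ^ q)"
      using e(2) pos by (intro prod_mono conjI power_increasing) (auto simp: less_imp_le Suc_leI)
    also have "\<dots> = w ^ q" by (simp add: w_def prod_power_distrib)
    also have "\<dots> < (2 ^ K) ^ q"
    proof (rule power_strict_mono)
      have "w < 2 ^ w" by (rule less_exp)
      also have "\<dots> \<le> 2 ^ K" by (simp add: K_def)
      finally show "w < 2 ^ K" .
    qed (use q in auto)
    finally show ?thesis by (simp add: power_mult)
  qed
  have "(nu_filtration n (K * q) :: 'a ser set) \<subseteq> frob_ideal n q" if q: "q \<ge> 1" for q
  proof
    fix F :: "'a ser" assume F: "F \<in> nu_filtration n (K * q)"
    then have FR: "F \<in> series n" and z: "\<And>e. nu e < 2 ^ (K * q) \<Longrightarrow> coef F e = 0"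
      by (auto simp: nu_filtration_def vanish_def)
    have "coef F e = 0" if "\<forall>i. count e i < q" for e
      using z[OF box[OF _ that q]] series_coef[OF FR, of e] by blast
    with FR show "F \<in> frob_ideal n q" unfolding frob_ideal_def vanish_def by blast
  qed
  then show ?thesis using that[of K] by (simp add: K_def)
qed

lemma growth_of_hk_length:
  fixes f :: "'a::field ser"
  assumes f: "f \<in> series n" and p: "p \<ge> 2"
    and hk_length: "\<And>k. (p ^ k) ^ d \<le> hk_length n f (p ^ k)"
  shows "growth n d (princ n f)"
  unfolding growth_def
proof
  fix C
  obtain K where K: "K \<ge> 1" "\<forall>q\<ge>1. (nu_filtration n (K * q) :: 'a ser set) \<subseteq> frob_ideal n q"
    by (rule nu_filtration_le_frob_ideal)
  \<comment> \<open>Chosen so that C * (K * q)^d = k * q^d; as k < 2^k \<le> q, this is below q *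
    q^d.\<close>
  define k where "k = C * K ^ d"
  define q where "q = p ^ k"
  have "k < 2 ^ k" by (rule less_exp)
  also have "\<dots> \<le> q" using p by (simp add: q_def power_mono)
  finally have kq: "k < q" .
  then have q1: "q \<ge> 1" by simp
  have iF: "is_ideal n (princ n f)" using f by (rule is_ideal_princ)
  have ij: "is_ideal n (frob_ideal n q :: 'a ser set)" by (rule is_ideal_frob_ideal) (use q1 in simp)
  have "isum (princ n f) (nu_filtration n (K * q)) \<subseteq> isum (frob_ideal n q) (princ n f)"
    using isum_upper[OF ij iF] K(2) q1 by (intro isum_least[OF is_ideal_isum[OF ij iF]]) blast+
  then have "hk_length n f q \<le> trunc_length n (princ n f) (K * q)"
    unfolding hk_length_def trunc_length_def by (intro colength_mono fin_colength_isum_nu_filtration iF is_ideal_isum ij)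
  then have le: "q ^ d \<le> trunc_length n (princ n f) (K * q)" using hk_length[of k] unfolding q_def by linarith
  have "C * (K * q) ^ d = k * q ^ d" by (simp add: k_def power_mult_distrib)
  also have "\<dots> < q * q ^ d" using kq q1 by simp
  also have "\<dots> \<le> (K * q) * trunc_length n (princ n f) (K * q)"
    using le K(1) by (intro mult_le_mono) auto
  finally have "C * (K * q) ^ d < trunc_length n (princ n f) (K * q) * (K * q)" by (simp add: mult.commute)
  moreover have "K * q \<ge> 1" using K(1) q1 by simp
  ultimately show "\<exists>M\<ge>1. C * M ^ d < trunc_length n (princ n f) M * M" by blast
qed

section \<open>Transfer to the concrete power series and conclusion\<close>

lemma colength_strict_mono:
  assumes I: "fin_colength n I" and J: "is_ideal n J" and less: "I \<subset> J"
  shows "colength n J < colength n I"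
proof -
  have "ser.fin_codim J I"
    using ser.fin_codim_sub[of "series n" I J] I is_idealD(1)[OF J] is_ideal_subspace[OF fin_colength_is_ideal[OF I]] by (auto simp: fin_colength_def)
  then have "ser.rel_dim J I \<noteq> 0"
    using ser.rel_dim_eq_0_iff[OF _ is_ideal_subspace[OF fin_colength_is_ideal[OF I]], of J] less by blast
  then show ?thesis using colength_add[OF I J] less by auto
qed

lemma ideal_chain_length_le:
  assumes J: "fin_colength n (C 0)" and C: "\<forall>i\<le>l. is_ideal n (C i)" "\<forall>i<l. C i \<subset> C (Suc i)"
  shows "l \<le> colength n (C 0)"
proof -
  have "i \<le> l \<Longrightarrow> C 0 \<subseteq> C i \<and> i + colength n (C i) \<le> colength n (C 0)" for i
  proof (induction i)
    case (Suc i)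
    then have IH: "C 0 \<subseteq> C i" "i + colength n (C i) \<le> colength n (C 0)" by auto
    have "fin_colength n (C i)" using fin_colength_mono[OF J _ IH(1)] C(1) Suc.prems by simp
    then have "colength n (C (Suc i)) < colength n (C i)"
      using C Suc.prems by (intro colength_strict_mono) auto
    moreover have "C i \<subset> C (Suc i)" using C(2) Suc.prems by simp
    ultimately show ?case using IH by auto
  qed simp
  from this[of l] show ?thesis by simp
qed

text \<open>Take F outside J carried into J by \<open>nu_filtration n k\<close> with k as small as
  possible. Were H * F outside J for some H in the maximal ideal, it would be such an element for k
  - 1.\<close>

lemma socle_element:
  fixes J :: "'a::field ser set"
  assumes J: "is_ideal n J" "J \<noteq> series n" and D: "nu_filtration n M \<subseteq> J"
  obtains F where "F \<in> series n" "F \<notin> J" "\<And>H. H \<in> nu_filtration n 1 \<Longrightarrow> H * F \<in> J"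
proof -
  let ?P = "\<lambda>k. \<exists>F\<in>series n. F \<notin> J \<and> (\<forall>H\<in>nu_filtration n k. H * F \<in> J)"
  obtain F0 where F0: "F0 \<in> series n" "F0 \<notin> J" using J is_idealD(1)[OF J(1)] by blast
  have "?P M" using F0 D is_idealD(5)[OF J(1)] by blast
  then have Pk: "?P (LEAST k. ?P k)" by (rule LeastI)
  define k where "k = (LEAST k. ?P k)"
  obtain F where F: "F \<in> series n" "F \<notin> J" "\<And>H. H \<in> nu_filtration n k \<Longrightarrow> H * F \<in> J"
    using Pk unfolding k_def[symmetric] by blast
  have k0: "k \<noteq> 0"
  proof
    assume "k = 0"
    then have "1 * F \<in> J" using F(3)[of 1] by (simp add: nu_filtration_0)
    with F show False by simp
  qed
  have "H * F \<in> J" if H: "H \<in> nu_filtration n 1" for H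
  proof (rule ccontr)
    assume HF: "H * F \<notin> J"
    have "H' * (H * F) \<in> J" if "H' \<in> nu_filtration n (k - 1)" for H'
    proof -
      have "H' * H \<in> nu_filtration n k" using nu_filtration_mult[OF that H] k0 by simp
      then show ?thesis using F(3) by (simp add: mult.assoc[symmetric])
    qed
    moreover have "H * F \<in> series n" using H F(1) nu_filtration_1 series_closed(3) by blast
    ultimately have "?P (k - 1)" using HF by blast
    then have "k \<le> k - 1" unfolding k_def by (rule Least_le)
    with k0 show False by simp
  qed
  then show ?thesis using that[OF F(1,2)] by blast
qed

text \<open>Modulo J, a series acts on a socle element F through its constant term, so J + kF is
  already an ideal and adds a single dimension.\<close>

lemma ideal_step:
  fixes J :: "'a::field ser set"
  assumes J: "fin_colength n J" "J \<noteq> series n" and D: "nu_filtration n M \<subseteq> J"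
  obtains J' where "is_ideal n J'" "J \<subset> J'" "colength n J = Suc (colength n J')"
proof -
  note iJ = fin_colength_is_ideal[OF J(1)]
  obtain F where F: "F \<in> series n" "F \<notin> J" "\<And>H. H \<in> nu_filtration n 1 \<Longrightarrow> H * F \<in> J"
    using socle_element[OF iJ J(2) D] by blast
  define J' where "J' = {j + scale_ser c F |j c. j \<in> J}"
  have i: "is_ideal n J'"
    unfolding is_ideal_def
  proof (intro conjI ballI)
    show "J' \<subseteq> series n" using is_idealD(1)[OF iJ] F(1) by (auto simp: J'_def intro!: series_closed)
    show "0 \<in> J'" unfolding J'_def using is_idealD(2)[OF iJ] by (intro CollectI exI[of _ 0]) simp
  next
    fix A B assume "A \<in> J'" "B \<in> J'"
    then obtain a b c d where ab: "a \<in> J" "b \<in> J" "A = a + scale_ser c F" "B = b + scale_ser d F"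
      unfolding J'_def by blast
    then have "A + B = (a + b) + scale_ser (c + d) F" by (simp add: ser.scale_left_distrib)
    then show "A + B \<in> J'" unfolding J'_def using is_idealD(3)[OF iJ ab(1,2)] by blast
  next
    fix A H :: "'a ser" assume "A \<in> J'" and H: "H \<in> series n"
    then obtain a c where a: "a \<in> J" "A = a + scale_ser c F" unfolding J'_def by blast
    let ?h = "coef H {#}"
    have H1: "H - scale_ser ?h 1 \<in> nu_filtration n 1"
      unfolding nu_filtration_1 using H by (auto simp: coef_1 intro!: series_closed)
    have "H * A = (H * a + scale_ser c ((H - scale_ser ?h 1) * F)) + scale_ser (c * ?h) F"
      unfolding a(2) by (simp add: distrib_left left_diff_distrib scale_ser_mult ser.scale_right_diff_distrib)
    moreover have "H * a + scale_ser c ((H - scale_ser ?h 1) * F) \<in> J"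
      using is_idealD(3)[OF iJ is_idealD(4)[OF iJ a(1) H] is_idealD(6)[OF iJ F(3)[OF H1]]] .
    ultimately show "H * A \<in> J'" unfolding J'_def by blast
  qed
  have sub: "J \<subseteq> J'" unfolding J'_def by (force intro: exI[of _ 0])
  have FJ': "F \<in> J'" unfolding J'_def using is_idealD(2)[OF iJ] by (intro CollectI exI[of _ 0] exI[of _ 1]) simp
  with sub F(2) have less: "J \<subset> J'" by blast
  have "J' \<subseteq> ser.span (J \<union> {F})"
  proof
    fix A assume "A \<in> J'"
    then obtain a c where a: "a \<in> J" "A = a + scale_ser c F" unfolding J'_def by blast
    show "A \<in> ser.span (J \<union> {F})"
      unfolding a(2) by (intro ser.span_add ser.span_scale ser.span_base) (use a in auto)
  qed
  then have "ser.rel_dim J' J \<le> 1" using ser.rel_dim_le[of "{F}" J' J] FJ' by simp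
  then have "colength n J = Suc (colength n J')"
    using colength_strict_mono[OF J(1) i less] colength_add[OF J(1) i sub] by simp
  then show ?thesis using that[OF i less] by blast
qed

lemma ideal_chain_exists:
  fixes J :: "'a::field ser set"
  assumes "fin_colength n J" "nu_filtration n M \<subseteq> J"
  shows "\<exists>C. C 0 = J \<and> C (colength n J) = series n \<and> (\<forall>i\<le>colength n J. is_ideal n (C i)) \<and> (\<forall>i<colength n J. C i \<subset> C (Suc i))"
  using assms
proof (induction "colength n J" arbitrary: J)
  case 0
  then show ?case using colength_eq_0_iff[of n J] fin_colength_is_ideal[of n J] by (intro exI[of _ "\<lambda>_. J"]) simp
next
  case (Suc l)
  have "J \<noteq> series n" using Suc.hyps(2) colength_eq_0_iff[OF Suc.prems(1)] by auto
  then obtain J' where J': "is_ideal n J'" "J \<subset> J'" "colength n J = Suc (colength n J')"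
    using ideal_step[OF Suc.prems(1) _ Suc.prems(2)] by blast
  have f': "fin_colength n J'" using fin_colength_mono[OF Suc.prems(1) J'(1)] J'(2) by blast
  have l: "l = colength n J'" using J'(3) Suc.hyps(2) by simp
  have "nu_filtration n M \<subseteq> J'" using Suc.prems(2) J'(2) by blast
  from Suc.hyps(1)[OF l f' this] obtain C where
    C: "C 0 = J'" "C l = series n" "\<forall>i\<le>l. is_ideal n (C i)" "\<forall>i<l. C i \<subset> C (Suc i)"
    unfolding l[symmetric] by blast
  define D where "D i = (case i of 0 \<Rightarrow> J | Suc j \<Rightarrow> C j)" for i
  have "\<forall>i\<le>Suc l. is_ideal n (D i)" using C(3) fin_colength_is_ideal[OF Suc.prems(1)] by (auto simp: D_def split: nat.split)
  moreover have "\<forall>i<Suc l. D i \<subset> D (Suc i)" using C(1,4) J'(2) by (auto simp: D_def split: nat.split)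
  ultimately show ?case using C(2) Suc.hyps(2)[symmetric] by (intro exI[of _ D]) (simp add: D_def)
qed

text \<open>Exponents of infinite support are given coefficient 0; there the sum in \<^const>\<open>ps_mult\<close> may
  range over an infinite set, in which case it is 0 as well.\<close>

definition of_ser :: "'a::comm_ring_1 ser \<Rightarrow> 'a mps" where
  "of_ser G = (\<lambda>e. if finite {i. e i \<noteq> 0} then coef G (Abs_multiset e) else 0)"

lemma exponent_cases:
  fixes e :: "nat \<Rightarrow> nat"
  obtains m where "e = count m" | "infinite {i. e i \<noteq> 0}"
proof (cases "finite {i. e i \<noteq> 0}")
  case True
  then have "count (Abs_multiset e) = e" by (simp add: Abs_multiset_inverse)
  then show ?thesis using that(1)[of "Abs_multiset e"] by simp
next
  case False
  then show ?thesis by (rule that(2))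
qed

lemma of_ser_count [simp]: "of_ser G (count m) = coef G m"
proof -
  have "{i. count m i \<noteq> 0} = set_mset m" by (auto simp: not_in_iff)
  then show ?thesis by (simp add: of_ser_def count_inverse)
qed

lemma of_ser_infinite [simp]: "infinite {i. e i \<noteq> 0} \<Longrightarrow> of_ser G e = 0"
  by (simp add: of_ser_def)

lemma mps_eqI:
  assumes "\<And>m. F (count m) = G (count m)" "\<And>e. infinite {i. e i \<noteq> 0} \<Longrightarrow> F e = G e"
  shows "F = (G :: 'a mps)"
proof
  fix e :: "nat \<Rightarrow> nat"
  show "F e = G e" by (cases e rule: exponent_cases) (use assms in auto)
qed

lemma inj_of_ser: "inj of_ser"
proof (rule injI, rule ser_eqI)
  fix F G :: "'a ser" and m assume "of_ser F = of_ser G"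
  then have "of_ser F (count m) = of_ser G (count m)" by simp
  then show "coef F m = coef G m" by simp
qed

lemma of_ser_zero: "of_ser 0 = ps_zero"
  by (rule mps_eqI) (auto simp: ps_zero_def)

lemma count_eq_zero_iff: "count m = (\<lambda>_. 0) \<longleftrightarrow> m = {#}"
  by (auto simp: multiset_eq_iff fun_eq_iff)

lemma of_ser_one: "of_ser 1 = ps_one"
  by (rule mps_eqI) (auto simp: ps_one_def coef_1 count_eq_zero_iff)

lemma of_ser_add: "of_ser (F + G) = ps_add (of_ser F) (of_ser G)"
  by (rule mps_eqI) (auto simp: ps_add_def)

lemma of_ser_scale_ser: "of_ser (scale_ser c F) = ps_smult c (of_ser F)"
  by (rule mps_eqI) (auto simp: ps_smult_def)

lemma of_ser_const: "ps_const_term (of_ser F) = coef F {#}"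
proof -
  have "count {#} = (\<lambda>_ :: nat. 0)" by auto
  then show ?thesis unfolding ps_const_term_def using of_ser_count[of F "{#}"] by metis
qed

lemma of_ser_mult: "of_ser (F * G) = ps_mult (of_ser F) (of_ser G)"
proof (rule mps_eqI)
  fix m :: "nat multiset"
  have "{d. \<forall>i. d i \<le> count m i} = count ` {d. d \<subseteq># m}"
  proof (intro equalityI subsetI)
    fix d assume d: "d \<in> {d. \<forall>i. d i \<le> count m i}"
    have "{i. d i \<noteq> 0} \<subseteq> set_mset m"
    proof
      fix i assume "i \<in> {i. d i \<noteq> 0}"
      then have "d i \<noteq> 0" by simp
      moreover have "d i \<le> count m i" using d by blast
      ultimately have "0 < count m i" by linarith
      then show "i \<in># m" by simp
    qed
    then have "finite {i. d i \<noteq> 0}" using finite_subset by blast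
    then obtain d' where d': "d = count d'" by (cases d rule: exponent_cases) auto
    then have "d' \<subseteq># m" using d by (simp add: subseteq_mset_def)
    with d' show "d \<in> count ` {d. d \<subseteq># m}" by blast
  qed (auto simp: mset_subset_eq_count)
  then have "ps_mult (of_ser F) (of_ser G) (count m) =
      (\<Sum>d\<in>count ` {d. d \<subseteq># m}. of_ser F d * of_ser G (\<lambda>i. count m i - d i))"
    by (simp add: ps_mult_def)
  also have "\<dots> = (\<Sum>d\<in>{d. d \<subseteq># m}. of_ser F (count d) * of_ser G (\<lambda>i. count m i - count d i))"
    by (subst sum.reindex) (auto simp: inj_on_def count_inject)
  also have "\<dots> = (\<Sum>d\<in>{d. d \<subseteq># m}. coef F d * coef G (m - d))"
  proof (rule sum.cong)
    fix d :: "nat multiset"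
    have "(\<lambda>i. count m i - count d i) = count (m - d)" by auto
    then show "of_ser F (count d) * of_ser G (\<lambda>i. count m i - count d i) = coef F d * coef G (m - d)" by simp
  qed simp
  finally show "of_ser (F * G) (count m) = ps_mult (of_ser F) (of_ser G) (count m)"
    by (simp add: coef_mult sum_splits)
next
  fix e :: "nat \<Rightarrow> nat" assume inf: "infinite {i. e i \<noteq> 0}"
  have "ps_mult (of_ser F) (of_ser G) e = 0"
    unfolding ps_mult_def
  proof (rule sum.neutral, rule ballI)
    fix d :: "nat \<Rightarrow> nat"
    \<comment> \<open>An infinite support is not covered by two finite ones, so one factor of every
      summand vanishes.\<close>
    have "{i. e i \<noteq> 0} \<subseteq> {i. d i \<noteq> 0} \<union> {i. e i - d i \<noteq> 0}" by auto
    then have "infinite {i. d i \<noteq> 0} \<or> infinite {i. e i - d i \<noteq> 0}"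
      using inf finite_subset by blast
    then show "of_ser F d * of_ser G (\<lambda>i. e i - d i) = 0"
      using of_ser_infinite[of d F] of_ser_infinite[of "\<lambda>i. e i - d i" G] by auto
  qed
  with inf show "of_ser (F * G) e = ps_mult (of_ser F) (of_ser G) e" by simp
qed

lemma of_ser_power: "of_ser (F ^ k) = ps_pow (of_ser F) k"
  by (induction k) (auto simp: ps_pow_def of_ser_one of_ser_mult)

lemma of_ser_mem_ring: "of_ser F \<in> ps_ring n \<longleftrightarrow> F \<in> series n"
proof -
  have exponents: "(\<exists>i\<ge>n. count m i \<noteq> 0) \<longleftrightarrow> m \<notin> exponents n" for m
    by (auto simp: exponents_def not_less) (metis count_eq_zero_iff count_inI)?
  show ?thesis
  proof
    assume F: "of_ser F \<in> ps_ring n"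
    have "coef F m = 0" if "m \<notin> exponents n" for m
      using F that exponents[of m] unfolding ps_ring_def by (metis (mono_tags, lifting) mem_Collect_eq of_ser_count)
    then show "F \<in> series n" unfolding series_def by blast
  next
    assume F: "F \<in> series n"
    have "of_ser F e = 0" if "\<exists>i\<ge>n. e i \<noteq> 0" for e
    proof (cases e rule: exponent_cases)
      case (1 m)
      then show ?thesis using that exponents[of m] series_coef[OF F, of m] by simp
    qed simp
    then show "of_ser F \<in> ps_ring n" unfolding ps_ring_def by blast
  qed
qed

text \<open>An exponent of infinite support involves a variable of index at least n, so a member of
  \<open>ps_ring n\<close> vanishes there and is determined by its values on multisets.\<close>

lemma ps_ring_of_ser:
  assumes "F \<in> ps_ring n"
  obtains G where "G \<in> series n" "F = of_ser G"
proof -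
  have "F = of_ser (Ser (\<lambda>m. F (count m)))"
  proof (rule mps_eqI)
    fix e :: "nat \<Rightarrow> nat" assume inf: "infinite {i. e i \<noteq> 0}"
    have "\<exists>i\<ge>n. e i \<noteq> 0"
    proof (rule ccontr)
      assume "\<not> ?thesis"
      then have "{i. e i \<noteq> 0} \<subseteq> {..<n}" by (auto simp: not_less[symmetric])
      then show False using inf finite_subset by blast
    qed
    then have "F e = 0" using assms unfolding ps_ring_def by blast
    then show "F e = of_ser (Ser (\<lambda>m. F (count m))) e" using inf by simp
  qed simp
  then show ?thesis using that assms of_ser_mem_ring by metis
qed

lemma ps_ring_eq: "ps_ring n = of_ser ` series n"
proof (intro equalityI subsetI)
  fix F :: "'a mps" assume "F \<in> ps_ring n"
  then show "F \<in> of_ser ` series n" by (rule ps_ring_of_ser) simp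
qed (auto simp: of_ser_mem_ring)

lemma of_ser_mem_image: "of_ser F \<in> of_ser ` I \<longleftrightarrow> F \<in> I"
  by (rule inj_image_mem_iff[OF inj_of_ser])

section \<open>Ideals, lengths and dimensions in the concrete ring\<close>

lemma ps_ideal_of_ser: "ps_ideal n (of_ser ` I) \<longleftrightarrow> is_ideal n I"
  unfolding ps_ideal_def is_ideal_def ps_ring_eq
  by (simp add: of_ser_mem_image inj_image_subset_iff[OF inj_of_ser]
      flip: of_ser_zero of_ser_add of_ser_mult)

lemma ps_ideal_eq:
  assumes "ps_ideal n J"
  obtains I where "is_ideal n I" "J = of_ser ` I"
proof -
  have "J \<subseteq> of_ser ` series n" using assms unfolding ps_ideal_def ps_ring_eq by blast
  then have "J = of_ser ` (of_ser -` J)" by blast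
  with assms show ?thesis using that ps_ideal_of_ser by metis
qed

lemma ps_prime_of_ser: "ps_prime n (of_ser ` P) \<longleftrightarrow> is_prime n P"
  unfolding ps_prime_def is_prime_def ps_ring_eq ps_ideal_of_ser
  by (simp add: of_ser_mem_image inj_image_eq_iff[OF inj_of_ser] flip: of_ser_mult)

lemma ps_gen_of_ser:
  assumes I: "is_ideal n I" "S \<subseteq> I" "\<And>I'. is_ideal n I' \<Longrightarrow> S \<subseteq> I' \<Longrightarrow> I \<subseteq> I'"
  shows "ps_gen n (of_ser ` S) = of_ser ` I"
proof -
  have "of_ser ` I \<subseteq> J" if J: "ps_ideal n J" "of_ser ` S \<subseteq> J" for J
  proof -
    obtain I' where I': "is_ideal n I'" "J = of_ser ` I'" using ps_ideal_eq[OF J(1)] by blast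
    then have "S \<subseteq> I'" using J(2) inj_image_subset_iff[OF inj_of_ser] by blast
    then show ?thesis using I(3) I' by blast
  qed
  moreover have "ps_ideal n (of_ser ` I)" "of_ser ` S \<subseteq> of_ser ` I"
    using I by (auto simp: ps_ideal_of_ser)
  ultimately show ?thesis unfolding ps_gen_def by blast
qed

lemma ps_gen_princ:
  assumes "f \<in> series n"
  shows "ps_gen n {of_ser f} = of_ser ` princ n f"
proof -
  have "ps_gen n (of_ser ` {f}) = of_ser ` princ n f"
    using assms by (intro ps_gen_of_ser is_ideal_princ) (auto simp: princ_self dest: princ_least)
  then show ?thesis by simp
qed

text \<open>Every strict inclusion lowers the colength by at least 1, and adjoining socle elements
  gives a chain in which it drops by exactly 1 each time.\<close>

lemma ps_quot_length_of_ser: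
  fixes J :: "'a::field ser set"
  assumes J: "fin_colength n J" "nu_filtration n M \<subseteq> J"
  shows "ps_quot_length n (of_ser ` J) = enat (colength n J)"
  unfolding ps_quot_length_def
proof (rule antisym)
  show "Sup {enat l |l. \<exists>C. C 0 = of_ser ` J \<and> C l = ps_ring n \<and> (\<forall>i\<le>l. ps_ideal n (C i)) \<and>
      (\<forall>i<l. C i \<subset> C (Suc i))} \<le> enat (colength n J)"
  proof (rule Sup_least, clarify)
    fix l and C :: "nat \<Rightarrow> 'a mps set"
    assume C: "C 0 = of_ser ` J" "\<forall>i\<le>l. ps_ideal n (C i)" "\<forall>i<l. C i \<subset> C (Suc i)"
    define D where "D i = of_ser -` C i" for i
    have CD: "C i = of_ser ` D i" if i: "i \<le> l" for i
    proof -
      have "ps_ideal n (C i)" using C(2) i by blast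
      then obtain I where "C i = of_ser ` I" using ps_ideal_eq by metis
      then show ?thesis by (auto simp: D_def)
    qed
    have D0: "D 0 = J" unfolding D_def C(1) using inj_vimage_image_eq[OF inj_of_ser] by blast
    have "\<forall>i\<le>l. is_ideal n (D i)" using C(2) CD ps_ideal_of_ser by metis
    moreover have "\<forall>i<l. D i \<subset> D (Suc i)"
    proof (intro allI impI)
      fix i assume i: "i < l"
      then have "C i \<subset> C (Suc i)" using C(3) by blast
      then have "of_ser ` D i \<subset> of_ser ` D (Suc i)" using CD[of i] CD[of "Suc i"] i by simp
      then show "D i \<subset> D (Suc i)" using inj_image_subset_iff[OF inj_of_ser] by blast
    qed
    ultimately have "l \<le> colength n (D 0)" using J(1) D0 by (intro ideal_chain_length_le) auto
    then show "enat l \<le> enat (colength n J)" using D0 by simp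
  qed
  obtain C where C: "C 0 = J" "C (colength n J) = series n" "\<forall>i\<le>colength n J. is_ideal n (C i)"
    "\<forall>i<colength n J. C i \<subset> C (Suc i)"
    using ideal_chain_exists[OF J] by blast
  have "\<forall>i<colength n J. of_ser ` C i \<subset> of_ser ` C (Suc i)"
    using C(4) by (intro allI impI image_strict_mono inj_on_subset[OF inj_of_ser subset_UNIV]) blast
  then show "enat (colength n J) \<le> Sup {enat l |l. \<exists>C. C 0 = of_ser ` J \<and> C l = ps_ring n \<and>
      (\<forall>i\<le>l. ps_ideal n (C i)) \<and> (\<forall>i<l. C i \<subset> C (Suc i))}"
    using C(1-3) by (intro Sup_upper CollectI exI[of _ "colength n J"] conjI refl exI[of _ "\<lambda>i. of_ser ` C i"])
      (auto simp: ps_ring_eq ps_ideal_of_ser)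
qed

lemma ps_quot_dim_le:
  fixes I :: "'a::field ser set"
  shows "ps_quot_dim n (of_ser ` I) \<le> enat n"
  unfolding ps_quot_dim_def
proof (rule Sup_least, clarify)
  fix l and C :: "nat \<Rightarrow> 'a mps set"
  assume C: "\<forall>i\<le>l. ps_prime n (C i) \<and> of_ser ` I \<subseteq> C i" "\<forall>i<l. C i \<subset> C (Suc i)"
  define D where "D i = of_ser -` C i" for i
  have CD: "C i = of_ser ` D i" if "i \<le> l" for i
  proof -
    have "ps_ideal n (C i)" using C(1) that unfolding ps_prime_def by blast
    then obtain I where "C i = of_ser ` I" using ps_ideal_eq by metis
    then show ?thesis by (auto simp: D_def)
  qed
  have "\<forall>i\<le>l. is_prime n (D i)" using C(1) CD ps_prime_of_ser by metis
  moreover have "\<forall>i<l. D i \<subset> D (Suc i)"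
  proof (intro allI impI)
    fix i assume i: "i < l"
    then have "C i \<subset> C (Suc i)" using C(2) by blast
    then have "of_ser ` D i \<subset> of_ser ` D (Suc i)" using CD[of i] CD[of "Suc i"] i by simp
    then show "D i \<subset> D (Suc i)" using inj_image_subset_iff[OF inj_of_ser] by blast
  qed
  ultimately show "enat l \<le> enat n" using prime_chain_length_le by simp
qed

lemma ps_quot_dim_ge:
  fixes I :: "'a::field ser set"
  assumes "is_ideal n I" "growth n d I"
  shows "enat d \<le> ps_quot_dim n (of_ser ` I)"
proof -
  obtain C where C: "\<forall>i\<le>d. is_prime n (C i) \<and> I \<subseteq> C i" "\<forall>i<d. C i \<subset> C (Suc i)"
    using growth_chain[OF assms] by blast
  have "\<forall>i<d. of_ser ` C i \<subset> of_ser ` C (Suc i)"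
    using C(2) by (intro allI impI image_strict_mono inj_on_subset[OF inj_of_ser subset_UNIV]) blast
  moreover have "\<forall>i\<le>d. ps_prime n (of_ser ` C i) \<and> of_ser ` I \<subseteq> of_ser ` C i"
    using C(1) by (simp add: ps_prime_of_ser image_mono)
  ultimately show ?thesis unfolding ps_quot_dim_def
    by (intro Sup_upper CollectI exI[of _ d] conjI refl exI[of _ "\<lambda>i. of_ser ` C i"])
qed

lemma ps_max_ideal_eq: "ps_max_ideal n = of_ser ` nu_filtration n 1"
proof -
  have "of_ser F \<in> ps_max_ideal n \<longleftrightarrow> F \<in> nu_filtration n 1" for F :: "'a ser"
    unfolding nu_filtration_1 ps_max_ideal_def by (simp add: of_ser_mem_ring of_ser_const)
  moreover have "ps_max_ideal n \<subseteq> range (of_ser :: 'a ser \<Rightarrow> _)"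
    using ps_ring_of_ser unfolding ps_max_ideal_def by blast
  ultimately show ?thesis by blast
qed

text \<open>The q-th powers of elements of the maximal ideal lie in the ideal of the x_i^q because
  Frobenius is additive, and the x_i^q are themselves such powers.\<close>

lemma ps_frob_quot_eq:
  fixes f :: "'a::field ser"
  assumes f: "f \<in> series n" and p: "prime CHAR('a)"
  shows "ps_frob_quot n (of_ser ` princ n f) (CHAR('a) ^ k) = of_ser ` isum (frob_ideal n (CHAR('a) ^ k)) (princ n f)"
proof -
  let ?q = "CHAR('a) ^ k"
  have q: "?q > 0" using p prime_gt_0_nat by simp
  have "of_ser ` princ n f \<union> {ps_pow F ?q |F. F \<in> ps_max_ideal n} =
      of_ser ` (princ n f \<union> (\<lambda>F. F ^ ?q) ` nu_filtration n 1)"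
  proof -
    have "{ps_pow F ?q |F. F \<in> (ps_max_ideal n :: 'a mps set)} = (\<lambda>F. ps_pow (of_ser F) ?q) ` nu_filtration n 1"
      unfolding ps_max_ideal_eq by blast
    then show ?thesis by (simp only: image_Un image_image of_ser_power)
  qed
  moreover have "ps_gen n (of_ser ` (princ n f \<union> (\<lambda>F. F ^ ?q) ` nu_filtration n 1)) = of_ser ` isum (frob_ideal n ?q) (princ n f)"
  proof (rule ps_gen_of_ser)
    show "is_ideal n (isum (frob_ideal n ?q) (princ n f))" using fin_colength_hk_length[OF f q] by blast
    have "F ^ ?q \<in> frob_ideal n ?q" if "F \<in> nu_filtration n 1" for F :: "'a ser"
      using frob_ideal_frob[of F n 1 k] that p nu_filtration_1_eq_frob_ideal by auto
    then show "princ n f \<union> (\<lambda>F. F ^ ?q) ` nu_filtration n 1 \<subseteq> isum (frob_ideal n ?q) (princ n f)"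
      using isum_upper[OF is_ideal_frob_ideal[OF q] is_ideal_princ[OF f]] by blast
    fix I :: "'a ser set" assume I: "is_ideal n I" "princ n f \<union> (\<lambda>F. F ^ ?q) ` nu_filtration n 1 \<subseteq> I"
    have "frob_ideal n ?q \<subseteq> I"
    proof
      fix F :: "'a ser" assume "F \<in> frob_ideal n ?q"
      then obtain G where G: "\<And>i. G i \<in> series n" "F = (\<Sum>i<n. xmonom (replicate_mset ?q i) * G i)"
        using frob_ideal_decomp[OF _ q] by blast
      have "xmonom (replicate_mset ?q i) \<in> I" if "i < n" for i
      proof -
        have "(xmonom {#i#} :: 'a ser) \<in> nu_filtration n 1"
          unfolding nu_filtration_1 using that by (auto simp: coef_mono exponents_def intro: series_mono)
        then have "(xmonom {#i#} :: 'a ser) ^ ?q \<in> I" using I(2) by blast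
        moreover have "repeat_mset ?q {#i#} = replicate_mset ?q i" by (rule multiset_eqI) simp
        ultimately show ?thesis by (simp add: mono_power)
      qed
      then show "F \<in> I" unfolding G(2) using G(1) by (intro is_ideal_sum[OF I(1)] is_idealD(5)[OF I(1)]) auto
    qed
    then show "isum (frob_ideal n ?q) (princ n f) \<subseteq> I" using I(2) by (intro isum_least[OF I(1)]) auto
  qed
  ultimately show ?thesis unfolding ps_frob_quot_def by simp
qed

section \<open>The Hilbert--Kunz multiplicity as a limit of normalised lengths\<close>

lemma eHK_eq:
  fixes f :: "'a::field ser"
  assumes f: "f \<in> series n" and p: "prime CHAR('a)"
  shows "eHK n (of_ser ` princ n f) = lim (\<lambda>k. real (hk_length n f (CHAR('a) ^ k)) /
    real (CHAR('a) ^ k) ^ the_enat (ps_quot_dim n (of_ser ` princ n f)))"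
proof -
  have "ps_quot_length n (ps_frob_quot n (of_ser ` princ n f) (CHAR('a) ^ k)) = enat (hk_length n f (CHAR('a) ^ k))" for k
  proof -
    let ?q = "CHAR('a) ^ k"
    have q: "?q > 0" using p prime_gt_0_nat by simp
    obtain K where K: "K \<ge> 1" "\<forall>q\<ge>1. (nu_filtration n (K * q) :: 'a ser set) \<subseteq> frob_ideal n q"
      by (rule nu_filtration_le_frob_ideal)
    have "nu_filtration n (K * ?q) \<subseteq> isum (frob_ideal n ?q) (princ n f)"
      using K(2) q fin_colength_hk_length(2)[OF f q] by (metis Suc_leI One_nat_def order_trans)
    then show ?thesis
      unfolding ps_frob_quot_eq[OF f p] hk_length_def using fin_colength_hk_length(3)[OF f q] by (intro ps_quot_length_of_ser)
  qed
  then show ?thesis unfolding eHK_def by simp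
qed

lemma hk_length_step:
  fixes f :: "'a::field ser"
  assumes f: "f \<in> series n" and p: "prime CHAR('a)" and n: "n \<ge> 1"
  shows "CHAR('a) ^ (n - 1) * hk_length n f (CHAR('a) ^ k) \<le> hk_length n f (CHAR('a) ^ Suc k)"
proof -
  let ?p = "CHAR('a)"
  have p0: "?p > 0" using p prime_gt_0_nat by blast
  have "?p * (?p ^ (n - 1) * hk_length n f (?p ^ k)) = ?p ^ n * hk_length n f (?p ^ k)"
    using n by (cases n) simp_all
  also have "\<dots> \<le> ?p * hk_length n f (?p ^ Suc k)"
    using hk_length_frob_le[OF f _ p, of "?p ^ k"] p0 by (simp add: mult.commute)
  finally show ?thesis using p0 by simp
qed

text \<open>Starting from the value 1 at q = 1, each Frobenius step gains a factor p^(n-1).\<close>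

lemma hk_length_ge:
  fixes f :: "'a::field ser"
  assumes f: "f \<in> nu_filtration n 1" and p: "prime CHAR('a)" and n: "n \<ge> 1"
  shows "(CHAR('a) ^ k) ^ (n - 1) \<le> hk_length n f (CHAR('a) ^ k)"
proof (induction k)
  case 0
  then show ?case using hk_length_1[OF f] by simp
next
  case (Suc k)
  have fR: "f \<in> series n" using f nu_filtration_1 by blast
  have "(CHAR('a) ^ Suc k) ^ (n - 1) = CHAR('a) ^ (n - 1) * (CHAR('a) ^ k) ^ (n - 1)"
    by (simp add: power_mult_distrib)
  also have "\<dots> \<le> CHAR('a) ^ (n - 1) * hk_length n f (CHAR('a) ^ k)" using Suc by simp
  also have "\<dots> \<le> hk_length n f (CHAR('a) ^ Suc k)" by (rule hk_length_step[OF fR p n])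
  finally show ?case .
qed

lemma hk_length_convergent:
  fixes f :: "'a::field ser"
  assumes f: "f \<in> series n" "f \<noteq> 0" and p: "prime CHAR('a)" and n: "n \<ge> 1"
  obtains L where "(\<lambda>k. real (hk_length n f (CHAR('a) ^ k)) / real (CHAR('a) ^ k) ^ (n - 1)) \<longlonglongrightarrow> L"
proof -
  let ?p = "CHAR('a)"
  have p0: "?p > 0" using p prime_gt_0_nat by blast
  let ?s = "\<lambda>k. real (hk_length n f (?p ^ k)) / real (?p ^ k) ^ (n - 1)"
  have "incseq ?s"
  proof (rule incseq_SucI)
    fix k
    have "real (?p ^ (n - 1)) * real (hk_length n f (?p ^ k)) \<le> real (hk_length n f (?p ^ Suc k))"
      using hk_length_step[OF f(1) p n, of k] by (metis of_nat_le_iff of_nat_mult)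
    moreover have "real (?p ^ Suc k) ^ (n - 1) = real (?p ^ (n - 1)) * real (?p ^ k) ^ (n - 1)"
      by (simp add: power_mult_distrib)
    ultimately show "?s k \<le> ?s (Suc k)" using p0 by (simp add: field_simps del: power_Suc)
  qed
  moreover obtain C where C: "\<And>q. q > 0 \<Longrightarrow> hk_length n f q \<le> C * q ^ (n - 1)"
    using hk_length_bound[OF f n] by blast
  have "\<forall>k. ?s k \<le> real C"
  proof
    fix k
    have "real (hk_length n f (?p ^ k)) \<le> real (C * (?p ^ k) ^ (n - 1))"
      using C[of "?p ^ k"] p0 by (metis of_nat_le_iff zero_less_power)
    then show "?s k \<le> real C" using p0 by (simp add: divide_le_eq)
  qed
  ultimately obtain L where "?s \<longlonglongrightarrow> L" using incseq_convergent by blast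
  then show ?thesis using that by blast
qed

text \<open>A nonzero polynomial in one variable has finitely many roots, so proper closed sets are
  finite.\<close>

lemma zariski_dense_infinite:
  assumes "infinite (A :: 'a::field set)"
  shows "zariski_dense A"
  unfolding zariski_dense_def
proof (intro allI impI, elim conjE)
  fix S :: "'a set" assume "zariski_closed S" and sub: "A \<subseteq> S"
  then obtain P where P: "S = {x. \<forall>p\<in>P. poly p x = 0}" unfolding zariski_closed_def by blast
  have "p = 0" if "p \<in> P" for p
  proof (rule ccontr)
    assume "p \<noteq> 0"
    then have "finite {x. poly p x = 0}" by (rule poly_roots_finite)
    moreover have "A \<subseteq> {x. poly p x = 0}" using sub P that by blast
    ultimately show False using assms finite_subset by blast
  qed
  then have "\<forall>p\<in>P. poly p x = 0" for x by (metis poly_0)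
  then show "S = UNIV" unfolding P by blast
qed

theorem theorem2p7:
  fixes f g :: "'a::alg_closed_field mps" and n :: nat
  assumes "uncountable (UNIV :: 'a set)"
    and "CHAR('a) > 0"
    and "f \<in> ps_ring n" and "g \<in> ps_ring n"
    and "f \<in> ps_max_ideal n"
    and "ps_quot_dim n (ps_gen n {f}) = enat (n - 1)"
    and "g \<noteq> ps_zero" and "ps_const_term g = 0"
    and "g \<notin> {ps_smult c f | c. True}"
  shows "\<exists>\<Lambda> :: 'a set. zariski_dense \<Lambda> \<and>
           (\<forall>\<alpha>\<in>\<Lambda>. eHK n (ps_gen n {ps_add f (ps_smult \<alpha> g)}) \<le> eHK n (ps_gen n {f}))"
proof -
  let ?p = "CHAR('a)"
  have p: "prime ?p" using assms(2) by (rule prime_CHAR_semidom)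
  have p2: "?p \<ge> 2" using p prime_ge_2_nat by blast
  obtain f' where f': "f' \<in> series n" "f = of_ser f'" using ps_ring_of_ser[OF assms(3)] by blast
  obtain g' where g': "g' \<in> series n" "g = of_ser g'" using ps_ring_of_ser[OF assms(4)] by blast
  have fm: "f' \<in> nu_filtration n 1" using assms(5) unfolding ps_max_ideal_eq f'(2) of_ser_mem_image .
  have gm: "g' \<in> nu_filtration n 1" unfolding nu_filtration_1 using g'(1) assms(8) unfolding g'(2) of_ser_const by blast
  have g0: "g' \<noteq> 0" using assms(7) g'(2) of_ser_zero by auto
  \<comment> \<open>For n = 0 every series is constant, so g(0) = 0 would force g = 0. From here on
    n - 1 is a true predecessor.\<close>
  have n: "n \<ge> 1"
  proof (rule ccontr)
    assume "\<not> n \<ge> 1"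
    then have "n = 0" by simp
    then have "exponents n = {{#}}" by (simp add: exponents_def)
    then have "coef g' e = coef 0 e" for e
      using gm series_coef[OF g'(1), of e] unfolding nu_filtration_1 by (cases "e = {#}") auto
    then show False using g0 ser_eqI by blast
  qed
  have gen_f: "ps_gen n {f} = of_ser ` princ n f'" unfolding f'(2) by (rule ps_gen_princ[OF f'(1)])
  \<comment> \<open>For f = 0 the lengths are the full q^n, and the growth criterion would make the
    dimension at least n rather than n - 1.\<close>
  have f0: "f' \<noteq> 0"
  proof
    assume f0: "f' = 0"
    have "(?p ^ k) ^ n \<le> hk_length n f' (?p ^ k)" for k
    proof -
      have q: "?p ^ k > 0" using p2 by simp
      have i: "is_ideal n (frob_ideal n (?p ^ k) :: 'a ser set)" using q by (rule is_ideal_frob_ideal)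
      have "isum (frob_ideal n (?p ^ k)) (princ n f') \<subseteq> frob_ideal n (?p ^ k)"
        unfolding f0 by (rule isum_least[OF i order_refl princ_least[OF i is_idealD(2)[OF i]]])
      then have "colength n (frob_ideal n (?p ^ k) :: 'a ser set) \<le> hk_length n f' (?p ^ k)"
        unfolding hk_length_def using fin_colength_hk_length(3)[OF f'(1) q] i by (intro colength_mono)
      then show ?thesis using colength_frob_ideal[OF q, of n, where 'a = 'a] by simp
    qed
    then have "growth n n (princ n f')" using f'(1) p2 by (intro growth_of_hk_length)
    then have "enat n \<le> ps_quot_dim n (of_ser ` princ n f')"
      by (intro ps_quot_dim_ge is_ideal_princ f'(1))
    then show False using assms(6) n unfolding gen_f by simp
  qed
  obtain Lf where Lf: "(\<lambda>k. real (hk_length n f' (?p ^ k)) / real (?p ^ k) ^ (n - 1)) \<longlonglongrightarrow> Lf"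
    using hk_length_convergent[OF f'(1) f0 p n] by blast
  have eHK_f: "eHK n (ps_gen n {f}) = Lf"
    using eHK_eq[OF f'(1) p] assms(6) limI[OF Lf] unfolding gen_f by simp
  have Lf0: "0 \<le> Lf" by (rule LIMSEQ_le_const[OF Lf]) auto
  \<comment> \<open>There is one finite exceptional set for each k; the union is countable, so its
    complement in the uncountable field is infinite.\<close>
  define bad where "bad = (\<Union>k. {\<alpha>. hk_length n f' (?p ^ k) < hk_length n (f' + scale_ser \<alpha> g') (?p ^ k)})"
  have "countable bad"
    unfolding bad_def
  proof (rule countable_UN)
    show "countable {\<alpha>. hk_length n f' (?p ^ k) < hk_length n (f' + scale_ser \<alpha> g') (?p ^ k)}" for k
      by (rule countable_finite[OF hk_length_semicont[OF f'(1) g'(1)]]) (use p2 in simp)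
  qed simp
  have "infinite (- bad)"
  proof
    assume "finite (- bad)"
    then have "countable (bad \<union> - bad)" by (intro countable_Un[OF \<open>countable bad\<close>] countable_finite)
    then show False using assms(1) by simp
  qed
  moreover have "eHK n (ps_gen n {ps_add f (ps_smult \<alpha> g)}) \<le> eHK n (ps_gen n {f})" if \<alpha>: "\<alpha> \<in> - bad" for \<alpha>
  proof -
    let ?F = "f' + scale_ser \<alpha> g'"
    have F: "?F \<in> series n" using f'(1) g'(1) by (auto intro: series_closed)
    have Fm: "?F \<in> nu_filtration n 1" using fm gm by (intro is_idealD(3)[OF is_ideal_nu_filtration] is_idealD(6)[OF is_ideal_nu_filtration])
    \<comment> \<open>For \<alpha> = 0 this is f \<noteq> 0; otherwise f + \<alpha>g = 0 would make
      g a scalar multiple of f.\<close>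
    have F0: "?F \<noteq> 0"
    proof
      assume z: "?F = 0"
      show False
      proof (cases "\<alpha> = 0")
        case True
        then show False using z f0 by simp
      next
        case False
        have "f' = - scale_ser \<alpha> g'" using z by (simp add: eq_neg_iff_add_eq_0)
        then have "scale_ser (- inverse \<alpha>) f' = g'"
          using False by (intro ser_eqI) simp
        then have "g = ps_smult (- inverse \<alpha>) f" unfolding f'(2) g'(2) of_ser_scale_ser[symmetric] by simp
        then show False using assms(9) by blast
      qed
    qed
    have gen_F: "ps_gen n {ps_add f (ps_smult \<alpha> g)} = of_ser ` princ n ?F"
      unfolding f'(2) g'(2) of_ser_scale_ser[symmetric] of_ser_add[symmetric] by (rule ps_gen_princ[OF F])
    obtain LF where LF: "(\<lambda>k. real (hk_length n ?F (?p ^ k)) / real (?p ^ k) ^ (n - 1)) \<longlonglongrightarrow> LF"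
      using hk_length_convergent[OF F F0 p n] by blast
    have le: "hk_length n ?F (?p ^ k) \<le> hk_length n f' (?p ^ k)" for k
      using \<alpha> unfolding bad_def by (auto simp: not_less)
    have "LF \<le> Lf"
    proof (rule LIMSEQ_le[OF LF Lf], intro exI[of _ 0] allI impI)
      show "real (hk_length n ?F (?p ^ k)) / real (?p ^ k) ^ (n - 1) \<le> real (hk_length n f' (?p ^ k)) / real (?p ^ k) ^ (n - 1)" for k
        using le[of k] by (intro divide_right_mono) simp_all
    qed
    \<comment> \<open>The two-sided bound makes the dimension finite, so that
      \<open>the_enat\<close> returns it, and leaves only d = n - 1 and d = n.\<close>
    have "growth n (n - 1) (princ n ?F)"
      using F p2 hk_length_ge[OF Fm p n] by (intro growth_of_hk_length)
    then have "enat (n - 1) \<le> ps_quot_dim n (of_ser ` princ n ?F)"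
      by (intro ps_quot_dim_ge is_ideal_princ F)
    moreover have "ps_quot_dim n (of_ser ` princ n ?F) \<le> enat n" by (rule ps_quot_dim_le)
    ultimately obtain d where d: "ps_quot_dim n (of_ser ` princ n ?F) = enat d" "n - 1 \<le> d" "d \<le> n"
      by (cases "ps_quot_dim n (of_ser ` princ n ?F)") auto
    have eHK_F: "eHK n (of_ser ` princ n ?F) = lim (\<lambda>k. real (hk_length n ?F (?p ^ k)) / real (?p ^ k) ^ d)"
      using eHK_eq[OF F p] d(1) by simp
    show ?thesis
    proof (cases "d = n - 1")
      case True
      then show ?thesis using eHK_F limI[OF LF] \<open>LF \<le> Lf\<close> unfolding gen_F eHK_f by simp
    next
      case False
      \<comment> \<open>For d = n the denominator has one more factor q than in the convergent
        sequence, so the limit is 0, which is at most \<open>Lf\<close>.\<close>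
      then have dn: "d = Suc (n - 1)" using d by simp
      have "(\<lambda>k. inverse (real ?p ^ k)) \<longlonglongrightarrow> 0"
        using p2 by (intro LIMSEQ_inverse_realpow_zero) simp
      from tendsto_mult[OF LF this]
      have "(\<lambda>k. real (hk_length n ?F (?p ^ k)) / real (?p ^ k) ^ d) \<longlonglongrightarrow> 0"
        unfolding dn by (simp add: field_simps)
      then show ?thesis using eHK_F limI Lf0 unfolding gen_F eHK_f by metis
    qed
  qed
  ultimately show ?thesis using zariski_dense_infinite by blast
qed

end
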